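(* Let $S$ be a closed, bounded from below, densely defined symmetric operator on a separable Hilbert space $\mathcal H$ with finite and equal defect numbers $(n,n)$, and let $(\mathcal K,\Gamma_0,\Gamma_1)$ be a boundary triplet for $S$. Let $\mathcal L_1,\mathcal L_2$ be the Lagrangian planes in $(\mathcal K\oplus\mathcal K,\omega)$ corresponding to self-adjoint extensions $H_1$, $H_2$ of $S$. For $\lambda\in\rho(H_1)\cap\rho(H_2)\cap\mathbb R$ define $$D(\lambda):=(H_1-\lambda)^{-1}-(H_2-\lambda)^{-1},$$ and let $\mathcal N_\lambda:=\ker(S^*-\lambda)$ and $\mathcal M(\lambda):=\{(\Gamma_0f,\Gamma_1f):f\in\mathcal N_\lambda\}$. Then $$n_-\big(D(\lambda)\big)=\iota\big(\mathcal L_1,\mathcal L_2,\mathcal M(\lambda)\big),\qquad n_+\big(D(\lambda)\big)=\iota\big(\mathcal L_2,\mathcal L_1,\mathcal M(\lambda)\big),$$ $$n_0\big(D(\lambda)|_{\mathcal N_\lambda}\big)=\dim(\mathcal L_1\cap\mathcal L_2).$$ In addition, $D(\lambda)$ has constant rank given by $$\operatorname{rank}\big(D(\lambda)\big)=n-\dim(\mathcal L_1\cap\mathcal L_2),$$ while the functions $\lambda\mapsto n_\pm(D(\lambda))$ are locally constant on $\rho(H_1)\cap\rho(H_2)\cap\mathbb R$.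
   Context: All inner products are linear in the second argument. $\rho(\cdot)$ is the resolvent set. For a self-adjoint operator $T$, $n_0(T),n_+(T),n_-(T)$ denote the number of zero, positive and negative eigenvalues (with multiplicity), whenever finite. A boundary triplet $(\mathcal K,\Gamma_0,\Gamma_1)$ for $S$ consists of an $n$-dimensional complex Hilbert space $\mathcal K$ and linear maps $\Gamma_0,\Gamma_1:\operatorname{dom}(S^* )\to\mathcal K$ such that $\mathbf\Gamma f:=(\Gamma_0f,\Gamma_1f)$ defines a surjection $\operatorname{dom}(S^* )\to\mathcal K\oplus\mathcal K$ and $\langle f,S^*g\rangle_{\mathcal H}-\langle S^*f,g\rangle_{\mathcal H}=\langle\Gamma_0f,\Gamma_1g\rangle_{\mathcal K}-\langle\Gamma_1f,\Gamma_0g\rangle_{\mathcal K}$ for all $f,g\in\operatorname{dom}(S^* )$. The symplectic form on $\mathcal K\oplus\mathcal K$ is $\omega(u,v)=\langle u_0,v_1\rangle_{\mathcal K}-\langle u_1,v_0\rangle_{\mathcal K}$. A subspace $\mathcal L\subset\mathcal K\oplus\mathcal K$ is a Lagrangian plane if $\mathcal L=\{u:\omega(u,v)=0\ \forall v\in\mathcal L\}$. Self-adjoint extensions $H$ of $S$ are in one-to-one correspondence with Lagrangian planes $\mathcal L$ via $\operatorname{dom}(H)=\{f\in\operatorname{dom}(S^* ):\mathbf\Gamma f\in\mathcal L\}$ (and $H=S^*|_{\operatorname{dom}(H)}$). For real $\lambda$ in the resolvent set of some self-adjoint extension, $\mathcal M(\lambda)$ is a Lagrangian plane. Duistermaat index: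 for Lagrangian planes $\alpha,\beta,\gamma$ with $\alpha\cap\beta=0=\beta\cap\gamma$, $\gamma$ is the graph $\{u+Lu:u\in\alpha\}$ of a linear map $L:\alpha\to\beta$; let $Q(\alpha,\beta;\gamma)$ be the Hermitian form $(u_1,u_2)\mapsto\omega(u_1,Lu_2)$ on $\alpha$, and let $n_-$ of a Hermitian form be the maximal dimension of a subspace on which it is negative definite. For arbitrary Lagrangian planes $\mathcal L_1,\mathcal L_2,\mathcal L_3$, choose a Lagrangian plane $\hat{\mathcal L}$ transversal to all three and set $\iota(\mathcal L_1,\mathcal L_2,\mathcal L_3):=n_-(Q(\mathcal L_2,\hat{\mathcal L};\mathcal L_3))-n_-(Q(\mathcal L_1,\hat{\mathcal L};\mathcal L_3))+n_-(Q(\mathcal L_1,\hat{\mathcal L};\mathcal L_2))$, which does not depend on the choice of $\hat{\mathcal L}$. *)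

theory Defs
  imports "HOL-Analysis.Analysis"
begin

section \<open>Complex Hilbert spaces\<close>

class scaleC =
  fixes scaleC :: "complex \<Rightarrow> 'a \<Rightarrow> 'a"  (infixr "*\<^sub>C" 75)

class complex_vector = real_vector + scaleC +
  assumes scaleC_add_right: "a *\<^sub>C (x + y) = a *\<^sub>C x + a *\<^sub>C y"
    and scaleC_add_left: "(a + b) *\<^sub>C x = a *\<^sub>C x + b *\<^sub>C x"
    and scaleC_scaleC: "a *\<^sub>C b *\<^sub>C x = (a * b) *\<^sub>C x"
    and scaleC_one: "1 *\<^sub>C x = x"
    and scaleR_scaleC: "r *\<^sub>R x = complex_of_real r *\<^sub>C x"

text \<open>The inner product is linear in the second argument.\<close>

class complex_inner = complex_vector + real_normed_vector +
  fixes cinner :: "'a \<Rightarrow> 'a \<Rightarrow> complex"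
  assumes cinner_commute: "cinner x y = cnj (cinner y x)"
    and cinner_add_right: "cinner x (y + z) = cinner x y + cinner x z"
    and cinner_scaleC_right: "cinner x (a *\<^sub>C y) = a * cinner x y"
    and cinner_self: "cinner x x = complex_of_real ((norm x)\<^sup>2)"

class chilbert_space = complex_inner + complete_space

global_interpretation complex_vector:
  vector_space "scaleC :: complex \<Rightarrow> 'a \<Rightarrow> 'a :: complex_vector"
  defines csubspace = complex_vector.subspace
    and cspan = complex_vector.span
    and cdim = complex_vector.dim
  by unfold_locales (simp_all add: scaleC_add_right scaleC_add_left scaleC_scaleC scaleC_one)

instantiation prod :: (complex_vector, complex_vector) complex_vector
begin

definition scaleC_prod :: "complex \<Rightarrow> 'a \<times> 'b \<Rightarrow> 'a \<times> 'b"
  where "scaleC_prod a u = (a *\<^sub>C fst u, a *\<^sub>C snd u)"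

instance
  by standard (simp_all add: scaleC_prod_def scaleC_add_right scaleC_add_left
      scaleC_scaleC scaleC_one scaleR_prod_def scaleR_scaleC)

end

text \<open>The library's dimension is \<open>0\<close> on infinite-dimensional spaces; the extended dimension
  is \<open>\<infinity>\<close> there.\<close>

definition edim :: "'a::complex_vector set \<Rightarrow> enat"
  where "edim V = (if \<exists>B. finite B \<and> V \<subseteq> cspan B then enat (cdim V) else \<infinity>)"


section \<open>Unbounded operators\<close>

text \<open>An operator in a Hilbert space is identified with its graph, so that \<^term>\<open>Domain T\<close> is its
  domain, \<^prop>\<open>(f, f') \<in> T\<close> means \<open>f' = T f\<close>, and extension of operators is inclusion.\<close>

definition linear_operator :: "('h::complex_vector \<times> 'h) set \<Rightarrow> bool"
  where "linear_operator T \<longleftrightarrow> csubspace T \<and> single_valued T"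

definition densely_defined :: "('h::chilbert_space \<times> 'h) set \<Rightarrow> bool"
  where "densely_defined T \<longleftrightarrow> closure (Domain T) = UNIV"

definition symmetric_operator :: "('h::chilbert_space \<times> 'h) set \<Rightarrow> bool"
  where "symmetric_operator T \<longleftrightarrow>
    (\<forall>(f, f') \<in> T. \<forall>(g, g') \<in> T. cinner f g' = cinner f' g)"

definition bounded_from_below :: "('h::chilbert_space \<times> 'h) set \<Rightarrow> bool"
  where "bounded_from_below T \<longleftrightarrow>
    (\<exists>c::real. \<forall>(f, f') \<in> T. Re (cinner f f') \<ge> c * (norm f)\<^sup>2)"

definition adjoint_op :: "('h::chilbert_space \<times> 'h) set \<Rightarrow> ('h \<times> 'h) set"
  where "adjoint_op T = {(g, g'). \<forall>(f, f') \<in> T. cinner g f' = cinner g' f}"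

definition self_adjoint :: "('h::chilbert_space \<times> 'h) set \<Rightarrow> bool"
  where "self_adjoint T \<longleftrightarrow> linear_operator T \<and> densely_defined T \<and> adjoint_op T = T"

definition self_adjoint_extension ::
    "('h::chilbert_space \<times> 'h) set \<Rightarrow> ('h \<times> 'h) set \<Rightarrow> bool"
  where "self_adjoint_extension S H \<longleftrightarrow> self_adjoint H \<and> S \<subseteq> H"

text \<open>The kernel of \<open>T - z\<close>.\<close>

definition ker_minus :: "('h::complex_vector \<times> 'h) set \<Rightarrow> complex \<Rightarrow> 'h set"
  where "ker_minus T z = {f. (f, z *\<^sub>C f) \<in> T}"

definition defect_numbers :: "('h::chilbert_space \<times> 'h) set \<Rightarrow> enat \<times> enat"
  where "defect_numbers S =
    (edim (ker_minus (adjoint_op S) \<i>), edim (ker_minus (adjoint_op S) (- \<i>)))"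

text \<open>The resolvent \<open>(T - z)\<^sup>-\<^sup>1\<close>; meaningful if \<open>T - z\<close> is a bijection from \<^term>\<open>Domain T\<close> onto
  the whole space.\<close>

definition resolvent :: "('h::complex_vector \<times> 'h) set \<Rightarrow> complex \<Rightarrow> 'h \<Rightarrow> 'h"
  where "resolvent T z y = (THE x. (x, y + z *\<^sub>C x) \<in> T)"

definition resolvent_set :: "('h::chilbert_space \<times> 'h) set \<Rightarrow> complex set"
  where "resolvent_set T =
    {z. (\<forall>y. \<exists>!x. (x, y + z *\<^sub>C x) \<in> T) \<and> bounded_linear (resolvent T z)}"

definition common_real_resolvent_set ::
    "('h::chilbert_space \<times> 'h) set \<Rightarrow> ('h \<times> 'h) set \<Rightarrow> real set"
  where "common_real_resolvent_set H1 H2 =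
    {l. complex_of_real l \<in> resolvent_set H1 \<inter> resolvent_set H2}"

definition resolvent_difference ::
    "('h::chilbert_space \<times> 'h) set \<Rightarrow> ('h \<times> 'h) set \<Rightarrow> real \<Rightarrow> 'h \<Rightarrow> 'h"
  where "resolvent_difference H1 H2 l f =
    resolvent H1 (complex_of_real l) f - resolvent H2 (complex_of_real l) f"


section \<open>Counting eigenvalues\<close>

text \<open>Here \<open>T\<close> is an everywhere defined self-adjoint operator restricted to the
  subspace \<open>V\<close>, so only real eigenvalues occur. Eigenvalues are counted with multiplicity; the
  count is \<open>\<infinity>\<close> if there are infinitely many of them or one has infinite multiplicity.\<close>

definition eigenspace :: "'h::complex_vector set \<Rightarrow> ('h \<Rightarrow> 'h) \<Rightarrow> real \<Rightarrow> 'h set"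
  where "eigenspace V T \<mu> = {x \<in> V. T x = complex_of_real \<mu> *\<^sub>C x}"

definition eigenvalues :: "'h::complex_vector set \<Rightarrow> ('h \<Rightarrow> 'h) \<Rightarrow> real set"
  where "eigenvalues V T = {\<mu>. \<exists>x \<in> eigenspace V T \<mu>. x \<noteq> 0}"

definition eigenvalue_count ::
    "'h::complex_vector set \<Rightarrow> ('h \<Rightarrow> 'h) \<Rightarrow> real set \<Rightarrow> enat"
  where "eigenvalue_count V T A =
    (if finite (eigenvalues V T \<inter> A)
     then \<Sum>\<mu> \<in> eigenvalues V T \<inter> A. edim (eigenspace V T \<mu>) else \<infinity>)"

definition n_zero :: "'h::complex_vector set \<Rightarrow> ('h \<Rightarrow> 'h) \<Rightarrow> enat"
  where "n_zero V T = eigenvalue_count V T {0}"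

definition n_pos :: "'h::complex_vector set \<Rightarrow> ('h \<Rightarrow> 'h) \<Rightarrow> enat"
  where "n_pos V T = eigenvalue_count V T {0<..}"

definition n_neg :: "'h::complex_vector set \<Rightarrow> ('h \<Rightarrow> 'h) \<Rightarrow> enat"
  where "n_neg V T = eigenvalue_count V T {..<0}"


section \<open>Lagrangian planes and the Duistermaat index\<close>

definition omega :: "'k::complex_inner \<times> 'k \<Rightarrow> 'k \<times> 'k \<Rightarrow> complex"
  where "omega u v = cinner (fst u) (snd v) - cinner (snd u) (fst v)"

definition lagrangian :: "('k::complex_inner \<times> 'k) set \<Rightarrow> bool"
  where "lagrangian L \<longleftrightarrow> csubspace L \<and> L = {u. \<forall>v \<in> L. omega u v = 0}"

definition transversal :: "('k::complex_inner \<times> 'k) set \<Rightarrow> ('k \<times> 'k) set \<Rightarrow> bool"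
  where "transversal \<alpha> \<beta> \<longleftrightarrow> \<alpha> \<inter> \<beta> = {0}"

text \<open>The linear map \<open>L : \<alpha> \<rightarrow> \<beta>\<close> with \<open>\<gamma> = {u + L u | u \<in> \<alpha>}\<close>, for \<open>\<beta>\<close> transversal to \<open>\<alpha>\<close>
  and \<open>\<gamma>\<close>.\<close>

definition graph_map ::
    "('k::complex_inner \<times> 'k) set \<Rightarrow> ('k \<times> 'k) set \<Rightarrow> 'k \<times> 'k \<Rightarrow> 'k \<times> 'k"
  where "graph_map \<beta> \<gamma> u = (THE w. w \<in> \<beta> \<and> u + w \<in> \<gamma>)"

text \<open>The form \<open>Q(\<alpha>, \<beta>; \<gamma>)\<close>; its domain \<open>\<alpha>\<close> is supplied to \<open>form_neg_index\<close> below.\<close>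

definition Q_form ::
    "('k::complex_inner \<times> 'k) set \<Rightarrow> ('k \<times> 'k) set \<Rightarrow> 'k \<times> 'k \<Rightarrow> 'k \<times> 'k \<Rightarrow> complex"
  where "Q_form \<beta> \<gamma> u1 u2 = omega u1 (graph_map \<beta> \<gamma> u2)"

text \<open>The negative index of a Hermitian form \<open>Q\<close> on a finite-dimensional space \<open>\<alpha>\<close>.\<close>

definition form_neg_index ::
    "'v::complex_vector set \<Rightarrow> ('v \<Rightarrow> 'v \<Rightarrow> complex) \<Rightarrow> nat"
  where "form_neg_index \<alpha> Q =
    Max {cdim W | W. csubspace W \<and> W \<subseteq> \<alpha> \<and> (\<forall>u \<in> W. u \<noteq> 0 \<longrightarrow> Re (Q u u) < 0)}"

definition n_neg_Q ::
    "('k::complex_inner \<times> 'k) set \<Rightarrow> ('k \<times> 'k) set \<Rightarrow> ('k \<times> 'k) set \<Rightarrow> nat"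
  where "n_neg_Q \<alpha> \<beta> \<gamma> = form_neg_index \<alpha> (Q_form \<beta> \<gamma>)"

definition duistermaat_index ::
    "('k::complex_inner \<times> 'k) set \<Rightarrow> ('k \<times> 'k) set \<Rightarrow> ('k \<times> 'k) set \<Rightarrow> int"
  where "duistermaat_index L1 L2 L3 =
    (let L = (SOME L. lagrangian L \<and> transversal L L1 \<and> transversal L L2 \<and> transversal L L3)
     in int (n_neg_Q L2 L L3) - int (n_neg_Q L1 L L3) + int (n_neg_Q L1 L L2))"


section \<open>Boundary triplets\<close>

definition clinear_on :: "'h::complex_vector set \<Rightarrow> ('h \<Rightarrow> 'k::complex_vector) \<Rightarrow> bool"
  where "clinear_on V F \<longleftrightarrow>
    (\<forall>f \<in> V. \<forall>g \<in> V. F (f + g) = F f + F g) \<and> (\<forall>c. \<forall>f \<in> V. F (c *\<^sub>C f) = c *\<^sub>C F f)"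

text \<open>The space \<open>\<K>\<close> is the type \<^typ>\<open>'k\<close>; the values of the boundary maps outside the domain of
  the adjoint are irrelevant.\<close>

definition boundary_triplet ::
    "('h::chilbert_space \<times> 'h) set \<Rightarrow> nat \<Rightarrow> ('h \<Rightarrow> 'k::chilbert_space) \<Rightarrow> ('h \<Rightarrow> 'k) \<Rightarrow> bool"
  where "boundary_triplet S n \<Gamma>0 \<Gamma>1 \<longleftrightarrow>
    edim (UNIV :: 'k set) = enat n \<and>
    clinear_on (Domain (adjoint_op S)) \<Gamma>0 \<and>
    clinear_on (Domain (adjoint_op S)) \<Gamma>1 \<and>
    (\<lambda>f. (\<Gamma>0 f, \<Gamma>1 f)) ` Domain (adjoint_op S) = UNIV \<and>
    (\<forall>(f, f') \<in> adjoint_op S. \<forall>(g, g') \<in> adjoint_op S.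
      cinner f g' - cinner f' g = cinner (\<Gamma>0 f) (\<Gamma>1 g) - cinner (\<Gamma>1 f) (\<Gamma>0 g))"

text \<open>\<open>L\<close> is the Lagrangian plane that corresponds to the self-adjoint extension \<open>H\<close> of \<open>S\<close>: \<open>H\<close> is
  the restriction of the adjoint of \<open>S\<close> to those \<open>f\<close> with \<open>(\<Gamma>\<^sub>0 f, \<Gamma>\<^sub>1 f) \<in> L\<close>.\<close>

definition corresponding_plane ::
    "('h::chilbert_space \<times> 'h) set \<Rightarrow> ('h \<Rightarrow> 'k::chilbert_space) \<Rightarrow> ('h \<Rightarrow> 'k) \<Rightarrow>
     ('h \<times> 'h) set \<Rightarrow> ('k \<times> 'k) set \<Rightarrow> bool"
  where "corresponding_plane S \<Gamma>0 \<Gamma>1 H L \<longleftrightarrow>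
    lagrangian L \<and> H = {(f, f') \<in> adjoint_op S. (\<Gamma>0 f, \<Gamma>1 f) \<in> L}"

definition N_space :: "('h::chilbert_space \<times> 'h) set \<Rightarrow> real \<Rightarrow> 'h set"
  where "N_space S l = ker_minus (adjoint_op S) (complex_of_real l)"

definition M_plane ::
    "('h::chilbert_space \<times> 'h) set \<Rightarrow> ('h \<Rightarrow> 'k) \<Rightarrow> ('h \<Rightarrow> 'k) \<Rightarrow> real \<Rightarrow> ('k \<times> 'k) set"
  where "M_plane S \<Gamma>0 \<Gamma>1 l = (\<lambda>f. (\<Gamma>0 f, \<Gamma>1 f)) ` N_space S l"

end

theory Submission
  imports Defs "HOL-Computational_Algebra.Fundamental_Theorem_Algebra"
begin

text \<open>Write \<open>R\<^sub>j = (H\<^sub>j - \<lambda>)\<^sup>-\<^sup>1\<close> and \<open>\<Gamma>f = (\<Gamma>\<^sub>0 f, \<Gamma>\<^sub>1 f)\<close>. Green's identity gives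
  \<open>\<langle>f, D(\<lambda>)f\<rangle> = \<omega>(\<Gamma>R\<^sub>1f, \<Gamma>R\<^sub>2f)\<close>, and \<open>f \<mapsto> (\<Gamma>R\<^sub>2f, -\<Gamma>D(\<lambda>)f)\<close> maps the Hilbert space onto
  \<open>{(b, m) \<in> \<L>\<^sub>2 \<times> \<M>(\<lambda>). b - m \<in> \<L>\<^sub>1}\<close>. So \<open>n\<^sub>-(D(\<lambda>))\<close> is the negative index of \<open>\<omega>(b - m, b)\<close>
  on that finite-dimensional space. With a Lagrangian plane transversal to \<open>\<L>\<^sub>1\<close>, \<open>\<L>\<^sub>2\<close>, \<open>\<M>(\<lambda>)\<close>,
  the planes \<open>\<L>\<^sub>2\<close> and \<open>\<M>(\<lambda>)\<close> become graphs of Hermitian forms \<open>A\<close>, \<open>B\<close> on \<open>\<L>\<^sub>1\<close>, the space above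
  becomes the complement of the diagonal with respect to the form \<open>A \<oplus> (-B)\<close> on
  \<open>\<L>\<^sub>1 \<times> \<L>\<^sub>1\<close>, and additivity of the index along
  the two decompositions gives the Duistermaat index. The kernel of \<open>D(\<lambda>)\<close> on \<open>\<N>\<^sub>\<lambda>\<close> is mapped by
  \<open>\<Gamma>R\<^sub>1\<close> isomorphically onto \<open>\<L>\<^sub>1 \<inter> \<L>\<^sub>2\<close>. Finally \<open>n\<^sub>+\<close> and \<open>n\<^sub>-\<close> are lower semicontinuous in
  \<open>\<lambda>\<close> and have a constant sum, the rank.\<close>

section \<open>Complex vector spaces and inner products\<close>

text \<open>The index combines three negative indices, one of them on \<open>L2\<close>, while the
  operator supplies a single form on pairs \<open>(b, m)\<close>. Comparing them requires changing
  the sign of forms, and the rule n_-(-Q) = dim - n_-(Q) holds only for nondegenerate Q. This is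
  where it matters that \<lambda> lies in both resolvent sets: an element of the kernel of the
  adjoint minus \<lambda> whose boundary value lies in \<open>L1\<close> or in \<open>L2\<close>
  would be an eigenvector of that extension, so \<open>M\<close> is transversal to both planes.
  Transversality to \<open>L1\<close> makes B nondegenerate and transversality to \<open>L2\<close>
  makes A - B nondegenerate; A itself may have a kernel, namely \<open>L1 \<inter> L2\<close>.

  A second obstacle is that the form of the operator lives on an infinite-dimensional space and
  reaches boundary values through a map with a large kernel. A maximum of dimensions is awkward to
  transport along such a map. The relation \<open>neg_index\<close>, a finite negative family
  together with a nonnegative subspace, passes through linear maps in both directions and is tied to
  the maximum only at the end.\<close>

lemma cinner_add_left: "cinner (x + y) z = cinner x z + cinner y z"
  by (metis cinner_add_right cinner_commute complex_cnj_add)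

lemma cinner_scaleC_left: "cinner (a *\<^sub>C x) y = cnj a * cinner x y"
  by (metis cinner_commute cinner_scaleC_right complex_cnj_mult)

lemma cinner_zero_right [simp]: "cinner x 0 = 0"
  by (metis add_cancel_right_right cinner_add_right)

lemma cinner_zero_left [simp]: "cinner 0 x = 0"
  by (metis cinner_commute cinner_zero_right complex_cnj_zero)

lemma cinner_minus_right: "cinner x (- y) = - cinner x y"
  by (metis cinner_add_right cinner_zero_right add.right_inverse minus_unique)

lemma cinner_minus_left: "cinner (- x) y = - cinner x y"
  by (metis cinner_commute cinner_minus_right complex_cnj_minus)

lemma cinner_diff_right: "cinner x (y - z) = cinner x y - cinner x z"
  using cinner_add_right[of x y "- z"] by (simp add: cinner_minus_right)

lemma cinner_diff_left: "cinner (x - y) z = cinner x z - cinner y z"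
  using cinner_add_left[of x "- y" z] by (simp add: cinner_minus_left)

lemmas cinner_algebra = cinner_add_left cinner_add_right cinner_diff_left cinner_diff_right
  cinner_minus_left cinner_minus_right cinner_scaleC_left cinner_scaleC_right

lemma cinner_sum_right: "cinner x (\<Sum>i\<in>I. f i) = (\<Sum>i\<in>I. cinner x (f i))"
  by (induction I rule: infinite_finite_induct) (auto simp: cinner_add_right)

lemma cinner_sum_left: "cinner (\<Sum>i\<in>I. f i) x = (\<Sum>i\<in>I. cinner (f i) x)"
  by (induction I rule: infinite_finite_induct) (auto simp: cinner_add_left)

lemma cinner_self_eq_0 [simp]: "cinner x x = 0 \<longleftrightarrow> x = 0"
  by (simp add: cinner_self)

lemma cinner_eq_0_all: "(\<And>y. cinner x y = 0) \<Longrightarrow> x = 0"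
  using cinner_self_eq_0 by blast

text \<open>Expanding the square of \<open>norm (x + y)\<close> and comparing it with the triangle
  inequality, which belongs to the norm already, replaces the usual Cauchy-Schwarz argument.\<close>

lemma Re_cinner_le: "Re (cinner x y) \<le> norm x * norm y"
proof -
  have "cinner (x + y) (x + y) = cinner x x + cinner y y + (cinner x y + cnj (cinner x y))"
    by (simp add: cinner_algebra cinner_commute[of y x])
  then have "(norm (x + y))\<^sup>2 = (norm x)\<^sup>2 + (norm y)\<^sup>2 + 2 * Re (cinner x y)"
    unfolding cinner_self complex_add_cnj
    by (simp only: of_real_add[symmetric] of_real_eq_iff)
  moreover have "(norm (x + y))\<^sup>2 \<le> (norm x + norm y)\<^sup>2"
    by (intro power_mono norm_triangle_ineq norm_ge_zero)
  ultimately show ?thesis by (simp add: power2_sum)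
qed

lemma clinear_onD:
  assumes "clinear_on V f" "csubspace V" "x \<in> V"
  shows "y \<in> V \<Longrightarrow> f (x + y) = f x + f y" "f (c *\<^sub>C x) = c *\<^sub>C f x"
    "y \<in> V \<Longrightarrow> f (x - y) = f x - f y"
proof -
  show s: "f (c *\<^sub>C x) = c *\<^sub>C f x" for c using assms by (auto simp: clinear_on_def)
  show a: "f (x + y) = f x + f y" if "y \<in> V" for y using assms that by (auto simp: clinear_on_def)
  show "f (x - y) = f x - f y" if "y \<in> V"
  proof -
    have "f (x + (- 1) *\<^sub>C y) = f x + (- 1) *\<^sub>C f y"
      using assms that by (metis clinear_on_def complex_vector.subspace_scale)
    then show ?thesis by (simp add: complex_vector.scale_minus_left scaleC_one)
  qed
qed

lemma clinear_on_zero: "clinear_on V f \<Longrightarrow> csubspace V \<Longrightarrow> f 0 = 0"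
  by (metis clinear_onD(2) complex_vector.scale_zero_left complex_vector.subspace_0)

lemma clinear_on_sum:
  assumes "clinear_on V f" "csubspace V" "\<And>i. i \<in> I \<Longrightarrow> c i \<in> V"
  shows "f (\<Sum>i\<in>I. a i *\<^sub>C c i) = (\<Sum>i\<in>I. a i *\<^sub>C f (c i))"
  using assms(3)
proof (induction I rule: infinite_finite_induct)
  case (insert i I)
  have "(\<Sum>i\<in>I. a i *\<^sub>C c i) \<in> V"
    using insert.prems assms(2)
    by (intro complex_vector.subspace_sum complex_vector.subspace_scale) auto
  with insert show ?case
    using assms(1,2) by (simp add: clinear_onD complex_vector.subspace_scale)
qed (use clinear_on_zero[OF assms(1,2)] in auto)

lemma csubspace_image:
  assumes f: "clinear_on V f" and V: "csubspace V"
  shows "csubspace (f ` V)"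
proof (rule complex_vector.subspaceI)
  show "0 \<in> f ` V"
    using clinear_on_zero[OF f V] complex_vector.subspace_0[OF V] by (metis imageI)
  show "x + y \<in> f ` V" if "x \<in> f ` V" "y \<in> f ` V" for x y
  proof -
    from that obtain u v where "u \<in> V" "v \<in> V" "x = f u" "y = f v" by blast
    then have "x + y = f (u + v)" "u + v \<in> V"
      using clinear_onD(1)[OF f V] complex_vector.subspace_add[OF V] by auto
    then show ?thesis by blast
  qed
  show "c *\<^sub>C x \<in> f ` V" if "x \<in> f ` V" for c x
  proof -
    from that obtain u where "u \<in> V" "x = f u" by blast
    then have "c *\<^sub>C x = f (c *\<^sub>C u)" "c *\<^sub>C u \<in> V"
      using clinear_onD(2)[OF f V] complex_vector.subspace_scale[OF V] by auto
    then show ?thesis by blast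
  qed
qed

lemma csubspace_vimage:
  assumes f: "clinear_on V f" and V: "csubspace V" and P: "csubspace P"
  shows "csubspace {v \<in> V. f v \<in> P}"
  by (rule complex_vector.subspaceI)
     (auto simp: clinear_onD[OF f V] clinear_on_zero[OF f V] complex_vector.subspace_0[OF V]
       complex_vector.subspace_add[OF V] complex_vector.subspace_scale[OF V]
       complex_vector.subspace_0[OF P] complex_vector.subspace_add[OF P]
       complex_vector.subspace_scale[OF P])

lemma clinear_on_subset: "clinear_on V f \<Longrightarrow> W \<subseteq> V \<Longrightarrow> clinear_on W f"
  by (auto simp: clinear_on_def subset_iff)

section \<open>Finite-dimensional subspaces and their dimension\<close>

definition cfinite_dim :: "'a::complex_vector set \<Rightarrow> bool"
  where "cfinite_dim V \<longleftrightarrow> (\<exists>B. finite B \<and> V \<subseteq> cspan B)"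

lemma cfinite_dim_subset: "cfinite_dim V \<Longrightarrow> W \<subseteq> V \<Longrightarrow> cfinite_dim W"
  by (auto simp: cfinite_dim_def)

lemma cfinite_dim_basis:
  assumes "csubspace V" "cfinite_dim V"
  obtains B where "finite B" "\<not> complex_vector.dependent B" "cspan B = V" "card B = cdim V"
proof -
  obtain B where B: "B \<subseteq> V" "\<not> complex_vector.dependent B" "V \<subseteq> cspan B" "card B = cdim V"
    by (rule complex_vector.basis_exists)
  obtain C where "finite C" "V \<subseteq> cspan C" using assms(2) by (auto simp: cfinite_dim_def)
  with B have "finite B" using complex_vector.independent_span_bound by blast
  moreover have "cspan B = V"
    using B assms(1) by (simp add: complex_vector.span_minimal subset_antisym)
  ultimately show thesis using that B by blast
qed

lemma edim_cfinite: "cfinite_dim V \<Longrightarrow> edim V = enat (cdim V)"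
  by (auto simp: edim_def cfinite_dim_def)

lemma edim_cspan_independent:
  "finite B \<Longrightarrow> \<not> complex_vector.dependent B \<Longrightarrow> edim (cspan B) = enat (card B)"
  by (auto simp: edim_def complex_vector.dim_eq_card_independent)

lemma edim_eq_enatD: "edim V = enat n \<Longrightarrow> cfinite_dim V \<and> cdim V = n"
  by (auto simp: edim_def cfinite_dim_def split: if_splits)

lemma cspan_finite_sum: "finite B \<Longrightarrow> cspan B = {\<Sum>b\<in>B. a b *\<^sub>C b |a. True}"
  by (auto simp: complex_vector.span_finite)

lemma edim_linear_image:
  assumes f: "clinear_on V f" and V: "csubspace V" and ker: "\<And>v. v \<in> V \<Longrightarrow> f v = 0 \<Longrightarrow> v = 0"
    and fd: "cfinite_dim V"
  shows "edim (f ` V) = edim V" "cfinite_dim (f ` V)"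
proof -
  obtain B where B: "finite B" "\<not> complex_vector.dependent B" "cspan B = V"
    by (rule cfinite_dim_basis[OF V fd])
  have BV: "B \<subseteq> V" using B(3) complex_vector.span_superset by blast
  have inj: "inj_on f V"
  proof (rule inj_onI)
    fix x y assume xy: "x \<in> V" "y \<in> V" "f x = f y"
    then have "f (x - y) = 0" "x - y \<in> V"
      using clinear_onD(3)[OF f V] complex_vector.subspace_diff[OF V] by auto
    then show "x = y" using ker by fastforce
  qed
  then have injB: "inj_on f B" using BV inj_on_subset by blast
  have comb: "f (\<Sum>b\<in>B. a b *\<^sub>C b) = (\<Sum>b\<in>B. a b *\<^sub>C f b)" for a
    using clinear_on_sum[OF f V, of B "\<lambda>b. b" a] BV by auto
  have span: "cspan (f ` B) = f ` V"
  proof -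
    have "cspan (f ` B) \<subseteq> f ` V"
      using BV by (intro complex_vector.span_minimal csubspace_image[OF f V]) auto
    moreover have "f v \<in> cspan (f ` B)" if "v \<in> V" for v
    proof -
      obtain a where "v = (\<Sum>b\<in>B. a b *\<^sub>C b)"
        using \<open>v \<in> V\<close> B cspan_finite_sum[OF B(1)] by auto
      then have "f v = (\<Sum>b\<in>B. a b *\<^sub>C f b)" using comb by simp
      also have "\<dots> \<in> cspan (f ` B)"
        by (intro complex_vector.span_sum complex_vector.span_scale complex_vector.span_base imageI)
      finally show ?thesis .
    qed
    ultimately show ?thesis by auto
  qed
  have ind: "\<not> complex_vector.dependent (f ` B)"
  proof
    assume "complex_vector.dependent (f ` B)"
    then obtain u where u: "(\<Sum>w\<in>f ` B. u w *\<^sub>C w) = 0" "\<exists>w\<in>f ` B. u w \<noteq> 0"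
      using B(1) by (auto simp: complex_vector.dependent_finite)
    then have "f (\<Sum>b\<in>B. u (f b) *\<^sub>C b) = 0"
      by (simp add: comb[of "\<lambda>b. u (f b)"] sum.reindex[OF injB])
    moreover have "(\<Sum>b\<in>B. u (f b) *\<^sub>C b) \<in> V"
      using BV V by (auto intro!: complex_vector.subspace_sum complex_vector.subspace_scale)
    ultimately have "(\<Sum>b\<in>B. u (f b) *\<^sub>C b) = 0" using ker by blast
    then have "complex_vector.dependent B"
      unfolding complex_vector.dependent_finite[OF B(1)] using u(2) by auto
    then show False using B(2) by simp
  qed
  show "cfinite_dim (f ` V)" unfolding cfinite_dim_def using B(1) span by blast
  have "edim (f ` V) = enat (card (f ` B))"
    using edim_cspan_independent[OF _ ind] span B(1) by simp
  then show "edim (f ` V) = edim V"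
    using edim_cspan_independent[OF B(1,2)] B(3) card_image[OF injB] by simp
qed

text \<open>Appending \<open>v\<close> to a basis of \<open>W\<close> gives a basis of
  \<open>V\<close>. This drives both inductions on the dimension, where \<open>W\<close> is the
  orthogonal complement of a vector for a Hermitian form or for the inner product.\<close>

lemma cdim_split_line:
  assumes V: "csubspace V" and W: "csubspace W" "W \<subseteq> V" "v \<in> V" "v \<notin> W"
    and sum: "\<And>x. x \<in> V \<Longrightarrow> \<exists>a. x - a *\<^sub>C v \<in> W" and fd: "cfinite_dim V"
  shows "cdim V = Suc (cdim W)"
proof -
  obtain B where B: "finite B" "\<not> complex_vector.dependent B" "cspan B = W" "card B = cdim W"
    using cfinite_dim_basis[OF W(1) cfinite_dim_subset[OF fd W(2)]] by metis
  have vB: "v \<notin> cspan B" using B W by simp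
  then have "v \<notin> B" using complex_vector.span_base by blast
  have "V \<subseteq> cspan (insert v B)"
    unfolding complex_vector.span_insert using sum B(3) by auto
  moreover have "insert v B \<subseteq> V" using W B complex_vector.span_superset by blast
  moreover have "\<not> complex_vector.dependent (insert v B)"
    using B vB by (simp add: complex_vector.independent_insert)
  ultimately have "cdim V = card (insert v B)" by (metis complex_vector.dim_unique)
  then show ?thesis using B \<open>v \<notin> B\<close> by simp
qed

section \<open>The negative index of a quadratic form\<close>

text \<open>Gaussian elimination, one equation at a time. It stands in for dimension counts on
  indexed families, whose members may coincide.\<close>

lemma homogeneous_system:
  fixes a :: "'i \<Rightarrow> nat \<Rightarrow> complex"
  assumes "finite J" "k < card J"
  obtains b where "\<exists>j\<in>J. b j \<noteq> 0" "\<And>i. i < k \<Longrightarrow> (\<Sum>j\<in>J. b j * a j i) = 0"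
proof -
  have "\<exists>b. (\<exists>j\<in>J. b j \<noteq> 0) \<and> (\<forall>i<k. (\<Sum>j\<in>J. b j * a j i) = 0)"
    using assms
  proof (induction k arbitrary: J a)
    case 0
    then have "J \<noteq> {}" by auto
    then show ?case by (intro exI[of _ "\<lambda>_. 1"]) auto
  next
    case (Suc k)
    show ?case
    proof (cases "\<forall>j\<in>J. a j k = 0")
      case True
      obtain b where b: "\<exists>j\<in>J. b j \<noteq> 0" "\<forall>i<k. (\<Sum>j\<in>J. b j * a j i) = 0"
        using Suc.IH[of J a] Suc.prems by auto
      then show ?thesis using True by (intro exI[of _ b]) (auto simp: less_Suc_eq)
    next
      case False
      then obtain p where p: "p \<in> J" "a p k \<noteq> 0" by auto
      \<comment> \<open>The unknown \<open>p\<close> is eliminated by means of equation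
        \<open>k\<close>, which then becomes trivial; the value \<open>b' p\<close> below is
        recovered from that equation.\<close>
      define a' where "a' = (\<lambda>j i. a j i - a j k / a p k * a p i)"
      have "k < card (J - {p})" using Suc.prems p by (simp add: card_Diff_singleton)
      then obtain b where b: "\<exists>j\<in>J - {p}. b j \<noteq> 0"
        "\<forall>i<k. (\<Sum>j\<in>J - {p}. b j * a' j i) = 0"
        using Suc.IH[of "J - {p}" a'] Suc.prems by auto
      define b' where "b' = b(p := - (\<Sum>j\<in>J - {p}. b j * (a j k / a p k)))"
      have eq: "(\<Sum>j\<in>J. b' j * a j i) = (\<Sum>j\<in>J - {p}. b j * a' j i)" for i
      proof -
        have "(\<Sum>j\<in>J. b' j * a j i) = b' p * a p i + (\<Sum>j\<in>J - {p}. b' j * a j i)"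
          using Suc.prems p by (simp add: sum.remove)
        also have "(\<Sum>j\<in>J - {p}. b' j * a j i) = (\<Sum>j\<in>J - {p}. b j * a j i)"
          by (intro sum.cong) (auto simp: b'_def)
        also have "b' p * a p i = - (\<Sum>j\<in>J - {p}. b j * (a j k / a p k * a p i))"
          by (simp add: b'_def sum_distrib_right mult.assoc)
        finally show ?thesis
          by (simp add: a'_def algebra_simps sum_subtractf)
      qed
      have "a' j k = 0" for j using p by (simp add: a'_def)
      then have "(\<Sum>j\<in>J. b' j * a j i) = 0" if "i < Suc k" for i
        using b(2) eq that by (cases "i = k") auto
      moreover have "\<exists>j\<in>J. b' j \<noteq> 0" using b(1) by (auto simp: b'_def)
      ultimately show ?thesis by blast
    qed
  qed
  with that show thesis by blast
qed

text \<open>By Sylvester's law of inertia \<open>k\<close> is determined by \<open>V\<close> and \<open>q\<close>. The space \<open>V\<close> may be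
  infinite-dimensional, so that the form of a finite-rank operator on a Hilbert space is covered.\<close>

definition neg_index :: "'v::complex_vector set \<Rightarrow> ('v \<Rightarrow> real) \<Rightarrow> nat \<Rightarrow> bool"
  where "neg_index V q k \<longleftrightarrow> (\<exists>c P. (\<forall>i<k. c i \<in> V) \<and>
    (\<forall>a. (\<exists>i<k. a i \<noteq> 0) \<longrightarrow> q (\<Sum>i<k. a i *\<^sub>C c i) < 0) \<and>
    csubspace P \<and> P \<subseteq> V \<and> (\<forall>p\<in>P. 0 \<le> q p) \<and> (\<forall>v\<in>V. \<exists>a. v - (\<Sum>i<k. a i *\<^sub>C c i) \<in> P))"

lemma neg_indexE:
  assumes "neg_index V q k"
  obtains c P where "\<And>i. i < k \<Longrightarrow> c i \<in> V"
    "\<And>a. \<exists>i<k. a i \<noteq> 0 \<Longrightarrow> q (\<Sum>i<k. a i *\<^sub>C c i) < 0"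
    "csubspace P" "P \<subseteq> V" "\<And>p. p \<in> P \<Longrightarrow> 0 \<le> q p"
    "\<And>v. v \<in> V \<Longrightarrow> \<exists>a. v - (\<Sum>i<k. a i *\<^sub>C c i) \<in> P"
  using assms unfolding neg_index_def by blast

lemma neg_indexI:
  assumes "\<And>i. i < k \<Longrightarrow> c i \<in> V" "\<And>a. \<exists>i<k. a i \<noteq> 0 \<Longrightarrow> q (\<Sum>i<k. a i *\<^sub>C c i) < 0"
    and "csubspace P" "P \<subseteq> V" "\<And>p. p \<in> P \<Longrightarrow> 0 \<le> q p"
    and "\<And>v. v \<in> V \<Longrightarrow> \<exists>a. v - (\<Sum>i<k. a i *\<^sub>C c i) \<in> P"
  shows "neg_index V q k"
  unfolding neg_index_def using assms by (intro exI[of _ c] exI[of _ P]) blast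

lemma neg_index_finiteI:
  assumes I: "finite I" and c: "\<And>i. i \<in> I \<Longrightarrow> c i \<in> V"
    and neg: "\<And>a. \<exists>i\<in>I. a i \<noteq> 0 \<Longrightarrow> q (\<Sum>i\<in>I. a i *\<^sub>C c i) < 0"
    and P: "csubspace P" "P \<subseteq> V" "\<And>p. p \<in> P \<Longrightarrow> 0 \<le> q p"
    and span: "\<And>v. v \<in> V \<Longrightarrow> \<exists>a. v - (\<Sum>i\<in>I. a i *\<^sub>C c i) \<in> P"
  shows "neg_index V q (card I)"
proof -
  obtain h where h: "bij_betw h {0..<card I} I" using ex_bij_betw_nat_finite[OF I] by blast
  then have h': "bij_betw h {..<card I} I" by (simp add: atLeast0LessThan)
  define g where "g = inv_into {..<card I} h"
  have g: "g (h i) = i" if "i < card I" for i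
    using bij_betw_inv_into_left[OF h'] that by (simp add: g_def)
  have sum: "(\<Sum>i<card I. a (h i) *\<^sub>C c (h i)) = (\<Sum>i\<in>I. a i *\<^sub>C c i)" for a
    using sum.reindex_bij_betw[OF h'] .
  have sum': "(\<Sum>i<card I. a i *\<^sub>C c (h i)) = (\<Sum>i\<in>I. a (g i) *\<^sub>C c i)" for a
    using sum[of "\<lambda>i. a (g i)"] g by simp
  have hI: "h i \<in> I" if "i < card I" for i using h' that by (auto simp: bij_betw_def)
  show ?thesis
  proof (rule neg_indexI[where c = "\<lambda>i. c (h i)" and P = P])
    show "q (\<Sum>i<card I. a i *\<^sub>C c (h i)) < 0" if "\<exists>i<card I. a i \<noteq> 0" for a
    proof -
      from that obtain i where "i < card I" "a i \<noteq> 0" by blast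
      then have "\<exists>i\<in>I. a (g i) \<noteq> 0" using hI[of i] g[of i] by (intro bexI[of _ "h i"]) auto
      from neg[OF this] show ?thesis unfolding sum'[symmetric] .
    qed
    show "\<exists>a. v - (\<Sum>i<card I. a i *\<^sub>C c (h i)) \<in> P" if v: "v \<in> V" for v
    proof -
      from span[OF v] obtain a where "v - (\<Sum>i\<in>I. a i *\<^sub>C c i) \<in> P" by blast
      then show ?thesis unfolding sum[symmetric] by (intro exI[of _ "\<lambda>i. a (h i)"])
    qed
  qed (use P c hI in auto)
qed

text \<open>Modulo \<open>P\<close> every \<open>d j\<close> is a combination of the
  \<open>k\<close> vectors \<open>c i\<close>. More than \<open>k\<close> of them would therefore
  have a nontrivial combination inside \<open>P\<close>, where the form cannot be negative.\<close>

lemma neg_index_bound: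
  assumes "neg_index V q k" and J: "finite J" and d: "\<And>j. j \<in> J \<Longrightarrow> d j \<in> V"
    and neg: "\<And>b. \<exists>j\<in>J. b j \<noteq> 0 \<Longrightarrow> q (\<Sum>j\<in>J. b j *\<^sub>C d j) < 0"
  shows "card J \<le> k"
proof (rule ccontr)
  assume "\<not> card J \<le> k"
  obtain c P where c: "csubspace P" "\<And>p. p \<in> P \<Longrightarrow> 0 \<le> q p"
    "\<And>v. v \<in> V \<Longrightarrow> \<exists>a. v - (\<Sum>i<k. a i *\<^sub>C c i) \<in> P"
    using assms(1) by (rule neg_indexE) blast
  have "\<forall>j\<in>J. \<exists>a. d j - (\<Sum>i<k. a i *\<^sub>C c i) \<in> P" using c(3) d by blast
  then obtain a where a: "\<And>j. j \<in> J \<Longrightarrow> d j - (\<Sum>i<k. a j i *\<^sub>C c i) \<in> P" by metis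
  obtain b where b: "\<exists>j\<in>J. b j \<noteq> 0" "\<And>i. i < k \<Longrightarrow> (\<Sum>j\<in>J. b j * a j i) = 0"
    using homogeneous_system[OF J, of k a] \<open>\<not> card J \<le> k\<close> by auto
  have "(\<Sum>j\<in>J. b j *\<^sub>C (\<Sum>i<k. a j i *\<^sub>C c i)) = (\<Sum>i<k. (\<Sum>j\<in>J. b j * a j i) *\<^sub>C c i)"
    by (simp add: complex_vector.scale_sum_left complex_vector.scale_sum_right
        complex_vector.scale_scale) (rule sum.swap)
  also have "\<dots> = 0" using b(2) by (simp add: complex_vector.scale_zero_left)
  finally have "(\<Sum>j\<in>J. b j *\<^sub>C d j) = (\<Sum>j\<in>J. b j *\<^sub>C (d j - (\<Sum>i<k. a j i *\<^sub>C c i)))"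
    by (simp add: complex_vector.scale_right_diff_distrib sum_subtractf)
  also have "\<dots> \<in> P"
    using a c(1) by (auto intro!: complex_vector.subspace_sum complex_vector.subspace_scale)
  finally show False using c(2) neg[OF b(1)] by fastforce
qed

lemma neg_index_unique:
  assumes "neg_index V q k" "neg_index V q l"
  shows "k = l"
proof -
  have "k \<le> l" if "neg_index V q k" "neg_index V q l" for k l
  proof -
    obtain c where "\<And>i. i < k \<Longrightarrow> c i \<in> V" "\<And>a. \<exists>i<k. a i \<noteq> 0 \<Longrightarrow> q (\<Sum>i<k. a i *\<^sub>C c i) < 0"
      using \<open>neg_index V q k\<close> by (rule neg_indexE) blast
    then show ?thesis
      using neg_index_bound[OF \<open>neg_index V q l\<close>, of "{..<k}" c] by auto
  qed
  with assms show ?thesis by (meson order_antisym)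
qed

text \<open>Negativity is a condition on the values of the form alone, and these are preserved, so
  \<open>f\<close> may have a kernel. This carries the form of the resolvent difference from the
  Hilbert space to boundary values.\<close>

lemma neg_index_push:
  assumes f: "clinear_on V f" and V: "csubspace V" and q: "\<And>v. v \<in> V \<Longrightarrow> q v = r (f v)"
    and "neg_index V q k"
  shows "neg_index (f ` V) r k"
proof -
  obtain c P where c: "\<And>i. i < k \<Longrightarrow> c i \<in> V"
    "\<And>a. \<exists>i<k. a i \<noteq> 0 \<Longrightarrow> q (\<Sum>i<k. a i *\<^sub>C c i) < 0"
    and P: "csubspace P" "P \<subseteq> V" "\<And>p. p \<in> P \<Longrightarrow> 0 \<le> q p"
    and span: "\<And>v. v \<in> V \<Longrightarrow> \<exists>a. v - (\<Sum>i<k. a i *\<^sub>C c i) \<in> P"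
    by (rule neg_indexE[OF \<open>neg_index V q k\<close>]) blast
  have V': "(\<Sum>i<k. a i *\<^sub>C c i) \<in> V" for a
    using V c(1) by (auto intro!: complex_vector.subspace_sum complex_vector.subspace_scale)
  have fsum: "f (\<Sum>i<k. a i *\<^sub>C c i) = (\<Sum>i<k. a i *\<^sub>C f (c i))" for a
    using clinear_on_sum[OF f V, of "{..<k}" c a] c(1) by auto
  show ?thesis
  proof (rule neg_indexI[where c = "\<lambda>i. f (c i)" and P = "f ` P"])
    show "f (c i) \<in> f ` V" if "i < k" for i using c(1) that by blast
    show "r (\<Sum>i<k. a i *\<^sub>C f (c i)) < 0" if "\<exists>i<k. a i \<noteq> 0" for a
      using c(2)[OF that] unfolding q[OF V'] fsum .
    show "csubspace (f ` P)" using csubspace_image[OF clinear_on_subset[OF f P(2)] P(1)] .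
    show "f ` P \<subseteq> f ` V" using P(2) by blast
    show "0 \<le> r p" if "p \<in> f ` P" for p
    proof -
      from that obtain x where "x \<in> P" "p = f x" by blast
      then show ?thesis using q P by (metis subsetD)
    qed
    show "\<exists>a. w - (\<Sum>i<k. a i *\<^sub>C f (c i)) \<in> f ` P" if "w \<in> f ` V" for w
    proof -
      from that obtain v where v: "v \<in> V" "w = f v" by blast
      from span[OF v(1)] obtain a where "v - (\<Sum>i<k. a i *\<^sub>C c i) \<in> P" by blast
      then have "f (v - (\<Sum>i<k. a i *\<^sub>C c i)) \<in> f ` P" by blast
      then show ?thesis unfolding clinear_onD(3)[OF f V v(1) V'] v(2) fsum by blast
    qed
  qed
qed

text \<open>Arbitrary preimages of the negative vectors will do, and the full preimage of
  \<open>P\<close> absorbs the kernel of \<open>f\<close>.\<close>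

lemma neg_index_pull:
  assumes f: "clinear_on V f" and V: "csubspace V" and q: "\<And>v. v \<in> V \<Longrightarrow> q v = r (f v)"
    and "neg_index (f ` V) r k"
  shows "neg_index V q k"
proof -
  obtain c P where c: "\<And>i. i < k \<Longrightarrow> c i \<in> f ` V"
    "\<And>a. \<exists>i<k. a i \<noteq> 0 \<Longrightarrow> r (\<Sum>i<k. a i *\<^sub>C c i) < 0"
    and P: "csubspace P" "P \<subseteq> f ` V" "\<And>p. p \<in> P \<Longrightarrow> 0 \<le> r p"
    and span: "\<And>v. v \<in> f ` V \<Longrightarrow> \<exists>a. v - (\<Sum>i<k. a i *\<^sub>C c i) \<in> P"
    by (rule neg_indexE[OF \<open>neg_index (f ` V) r k\<close>]) blast
  define d where "d = (\<lambda>i. inv_into V f (c i))"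
  have d: "d i \<in> V \<and> f (d i) = c i" if "i < k" for i
    using c(1)[OF that] by (simp add: d_def inv_into_into f_inv_into_f)
  have V': "(\<Sum>i<k. a i *\<^sub>C d i) \<in> V" for a
    using V d by (auto intro!: complex_vector.subspace_sum complex_vector.subspace_scale)
  have fsum: "f (\<Sum>i<k. a i *\<^sub>C d i) = (\<Sum>i<k. a i *\<^sub>C c i)" for a
    using clinear_on_sum[OF f V, of "{..<k}" d a] d by auto
  show ?thesis
  proof (rule neg_indexI[where c = d and P = "{v \<in> V. f v \<in> P}"])
    show "d i \<in> V" if "i < k" for i using d that by blast
    show "q (\<Sum>i<k. a i *\<^sub>C d i) < 0" if "\<exists>i<k. a i \<noteq> 0" for a
      using c(2)[OF that] unfolding q[OF V'] fsum .
    show "csubspace {v \<in> V. f v \<in> P}" using csubspace_vimage[OF f V P(1)] .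
    show "0 \<le> q p" if "p \<in> {v \<in> V. f v \<in> P}" for p
      using that q P(3) by simp
    show "\<exists>a. v - (\<Sum>i<k. a i *\<^sub>C d i) \<in> {v \<in> V. f v \<in> P}" if v: "v \<in> V" for v
    proof -
      from v span obtain a where "f v - (\<Sum>i<k. a i *\<^sub>C c i) \<in> P" by blast
      then have "f (v - (\<Sum>i<k. a i *\<^sub>C d i)) \<in> P"
        unfolding clinear_onD(3)[OF f V v V'] fsum .
      then show ?thesis using complex_vector.subspace_diff[OF V v V'] by blast
    qed
  qed auto
qed

text \<open>Additivity of \<open>q\<close> across the two spaces expresses their orthogonality; the
  two negative families are joined and the two nonnegative parts are added.\<close>

lemma neg_index_add:
  assumes V: "csubspace V1" "csubspace V2"
    and q: "\<And>x y. x \<in> V1 \<Longrightarrow> y \<in> V2 \<Longrightarrow> q (x + y) = q x + q y" and q0: "q 0 = 0"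
    and "neg_index V1 q k" "neg_index V2 q l"
  shows "neg_index {x + y |x y. x \<in> V1 \<and> y \<in> V2} q (k + l)"
proof -
  obtain c P where c: "\<And>i. i < k \<Longrightarrow> c i \<in> V1"
    "\<And>a. \<exists>i<k. a i \<noteq> 0 \<Longrightarrow> q (\<Sum>i<k. a i *\<^sub>C c i) < 0"
    and P: "csubspace P" "P \<subseteq> V1" "\<And>p. p \<in> P \<Longrightarrow> 0 \<le> q p"
    and cspan: "\<And>v. v \<in> V1 \<Longrightarrow> \<exists>a. v - (\<Sum>i<k. a i *\<^sub>C c i) \<in> P"
    by (rule neg_indexE[OF \<open>neg_index V1 q k\<close>]) blast
  obtain d R where d: "\<And>i. i < l \<Longrightarrow> d i \<in> V2"
    "\<And>a. \<exists>i<l. a i \<noteq> 0 \<Longrightarrow> q (\<Sum>i<l. a i *\<^sub>C d i) < 0"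
    and R: "csubspace R" "R \<subseteq> V2" "\<And>p. p \<in> R \<Longrightarrow> 0 \<le> q p"
    and dspan: "\<And>v. v \<in> V2 \<Longrightarrow> \<exists>a. v - (\<Sum>i<l. a i *\<^sub>C d i) \<in> R"
    by (rule neg_indexE[OF \<open>neg_index V2 q l\<close>]) blast
  define e where "e = case_sum c d"
  let ?I = "{..<k} <+> {..<l}" and ?V = "{x + y |x y. x \<in> V1 \<and> y \<in> V2}"
    and ?P = "{x + y |x y. x \<in> P \<and> y \<in> R}"
  have sum: "(\<Sum>i\<in>?I. a i *\<^sub>C e i) = (\<Sum>i<k. a (Inl i) *\<^sub>C c i) + (\<Sum>i<l. a (Inr i) *\<^sub>C d i)" for a
    by (simp add: e_def sum.Plus)
  have cV: "(\<Sum>i<k. a i *\<^sub>C c i) \<in> V1" for a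
    using V c(1) by (auto intro!: complex_vector.subspace_sum complex_vector.subspace_scale)
  have dV: "(\<Sum>i<l. a i *\<^sub>C d i) \<in> V2" for a
    using V d(1) by (auto intro!: complex_vector.subspace_sum complex_vector.subspace_scale)
  \<comment> \<open>A nontrivial combination of the joined family may be trivial in one of the two
    spaces; there only the weak inequality is available, and it comes from
    \<open>q0\<close>.\<close>
  have c0: "q (\<Sum>i<k. a i *\<^sub>C c i) \<le> 0" for a
    using c(2)[of a] q0 by (cases "\<exists>i<k. a i \<noteq> 0") (auto intro: less_imp_le)
  have d0: "q (\<Sum>i<l. a i *\<^sub>C d i) \<le> 0" for a
    using d(2)[of a] q0 by (cases "\<exists>i<l. a i \<noteq> 0") (auto intro: less_imp_le)
  have "neg_index ?V q (card ?I)"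
  proof (rule neg_index_finiteI[where c = e and P = ?P])
    show "e i \<in> ?V" if "i \<in> ?I" for i
    proof -
      have "x \<in> ?V" if "x \<in> V1 \<or> x \<in> V2" for x
        using that complex_vector.subspace_0[OF V(1)] complex_vector.subspace_0[OF V(2)] by force
      with \<open>i \<in> ?I\<close> c(1) d(1) show ?thesis by (auto simp: e_def)
    qed
    show "q (\<Sum>i\<in>?I. a i *\<^sub>C e i) < 0" if nz: "\<exists>i\<in>?I. a i \<noteq> 0" for a
    proof -
      have "(\<exists>i<k. a (Inl i) \<noteq> 0) \<or> (\<exists>i<l. a (Inr i) \<noteq> 0)" using nz by auto
      then show ?thesis unfolding sum q[OF cV dV]
        using c0 d0 c(2)[of "\<lambda>i. a (Inl i)"] d(2)[of "\<lambda>i. a (Inr i)"]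
        by (meson add_neg_nonpos add_nonpos_neg)
    qed
    show "csubspace ?P" using complex_vector.subspace_sums[OF P(1) R(1)] .
    show "?P \<subseteq> ?V" using P R by blast
    show "0 \<le> q p" if "p \<in> ?P" for p
    proof -
      from that obtain x y where "x \<in> P" "y \<in> R" "p = x + y" by blast
      then show ?thesis using P R q by (auto simp: subset_iff)
    qed
    show "\<exists>a. v - (\<Sum>i\<in>?I. a i *\<^sub>C e i) \<in> ?P" if "v \<in> ?V" for v
    proof -
      from that obtain x y where v: "x \<in> V1" "y \<in> V2" "v = x + y" by blast
      from cspan[OF v(1)] obtain a where a: "x - (\<Sum>i<k. a i *\<^sub>C c i) \<in> P" by blast
      from dspan[OF v(2)] obtain b where b: "y - (\<Sum>i<l. b i *\<^sub>C d i) \<in> R" by blast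
      have "v - (\<Sum>i\<in>?I. case_sum a b i *\<^sub>C e i)
        = (x - (\<Sum>i<k. a i *\<^sub>C c i)) + (y - (\<Sum>i<l. b i *\<^sub>C d i))"
        by (simp add: sum v(3))
      then show ?thesis using a b by blast
    qed
  qed auto
  then show ?thesis by (simp add: card_Plus)
qed

text \<open>This links the relational index with the maximum in the Duistermaat index:
  \<open>neg_index_bound\<close> limits every negative definite subspace, and the span of the
  negative family attains the limit.\<close>

lemma form_neg_index_eq:
  assumes V: "csubspace V" and idx: "neg_index V (\<lambda>u. Re (Q u u)) k" and Q0: "Re (Q 0 0) = 0"
  shows "form_neg_index V Q = k"
proof -
  define q where "q = (\<lambda>u. Re (Q u u))"
  obtain c where c: "\<And>i. i < k \<Longrightarrow> c i \<in> V"
    "\<And>a. \<exists>i<k. a i \<noteq> 0 \<Longrightarrow> q (\<Sum>i<k. a i *\<^sub>C c i) < 0"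
    by (rule neg_indexE[OF idx[folded q_def]]) blast
  let ?S = "{cdim W |W. csubspace W \<and> W \<subseteq> V \<and> (\<forall>u\<in>W. u \<noteq> 0 \<longrightarrow> Re (Q u u) < 0)}"
  have le: "m \<le> k" if "m \<in> ?S" for m
  proof -
    from that[unfolded mem_Collect_eq] obtain W where
      "m = cdim W \<and> csubspace W \<and> W \<subseteq> V \<and> (\<forall>u\<in>W. u \<noteq> 0 \<longrightarrow> Re (Q u u) < 0)" ..
    then have W: "csubspace W" "W \<subseteq> V" "\<And>u. u \<in> W \<Longrightarrow> u \<noteq> 0 \<Longrightarrow> Re (Q u u) < 0"
      and m: "m = cdim W" by auto
    obtain B where B: "B \<subseteq> W" "\<not> complex_vector.dependent B" "W \<subseteq> cspan B" "card B = cdim W"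
      by (rule complex_vector.basis_exists)
    show ?thesis
    \<comment> \<open>For infinite \<open>B\<close> the cardinality, and with it
      \<open>cdim W\<close>, is 0 by convention, so the bound is trivial.\<close>
    proof (cases "finite B")
      case True
      have "card B \<le> k"
      proof (rule neg_index_bound[OF idx True, of "\<lambda>b. b"])
        show "b \<in> V" if "b \<in> B" for b using that B W by blast
        show "Re (Q (\<Sum>j\<in>B. b j *\<^sub>C j) (\<Sum>j\<in>B. b j *\<^sub>C j)) < 0" if "\<exists>j\<in>B. b j \<noteq> 0" for b
        proof (rule W(3))
          show "(\<Sum>j\<in>B. b j *\<^sub>C j) \<in> W"
            using B(1) W(1) by (auto intro!: complex_vector.subspace_sum complex_vector.subspace_scale)
          show "(\<Sum>j\<in>B. b j *\<^sub>C j) \<noteq> 0"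
            using that B(2) complex_vector.dependent_finite[OF True] by blast
        qed
      qed
      then show ?thesis using B m by simp
    qed (use B m in simp)
  qed
  have ind: "(\<Sum>i<k. a i *\<^sub>C c i) \<noteq> 0" if "\<exists>i<k. a i \<noteq> 0" for a
    using c(2)[OF that] Q0 by (auto simp: q_def)
  have inj: "inj_on c {..<k}"
  proof (rule inj_onI, rule ccontr)
    fix i j assume ij: "i \<in> {..<k}" "j \<in> {..<k}" "c i = c j" "i \<noteq> j"
    define a :: "nat \<Rightarrow> complex" where "a = (\<lambda>m. if m = i then 1 else if m = j then -1 else 0)"
    have "(\<Sum>m<k. a m *\<^sub>C c m) = (\<Sum>m\<in>{i,j}. a m *\<^sub>C c m)"
      using ij by (intro sum.mono_neutral_right) (auto simp: a_def complex_vector.scale_zero_left)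
    also have "\<dots> = 0" using ij by (simp add: a_def complex_vector.scale_minus_left)
    finally have "(\<Sum>m<k. a m *\<^sub>C c m) = 0" .
    moreover have "\<exists>m<k. a m \<noteq> 0" using ij by (intro exI[of _ i]) (simp add: a_def)
    ultimately show False using ind by blast
  qed
  have indep: "\<not> complex_vector.dependent (c ` {..<k})"
  proof
    assume "complex_vector.dependent (c ` {..<k})"
    then obtain u where "(\<Sum>w\<in>c ` {..<k}. u w *\<^sub>C w) = 0" "\<exists>w\<in>c ` {..<k}. u w \<noteq> 0"
      by (auto simp: complex_vector.dependent_finite)
    then show False using ind[of "\<lambda>i. u (c i)"] by (auto simp: sum.reindex[OF inj])
  qed
  have "k \<in> ?S"
  proof -
    let ?W = "cspan (c ` {..<k})"
    have "k = cdim ?W"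
      using complex_vector.dim_span_eq_card_independent[OF indep] card_image[OF inj] by simp
    moreover have "?W \<subseteq> V" using c(1) V by (intro complex_vector.span_minimal) auto
    moreover have "Re (Q u u) < 0" if u: "u \<in> ?W" "u \<noteq> 0" for u
    proof -
      obtain a where a: "u = (\<Sum>i<k. a (c i) *\<^sub>C c i)"
        using u(1) cspan_finite_sum[of "c ` {..<k}"] by (auto simp: sum.reindex[OF inj])
      then have "\<exists>i<k. a (c i) \<noteq> 0"
        using u(2) by (auto simp: complex_vector.scale_zero_left intro: ccontr)
      then show ?thesis using c(2)[of "\<lambda>i. a (c i)"] a by (simp add: q_def)
    qed
    ultimately show ?thesis
      unfolding mem_Collect_eq using complex_vector.subspace_span by (intro exI[of _ ?W]) auto
  qed
  moreover have "finite ?S" by (rule finite_subset[of _ "{..k}"]) (use le in auto)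
  ultimately show ?thesis unfolding form_neg_index_def using le by (intro Max_eqI) auto
qed

section \<open>Hermitian forms and the law of inertia\<close>

definition hermitian_on :: "'v::complex_vector set \<Rightarrow> ('v \<Rightarrow> 'v \<Rightarrow> complex) \<Rightarrow> bool"
  where "hermitian_on V Q \<longleftrightarrow>
    (\<forall>u\<in>V. \<forall>v\<in>V. \<forall>w\<in>V. Q u (v + w) = Q u v + Q u w) \<and>
    (\<forall>u\<in>V. \<forall>v\<in>V. \<forall>a. Q u (a *\<^sub>C v) = a * Q u v) \<and>
    (\<forall>u\<in>V. \<forall>v\<in>V. Q v u = cnj (Q u v))"

lemma hermitian_on_swap: "hermitian_on V Q \<Longrightarrow> u \<in> V \<Longrightarrow> v \<in> V \<Longrightarrow> Q v u = cnj (Q u v)"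
  unfolding hermitian_on_def by blast

lemma hermitian_onD:
  assumes Q: "hermitian_on V Q" "csubspace V" and V: "u \<in> V" "v \<in> V"
  shows "w \<in> V \<Longrightarrow> Q u (v + w) = Q u v + Q u w" "w \<in> V \<Longrightarrow> Q (v + w) u = Q v u + Q w u"
    "Q u (a *\<^sub>C v) = a * Q u v" "Q (a *\<^sub>C v) u = cnj a * Q v u"
proof -
  show 1: "Q u (v + w) = Q u v + Q u w" if "w \<in> V" for w
    using Q(1) V that unfolding hermitian_on_def by blast
  show 2: "Q u (a *\<^sub>C v) = a * Q u v" for a
    using Q(1) V unfolding hermitian_on_def by blast
  have av: "a *\<^sub>C v \<in> V" using V Q complex_vector.subspace_scale by blast
  show "Q (v + w) u = Q v u + Q w u" if w: "w \<in> V"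
  proof -
    have "v + w \<in> V" using V Q w complex_vector.subspace_add by blast
    from hermitian_on_swap[OF Q(1) V(1) this] show ?thesis
      unfolding 1[OF w] hermitian_on_swap[OF Q(1) V] hermitian_on_swap[OF Q(1) V(1) w] by simp
  qed
  show "Q (a *\<^sub>C v) u = cnj a * Q v u"
    unfolding hermitian_on_swap[OF Q(1) V(1) av] hermitian_on_swap[OF Q(1) V] 2 by simp
qed

lemma hermitian_on_self: "hermitian_on V Q \<Longrightarrow> u \<in> V \<Longrightarrow> Q u u = complex_of_real (Re (Q u u))"
  using hermitian_on_swap[of V Q u u] by (metis Reals_cnj_iff of_real_Re)

lemma hermitian_on_subset: "hermitian_on V Q \<Longrightarrow> W \<subseteq> V \<Longrightarrow> hermitian_on W Q"
  unfolding hermitian_on_def by blast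

lemma neg_index_nonneg: "csubspace V \<Longrightarrow> (\<And>v. v \<in> V \<Longrightarrow> 0 \<le> q v) \<Longrightarrow> neg_index V q 0"
  by (rule neg_indexI[where P = V]) auto

lemma neg_index_line:
  assumes "\<And>a. a \<noteq> 0 \<Longrightarrow> q (a *\<^sub>C v) < 0" "q 0 = 0"
  shows "neg_index (cspan {v}) q 1"
proof (rule neg_indexI[where c = "\<lambda>_. v" and P = "{0}"])
  show "v \<in> cspan {v}" by (simp add: complex_vector.span_base)
  show "{0} \<subseteq> cspan {v}" by (simp add: complex_vector.span_zero)
  show "csubspace {0}" by (rule complex_vector.subspace_single_0)
  show "\<exists>a. x - (\<Sum>i<(1::nat). a i *\<^sub>C v) \<in> {0}" if "x \<in> cspan {v}" for x
  proof -
    from that obtain c where "x = c *\<^sub>C v" by (auto simp: complex_vector.span_singleton)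
    then show ?thesis by (intro exI[of _ "\<lambda>_. c"]) (simp add: lessThan_Suc)
  qed
qed (use assms in \<open>auto simp: lessThan_Suc\<close>)

text \<open>A vector with nonzero value splits off as a line that adds 1 to exactly one of the two
  indices; without such a vector the form vanishes identically. The last clause is what later
  exchanges the index of a form for that of its negative.\<close>

lemma sylvester_inertia:
  assumes "csubspace V" "cfinite_dim V" "hermitian_on V Q"
  shows "\<exists>k l. neg_index V (\<lambda>u. Re (Q u u)) k \<and> neg_index V (\<lambda>u. - Re (Q u u)) l \<and>
    ((\<forall>u\<in>V. (\<forall>v\<in>V. Q v u = 0) \<longrightarrow> u = 0) \<longrightarrow> k + l = cdim V)"
  using assms
proof (induction "cdim V" arbitrary: V rule: less_induct)
  case less
  note V = less.prems(1) and fd = less.prems(2) and Q = less.prems(3)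
  note H = hermitian_onD[OF Q V]
  show ?case
  proof (cases "\<exists>v\<in>V. Q v v \<noteq> 0")
    case True
    then obtain v where v: "v \<in> V" "Q v v \<noteq> 0" by blast
    define r where "r = Re (Q v v)"
    have r: "Q v v = complex_of_real r" "r \<noteq> 0"
      using hermitian_on_self[OF Q v(1)] v(2) by (auto simp: r_def)
    define W where "W = {u \<in> V. Q v u = 0}"
    have Q0: "Q v 0 = 0"
      using H(3)[OF v(1) v(1), of 0] by (simp add: complex_vector.scale_zero_left)
    have "W \<subseteq> V" by (auto simp: W_def)
    have W: "csubspace W"
    proof (rule complex_vector.subspaceI)
      show "0 \<in> W" using Q0 complex_vector.subspace_0[OF V] by (simp add: W_def)
      show "x + y \<in> W" if "x \<in> W" "y \<in> W" for x y
        using that complex_vector.subspace_add[OF V] H(1)[OF v(1)] by (simp add: W_def)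
      show "c *\<^sub>C x \<in> W" if "x \<in> W" for c x
        using that complex_vector.subspace_scale[OF V] H(3)[OF v(1)] by (simp add: W_def)
    qed
    have vW: "v \<notin> W" using v by (simp add: W_def)
    have split: "\<exists>a. x - a *\<^sub>C v \<in> W" if x: "x \<in> V" for x
    proof -
      let ?a = "Q v x / Q v v"
      have av: "(- ?a) *\<^sub>C v \<in> V" using complex_vector.subspace_scale[OF V v(1)] .
      have "Q v (x + (- ?a) *\<^sub>C v) = 0"
        unfolding H(1)[OF v(1) x av] H(3)[OF v(1) v(1)] using v(2) by simp
      then have "x + (- ?a) *\<^sub>C v \<in> W"
        using complex_vector.subspace_add[OF V x av] unfolding W_def by blast
      then show ?thesis by (auto simp: complex_vector.scale_minus_left intro!: exI[of _ ?a])
    qed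
    have dim: "cdim V = Suc (cdim W)"
      by (rule cdim_split_line[OF V W \<open>W \<subseteq> V\<close> v(1) vW split fd])
    obtain k l where kl: "neg_index W (\<lambda>u. Re (Q u u)) k" "neg_index W (\<lambda>u. - Re (Q u u)) l"
      "(\<forall>u\<in>W. (\<forall>v\<in>W. Q v u = 0) \<longrightarrow> u = 0) \<Longrightarrow> k + l = cdim W"
      using less.hyps[OF _ W cfinite_dim_subset[OF fd \<open>W \<subseteq> V\<close>]
          hermitian_on_subset[OF Q \<open>W \<subseteq> V\<close>]] dim by auto
    have line: "cspan {v} \<subseteq> V" using v V by (intro complex_vector.span_minimal) auto
    have sum: "{x + y |x y. x \<in> cspan {v} \<and> y \<in> W} = V"
    proof (intro subset_antisym subsetI)
      fix x assume "x \<in> {x + y |x y. x \<in> cspan {v} \<and> y \<in> W}"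
      then show "x \<in> V" using line \<open>W \<subseteq> V\<close> complex_vector.subspace_add[OF V] by blast
    next
      fix x assume "x \<in> V"
      with split obtain a where "x - a *\<^sub>C v \<in> W" by blast
      moreover have "a *\<^sub>C v \<in> cspan {v}" by (simp add: complex_vector.span_base complex_vector.span_scale)
      moreover have "x = a *\<^sub>C v + (x - a *\<^sub>C v)" by simp
      ultimately show "x \<in> {x + y |x y. x \<in> cspan {v} \<and> y \<in> W}" by blast
    qed
    have add: "Q (x + y) (x + y) = Q x x + Q y y" if xy: "x \<in> cspan {v}" "y \<in> W" for x y
    proof -
      from xy(1) obtain a where a: "x = a *\<^sub>C v" by (auto simp: complex_vector.span_singleton)
      have xV: "x \<in> V" and yV: "y \<in> V" and vy: "Q v y = 0" using xy line by (auto simp: W_def)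
      have "Q x y = 0" using H(4)[OF yV v(1)] a vy by simp
      moreover from this have "Q y x = 0" using hermitian_on_swap[OF Q xV yV] by simp
      ultimately show ?thesis
        using H(1)[OF complex_vector.subspace_add[OF V xV yV] xV yV] H(2)[OF xV xV yV] H(2)[OF yV xV yV]
        by simp
    qed
    have self: "Q (a *\<^sub>C v) (a *\<^sub>C v) = complex_of_real ((cmod a)\<^sup>2 * r)" for a
      using H(3)[OF _ v(1), of "a *\<^sub>C v" a] H(4)[OF v(1) v(1), of a]
        complex_vector.subspace_scale[OF V v(1), of a] r
      by (simp add: complex_norm_square mult_ac del: of_real_power)
    have z: "Q 0 0 = 0" using self[of 0] by (simp add: complex_vector.scale_zero_left)
    obtain k' l' where kl': "neg_index (cspan {v}) (\<lambda>u. Re (Q u u)) k'"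
      "neg_index (cspan {v}) (\<lambda>u. - Re (Q u u)) l'" "k' + l' = (1::nat)"
    proof (cases "r < 0")
      case True
      have "neg_index (cspan {v}) (\<lambda>u. Re (Q u u)) 1"
        by (rule neg_index_line) (use True z self in \<open>auto simp: mult_pos_neg\<close>)
      moreover have "neg_index (cspan {v}) (\<lambda>u. - Re (Q u u)) 0"
        by (rule neg_index_nonneg[OF complex_vector.subspace_span])
          (use True self in \<open>auto simp: complex_vector.span_singleton mult_nonneg_nonpos\<close>)
      ultimately show thesis by (rule that) simp
    next
      case False
      then have "r > 0" using r by simp
      have "neg_index (cspan {v}) (\<lambda>u. - Re (Q u u)) 1"
        by (rule neg_index_line) (use \<open>r > 0\<close> z self in auto)
      moreover have "neg_index (cspan {v}) (\<lambda>u. Re (Q u u)) 0"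
        by (rule neg_index_nonneg[OF complex_vector.subspace_span])
          (use \<open>r > 0\<close> self in \<open>auto simp: complex_vector.span_singleton\<close>)
      ultimately show thesis by (intro that[of 0 1]) auto
    qed
    have "neg_index V (\<lambda>u. Re (Q u u)) (k' + k)" "neg_index V (\<lambda>u. - Re (Q u u)) (l' + l)"
      using neg_index_add[OF complex_vector.subspace_span W _ _ kl'(1) kl(1)]
        neg_index_add[OF complex_vector.subspace_span W _ _ kl'(2) kl(2)] add z
      unfolding sum by auto
    \<comment> \<open>Nondegeneracy passes to \<open>W\<close>: an element of \<open>W\<close>
      orthogonal to \<open>W\<close> is orthogonal to \<open>v\<close> as well, hence to all of
      \<open>V\<close>.\<close>
    moreover have "(k' + k) + (l' + l) = cdim V" if nd: "\<forall>u\<in>V. (\<forall>v\<in>V. Q v u = 0) \<longrightarrow> u = 0"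
    proof -
      have "u = 0" if u: "u \<in> W" "\<forall>w\<in>W. Q w u = 0" for u
      proof -
        have "Q x u = 0" if "x \<in> V" for x
        proof -
          obtain a where a: "x - a *\<^sub>C v \<in> W" using split \<open>x \<in> V\<close> by blast
          have uV: "u \<in> V" "Q v u = 0" using u by (auto simp: W_def)
          have "Q ((x - a *\<^sub>C v) + a *\<^sub>C v) u = Q (x - a *\<^sub>C v) u + Q (a *\<^sub>C v) u"
            using a \<open>W \<subseteq> V\<close> uV complex_vector.subspace_scale[OF V v(1)] by (intro H(2)) auto
          then show ?thesis using u(2) a H(4)[OF uV(1) v(1)] uV(2) by simp
        qed
        then show ?thesis using nd u \<open>W \<subseteq> V\<close> by blast
      qed
      then have "k + l = cdim W" using kl(3) by blast
      then show ?thesis using dim kl'(3) by simp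
    qed
    ultimately show ?thesis by blast
  next
    case False
    then have q0: "Q v v = 0" if "v \<in> V" for v using that by blast
    \<comment> \<open>Polarization: isotropy of \<open>u + w\<close> gives
      \<open>Q u w = - Q w u\<close>, isotropy of \<open>u + \<i> *\<^sub>C w\<close> gives
      \<open>Q u w = Q w u\<close>.\<close>
    have pol: "Q u w = 0" if uw: "u \<in> V" "w \<in> V" for u w
    proof -
      have sum0: "Q x y + Q y x = 0" if xy: "x \<in> V" "y \<in> V" for x y
        using q0[OF complex_vector.subspace_add[OF V xy]] q0 xy
          H(1)[OF complex_vector.subspace_add[OF V xy] xy] H(2)[OF xy(1) xy] H(2)[OF xy(2) xy]
        by (simp add: add.commute)
      have "\<i> * Q u w - \<i> * Q w u = 0"
        using sum0[OF uw(1) complex_vector.subspace_scale[OF V uw(2)], of \<i>]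
          H(3)[OF uw, of \<i>] H(4)[OF uw, of \<i>] by simp
      then have "Q u w = Q w u" by simp
      then show ?thesis using sum0[OF uw] by simp
    qed
    have "neg_index V (\<lambda>u. Re (Q u u)) 0" "neg_index V (\<lambda>u. - Re (Q u u)) 0"
      using q0 by (auto intro!: neg_index_nonneg V)
    moreover have "cdim V = 0" if nd: "\<forall>u\<in>V. (\<forall>v\<in>V. Q v u = 0) \<longrightarrow> u = 0"
    proof -
      have "V \<subseteq> {0}" using nd pol by blast
      then show ?thesis
        using complex_vector.dim_le_card[of V "{}"] by (simp add: complex_vector.span_empty)
    qed
    ultimately show ?thesis by (intro exI[of _ "0::nat"]) auto
  qed
qed

section \<open>Self-adjoint maps on finite-dimensional spaces\<close>

text \<open>The vectors are not normalised, so eigenvectors can be collected as they come.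
  Coefficients are divided by \<open>cinner b b\<close>, which is nonzero because 0 is
  excluded.\<close>

definition corthogonal :: "'a::complex_inner set \<Rightarrow> bool"
  where "corthogonal B \<longleftrightarrow> finite B \<and> 0 \<notin> B \<and> (\<forall>b\<in>B. \<forall>c\<in>B. b \<noteq> c \<longrightarrow> cinner b c = 0)"

lemma corthogonal_coeff:
  assumes "corthogonal B" "b \<in> B"
  shows "cinner b (\<Sum>c\<in>B. a c *\<^sub>C c) = a b * cinner b b"
proof -
  have "cinner b (\<Sum>c\<in>B. a c *\<^sub>C c) = (\<Sum>c\<in>B. a c * cinner b c)"
    by (simp add: cinner_sum_right cinner_scaleC_right)
  also have "\<dots> = (\<Sum>c\<in>{b}. a c * cinner b c)"
    using assms by (intro sum.mono_neutral_right) (auto simp: corthogonal_def)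
  finally show ?thesis by simp
qed

lemma corthogonal_independent:
  assumes "corthogonal B"
  shows "\<not> complex_vector.dependent B"
proof
  have fin: "finite B" using assms by (simp add: corthogonal_def)
  assume "complex_vector.dependent B"
  then obtain u where u: "(\<Sum>b\<in>B. u b *\<^sub>C b) = 0" "\<exists>b\<in>B. u b \<noteq> 0"
    using complex_vector.dependent_finite[OF fin] by blast
  then obtain b where b: "b \<in> B" "u b \<noteq> 0" by blast
  then have "u b * cinner b b = 0" using corthogonal_coeff[OF assms b(1), of u] u(1) by simp
  then show False using b assms by (auto simp: corthogonal_def)
qed

lemma corthogonal_expansion:
  assumes "corthogonal B" "x \<in> cspan B"
  shows "x = (\<Sum>b\<in>B. (cinner b x / cinner b b) *\<^sub>C b)"
proof -
  have fin: "finite B" using assms by (simp add: corthogonal_def)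
  obtain a where a: "x = (\<Sum>b\<in>B. a b *\<^sub>C b)" using assms(2) cspan_finite_sum[OF fin] by auto
  have "cinner b x / cinner b b = a b" if "b \<in> B" for b
    using corthogonal_coeff[OF assms(1) that, of a] a that assms(1) by (auto simp: corthogonal_def)
  then have "(\<Sum>b\<in>B. (cinner b x / cinner b b) *\<^sub>C b) = (\<Sum>b\<in>B. a b *\<^sub>C b)"
    by (intro sum.cong) auto
  with a show ?thesis by simp
qed

text \<open>The iterates of \<open>v\<close> under \<open>D\<close> are dependent, so some nonzero
  polynomial p satisfies p(D)v = 0. Stripping linear factors from p one by one must meet an
  eigenvector before only a nonzero constant is left.\<close>

lemma eigenvector_exists:
  fixes D :: "'a::complex_vector \<Rightarrow> 'a"
  assumes V: "csubspace V" "cfinite_dim V" and D: "clinear_on V D" "\<And>x. x \<in> V \<Longrightarrow> D x \<in> V"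
    and v: "v \<in> V" "v \<noteq> 0"
  obtains w r where "w \<in> V" "w \<noteq> 0" "D w = r *\<^sub>C w"
proof -
  \<comment> \<open>\<open>ap p\<close> is p(D)v, evaluated by Horner's scheme.\<close>
  define ap where "ap = (\<lambda>p. fold_coeffs (\<lambda>a w. a *\<^sub>C v + D w) p 0)"
  have D0: "D 0 = 0" using clinear_on_zero[OF D(1) V(1)] .
  have ap0: "ap 0 = 0" by (simp add: ap_def)
  have apC: "ap (pCons a p) = a *\<^sub>C v + D (ap p)" for a p
    by (cases "a = 0 \<and> p = 0") (auto simp: ap_def D0 complex_vector.scale_zero_left)
  have apV: "ap p \<in> V" for p
    by (induction p) (use V v D in \<open>auto simp: ap0 apC complex_vector.subspace_0
        intro!: complex_vector.subspace_add complex_vector.subspace_scale\<close>)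
  have ap_add: "ap (p + q) = ap p + ap q" for p q
    by (induction p q rule: poly_induct2)
       (auto simp: ap0 apC clinear_onD(1)[OF D(1) V(1) apV apV] scaleC_add_left)
  have ap_smult: "ap (smult c p) = c *\<^sub>C ap p" for c p
    by (induction p) (auto simp: ap0 apC clinear_onD(2)[OF D(1) V(1) apV] scaleC_add_right
        scaleC_scaleC complex_vector.scale_zero_right)
  have ap_sum: "ap (\<Sum>i\<in>I. f i) = (\<Sum>i\<in>I. ap (f i))" for I :: "nat set" and f
    by (induction I rule: infinite_finite_induct) (auto simp: ap0 ap_add)
  \<comment> \<open>If p = (X - r)q, then q(D)v is annihilated by D - r: either it is an
    eigenvector, or it is 0 and q has smaller degree.\<close>
  have eig: "\<exists>w\<in>V. \<exists>r. w \<noteq> 0 \<and> D w = r *\<^sub>C w" if "p \<noteq> 0" "ap p = 0" for p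
    using that
  proof (induction "degree p" arbitrary: p)
    case 0
    then obtain c where c: "p = [:c:]" by (metis degree_eq_zeroE)
    then show ?case using 0 v by (simp add: apC ap0 D0 complex_vector.scale_eq_0_iff)
  next
    case (Suc n)
    then have "\<not> constant (poly p)" by (simp add: constant_degree)
    then obtain r where "poly p r = 0" using fundamental_theorem_of_algebra by blast
    then obtain q where q: "p = [:- r, 1:] * q" by (auto simp: poly_eq_0_iff_dvd dvd_def)
    have "q \<noteq> 0" using q Suc.prems by auto
    then have "degree p = Suc (degree q)" unfolding q by (subst degree_mult_eq) auto
    then have deg: "n = degree q" using Suc.hyps by simp
    have eq: "(- r) *\<^sub>C ap q + D (ap q) = 0"
      using Suc.prems(2) unfolding q
      by (simp add: ap_add ap_smult apC complex_vector.scale_zero_left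
          flip: smult_minus_left)
    show ?case
    proof (cases "ap q = 0")
      case True
      then show ?thesis using Suc.hyps(1)[OF deg \<open>q \<noteq> 0\<close>] by blast
    next
      case False
      then show ?thesis using apV eq
        by (intro bexI[of _ "ap q"] exI[of _ r]) (auto simp: complex_vector.scale_minus_left)
    qed
  qed
  have ap_monom: "ap (monom a j) = a *\<^sub>C (D ^^ j) v" for a j
  proof -
    have DV: "(D ^^ j) v \<in> V" for j by (induction j) (use D v in auto)
    show ?thesis
    proof (induction j)
      case (Suc j)
      then show ?case
        by (simp add: monom_Suc apC complex_vector.scale_zero_left clinear_onD(2)[OF D(1) V(1) DV])
    qed (simp add: monom_0 apC ap0 D0)
  qed
  obtain B where B: "finite B" "cspan B = V" using cfinite_dim_basis[OF V] by metis
  obtain h where h: "bij_betw h {0..<card B} B" using ex_bij_betw_nat_finite[OF B(1)] by blast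
  have "\<exists>a. ap (monom 1 j) = (\<Sum>i<card B. a i *\<^sub>C h i)" for j
  proof -
    obtain a where "ap (monom 1 j) = (\<Sum>b\<in>B. a b *\<^sub>C b)"
      using apV[of "monom 1 j"] B cspan_finite_sum[OF B(1)] by auto
    also have "\<dots> = (\<Sum>i<card B. a (h i) *\<^sub>C h i)"
      using sum.reindex_bij_betw[OF h, of "\<lambda>b. a b *\<^sub>C b"] by (simp add: atLeast0LessThan)
    finally show ?thesis by (rule exI[of _ "\<lambda>i. a (h i)"])
  qed
  then obtain a where a: "\<And>j. ap (monom 1 j) = (\<Sum>i<card B. a j i *\<^sub>C h i)" by metis
  \<comment> \<open>One iterate more than there are basis vectors, which is what makes the system
    for the coefficients solvable.\<close>
  let ?J = "{..card B}"
  obtain b where b: "\<exists>j\<in>?J. b j \<noteq> 0" "\<And>i. i < card B \<Longrightarrow> (\<Sum>j\<in>?J. b j * a j i) = 0"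
    using homogeneous_system[of ?J "card B" a] by auto
  define p where "p = (\<Sum>j\<in>?J. monom (b j) j)"
  obtain j where j: "j \<in> ?J" "b j \<noteq> 0" using b(1) by blast
  have "coeff p j = b j" using j(1) by (simp add: p_def coeff_sum sum.delta)
  then have "p \<noteq> 0" using j by auto
  moreover have "ap p = 0"
  proof -
    have "ap p = (\<Sum>j\<in>?J. b j *\<^sub>C ap (monom 1 j))" by (simp add: p_def ap_sum ap_monom scaleC_one)
    also have "\<dots> = (\<Sum>i<card B. (\<Sum>j\<in>?J. b j * a j i) *\<^sub>C h i)"
      unfolding a by (simp add: complex_vector.scale_sum_left complex_vector.scale_sum_right
        complex_vector.scale_scale) (rule sum.swap)
    also have "\<dots> = 0" using b(2) by (simp add: complex_vector.scale_zero_left)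
    finally show ?thesis .
  qed
  ultimately show thesis using eig that by blast
qed

text \<open>The orthogonal complement of an eigenvector is invariant because \<open>D\<close> is
  symmetric on \<open>V\<close>, so the induction can continue there.\<close>

lemma spectral_theorem:
  fixes D :: "'a::complex_inner \<Rightarrow> 'a"
  assumes "csubspace V" "cfinite_dim V" "clinear_on V D" "\<And>x. x \<in> V \<Longrightarrow> D x \<in> V"
    and "\<And>x y. x \<in> V \<Longrightarrow> y \<in> V \<Longrightarrow> cinner x (D y) = cinner (D x) y"
  shows "\<exists>B \<mu>. corthogonal B \<and> cspan B = V \<and> (\<forall>b\<in>B. D b = complex_of_real (\<mu> b) *\<^sub>C b)"
  using assms
proof (induction "cdim V" arbitrary: V rule: less_induct)
  case less
  note V = less.prems(1,2) and D = less.prems(3-5)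
  show ?case
  proof (cases "V = {0}")
    case True
    then show ?thesis by (intro exI[of _ "{}"]) (auto simp: corthogonal_def complex_vector.span_empty)
  next
    case False
    then obtain v where "v \<in> V" "v \<noteq> 0" using complex_vector.subspace_0[OF V(1)] by blast
    then obtain w r where w: "w \<in> V" "w \<noteq> 0" "D w = r *\<^sub>C w"
      using eigenvector_exists[OF V D(1,2)] by metis
    have "r * cinner w w = cnj r * cinner w w"
      using D(3)[OF w(1) w(1)] w(3) by (simp add: cinner_algebra)
    then have "r \<in> \<real>" using w(2) by (simp add: Reals_cnj_iff)
    then obtain m where m: "r = complex_of_real m" by (auto elim: Reals_cases)
    define W where "W = {u \<in> V. cinner w u = 0}"
    have WV: "W \<subseteq> V" by (auto simp: W_def)
    have W: "csubspace W"
      by (rule complex_vector.subspaceI)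
         (auto simp: W_def cinner_algebra complex_vector.subspace_0[OF V(1)]
           complex_vector.subspace_add[OF V(1)] complex_vector.subspace_scale[OF V(1)])
    have wW: "w \<notin> W" using w by (simp add: W_def)
    have split: "\<exists>a. x - a *\<^sub>C w \<in> W" if x: "x \<in> V" for x
      using x w complex_vector.subspace_scale[OF V(1)] complex_vector.subspace_diff[OF V(1)]
      by (intro exI[of _ "cinner w x / cinner w w"]) (auto simp: W_def cinner_algebra)
    have dim: "cdim V = Suc (cdim W)"
      by (rule cdim_split_line[OF V(1) W WV w(1) wW split V(2)])
    have inv: "D x \<in> W" if "x \<in> W" for x
      using that D(2,3) w by (auto simp: W_def cinner_algebra)
    obtain B \<mu> where B: "corthogonal B" "cspan B = W" "\<forall>b\<in>B. D b = complex_of_real (\<mu> b) *\<^sub>C b"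
      using less.hyps[OF _ W cfinite_dim_subset[OF V(2) WV] clinear_on_subset[OF D(1) WV] inv] D(3)
        WV dim by (auto simp: subset_iff)
    have BW: "B \<subseteq> W" using B(2) complex_vector.span_superset by blast
    have "cspan (insert w B) = V"
    proof (rule subset_antisym)
      show "cspan (insert w B) \<subseteq> V" using w BW WV V by (intro complex_vector.span_minimal) auto
      show "V \<subseteq> cspan (insert w B)"
        unfolding complex_vector.span_insert using split B(2) by auto
    qed
    moreover have "corthogonal (insert w B)"
    proof -
      have "cinner w b = 0" "cinner b w = 0" if "b \<in> B" for b
        using that BW cinner_commute[of b w] by (auto simp: W_def)
      then show ?thesis using B(1) w(2) by (auto simp: corthogonal_def)
    qed
    moreover have "\<forall>b\<in>insert w B. D b = complex_of_real ((\<mu>(w := m)) b) *\<^sub>C b"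
      using B(3) w(3) m wW BW by auto
    ultimately show ?thesis by blast
  qed
qed

text \<open>The spectral theorem for the zero map supplies an orthogonal basis and takes the place
  of the Gram-Schmidt process.\<close>

lemma orthogonal_projection:
  fixes V :: "'a::complex_inner set"
  assumes "csubspace V" "cfinite_dim V"
  shows "\<exists>y\<in>V. \<forall>w\<in>V. cinner w (x - y) = 0"
proof -
  have "clinear_on V (\<lambda>_. 0)" by (simp add: clinear_on_def complex_vector.scale_zero_right)
  then obtain B where B: "corthogonal B" "cspan B = V"
    using spectral_theorem[OF assms, of "\<lambda>_. 0"] complex_vector.subspace_0[OF assms(1)] by auto
  define y where "y = (\<Sum>b\<in>B. (cinner b x / cinner b b) *\<^sub>C b)"
  have yV: "y \<in> V" unfolding y_def B(2)[symmetric]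
    by (intro complex_vector.span_sum complex_vector.span_scale complex_vector.span_base)
  have orth: "cinner b (x - y) = 0" if "b \<in> B" for b
    using corthogonal_coeff[OF B(1) that, of "\<lambda>b. cinner b x / cinner b b"] B(1) that
    by (auto simp: y_def cinner_diff_right corthogonal_def)
  have "cinner w (x - y) = 0" if "w \<in> V" for w
  proof -
    have "w = (\<Sum>b\<in>B. (cinner b w / cinner b b) *\<^sub>C b)"
      using corthogonal_expansion[OF B(1)] B(2) that by simp
    then have "cinner w (x - y) = cinner (\<Sum>b\<in>B. (cinner b w / cinner b b) *\<^sub>C b) (x - y)" by simp
    also have "\<dots> = 0" using orth by (simp add: cinner_sum_left cinner_scaleC_left)
    finally show ?thesis .
  qed
  with yV show ?thesis by blast
qed

section \<open>Self-adjoint operators of finite rank\<close>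

lemma corthogonal_subset: "corthogonal B \<Longrightarrow> C \<subseteq> B \<Longrightarrow> corthogonal C"
  by (auto simp: corthogonal_def intro: finite_subset)

lemma corthogonal_norm:
  assumes "corthogonal B"
  shows "(norm (\<Sum>b\<in>B. a b *\<^sub>C b))\<^sup>2 = (\<Sum>b\<in>B. (cmod (a b))\<^sup>2 * (norm b)\<^sup>2)"
proof -
  let ?x = "\<Sum>b\<in>B. a b *\<^sub>C b"
  have "cinner ?x ?x = (\<Sum>b\<in>B. cnj (a b) * cinner b ?x)"
    by (simp only: cinner_sum_left cinner_scaleC_left)
  also have "\<dots> = (\<Sum>b\<in>B. complex_of_real ((cmod (a b))\<^sup>2 * (norm b)\<^sup>2))"
    by (intro sum.cong refl)
       (simp add: corthogonal_coeff[OF assms] cinner_self complex_norm_square mult_ac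
         del: of_real_power)
  finally have "complex_of_real ((norm ?x)\<^sup>2)
      = complex_of_real (\<Sum>b\<in>B. (cmod (a b))\<^sup>2 * (norm b)\<^sup>2)"
    by (simp only: cinner_self of_real_sum)
  then show ?thesis by (simp only: of_real_eq_iff)
qed

text \<open>\<open>B\<close> diagonalises \<open>D\<close> on a subspace containing its range, later
  \<open>N_space S l\<close>. Eigenvectors for 0 are kept in \<open>B\<close>: they count the kernel
  of \<open>D\<close> inside that subspace, whereas the kernel in the whole space may be
  infinite-dimensional.\<close>

locale finite_rank_operator =
  fixes D :: "'h::complex_inner \<Rightarrow> 'h" and B :: "'h set" and \<mu> :: "'h \<Rightarrow> real"
  assumes linear: "clinear_on UNIV D"
    and hermitian: "cinner x (D y) = cinner (D x) y"
    and orth: "corthogonal B"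
    and range: "D x \<in> cspan B"
    and eig: "b \<in> B \<Longrightarrow> D b = complex_of_real (\<mu> b) *\<^sub>C b"
begin

lemma finite_B: "finite B" using orth by (simp add: corthogonal_def)

lemma cinner_nonzero: "b \<in> B \<Longrightarrow> cinner b b \<noteq> 0"
  using orth by (auto simp: corthogonal_def)

lemma cinner_D: "b \<in> B \<Longrightarrow> cinner b (D x) = complex_of_real (\<mu> b) * cinner b x"
  by (simp add: hermitian eig cinner_scaleC_left)

lemma D_sum: "D (\<Sum>i\<in>I. a i *\<^sub>C c i) = (\<Sum>i\<in>I. a i *\<^sub>C D (c i))"
  by (rule clinear_on_sum[OF linear]) auto

lemma expansion: "D x = (\<Sum>b\<in>B. (complex_of_real (\<mu> b) * cinner b x / cinner b b) *\<^sub>C b)"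
proof -
  have "D x = (\<Sum>b\<in>B. (cinner b (D x) / cinner b b) *\<^sub>C b)"
    by (rule corthogonal_expansion[OF orth range])
  then show ?thesis by (simp add: cinner_D)
qed

lemma independent: "C \<subseteq> B \<Longrightarrow> edim (cspan C) = enat (card C)"
  by (meson corthogonal_independent corthogonal_subset edim_cspan_independent finite_B finite_subset orth)

lemma csubspace_eigenspace: "csubspace (eigenspace UNIV D m)"
  using complex_vector.subspace_UNIV clinear_on_zero[OF linear]
  by (intro complex_vector.subspaceI)
     (auto simp: eigenspace_def clinear_onD[OF linear] scaleC_add_right scaleC_scaleC mult.commute
       complex_vector.scale_zero_right)

lemma eigenspace_span: "eigenspace (cspan B) D m = cspan {b\<in>B. \<mu> b = m}"
proof (rule subset_antisym)
  have "cspan {b\<in>B. \<mu> b = m} \<subseteq> eigenspace UNIV D m"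
    by (intro complex_vector.span_minimal csubspace_eigenspace) (auto simp: eigenspace_def eig)
  moreover have "cspan {b\<in>B. \<mu> b = m} \<subseteq> cspan B" by (intro complex_vector.span_mono) auto
  ultimately show "cspan {b\<in>B. \<mu> b = m} \<subseteq> eigenspace (cspan B) D m"
    by (auto simp: eigenspace_def)
next
  show "eigenspace (cspan B) D m \<subseteq> cspan {b\<in>B. \<mu> b = m}"
  proof
    fix x assume "x \<in> eigenspace (cspan B) D m"
    then have x: "x \<in> cspan B" "D x = complex_of_real m *\<^sub>C x" by (auto simp: eigenspace_def)
    have 0: "cinner b x = 0" if "b \<in> B" "\<mu> b \<noteq> m" for b
      using cinner_D[OF that(1), of x] x(2) that by (simp add: cinner_scaleC_right)
    have "x = (\<Sum>b\<in>B. (cinner b x / cinner b b) *\<^sub>C b)"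
      by (rule corthogonal_expansion[OF orth x(1)])
    also have "\<dots> = (\<Sum>b\<in>{b\<in>B. \<mu> b = m}. (cinner b x / cinner b b) *\<^sub>C b)"
      by (intro sum.mono_neutral_right finite_B)
         (auto simp: 0 complex_vector.scale_zero_left)
    also have "\<dots> \<in> cspan {b\<in>B. \<mu> b = m}"
      by (intro complex_vector.span_sum complex_vector.span_scale complex_vector.span_base)
    finally show "x \<in> cspan {b\<in>B. \<mu> b = m}" .
  qed
qed

text \<open>An eigenvector for a nonzero eigenvalue is a multiple of its own image, hence lies in
  the range of \<open>D\<close>.\<close>

lemma eigenspace_UNIV:
  assumes "m \<noteq> 0"
  shows "eigenspace UNIV D m = cspan {b\<in>B. \<mu> b = m}"
proof -
  have "x \<in> cspan B" if "D x = complex_of_real m *\<^sub>C x" for x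
  proof -
    have "x = (1 / complex_of_real m) *\<^sub>C D x"
      using that assms by (simp add: scaleC_scaleC scaleC_one)
    then show ?thesis using range[of x] complex_vector.span_scale by metis
  qed
  then show ?thesis unfolding eigenspace_span[symmetric] by (auto simp: eigenspace_def)
qed

lemma eigenvalues_UNIV:
  assumes "0 \<notin> A"
  shows "eigenvalues UNIV D \<inter> A = \<mu> ` {b\<in>B. \<mu> b \<in> A}"
proof -
  have iff: "(\<exists>x\<in>eigenspace UNIV D m. x \<noteq> 0) \<longleftrightarrow> (\<exists>b\<in>B. \<mu> b = m)" if "m \<in> A" for m
  proof -
    have m: "m \<noteq> 0" using assms that by blast
    have "\<exists>b\<in>B. \<mu> b = m" if "x \<in> cspan {b\<in>B. \<mu> b = m}" "x \<noteq> 0" for x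
    proof (rule ccontr)
      assume "\<not> (\<exists>b\<in>B. \<mu> b = m)"
      then have empty: "{b\<in>B. \<mu> b = m} = {}" by blast
      then show False using that unfolding empty complex_vector.span_empty by blast
    qed
    moreover have "b \<in> cspan {b\<in>B. \<mu> b = m}" "b \<noteq> 0" if "b \<in> B" "\<mu> b = m" for b
      using that orth by (auto simp: corthogonal_def intro: complex_vector.span_base)
    ultimately show ?thesis unfolding eigenspace_UNIV[OF m] by blast
  qed
  show ?thesis
  proof (rule set_eqI)
    fix m
    have "m \<in> eigenvalues UNIV D \<inter> A \<longleftrightarrow> m \<in> A \<and> (\<exists>b\<in>B. \<mu> b = m)"
      unfolding eigenvalues_def mem_Collect_eq Int_iff using iff[of m] by argo
    also have "\<dots> \<longleftrightarrow> m \<in> \<mu> ` {b\<in>B. \<mu> b \<in> A}" by auto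
    finally show "m \<in> eigenvalues UNIV D \<inter> A \<longleftrightarrow> m \<in> \<mu> ` {b\<in>B. \<mu> b \<in> A}" .
  qed
qed

text \<open>The multiplicity of an eigenvalue is the size of the fibre of \<open>\<mu>\<close> over
  it, so the sum over eigenvalues counts elements of \<open>B\<close> fibre by fibre.\<close>

lemma eigenvalue_count_UNIV:
  assumes "0 \<notin> A"
  shows "eigenvalue_count UNIV D A = enat (card {b\<in>B. \<mu> b \<in> A})"
proof -
  let ?I = "{b\<in>B. \<mu> b \<in> A}"
  have fin: "finite ?I" using finite_B by simp
  have "eigenvalue_count UNIV D A = (\<Sum>m\<in>\<mu> ` ?I. edim (eigenspace UNIV D m))"
    using fin by (simp add: eigenvalue_count_def eigenvalues_UNIV[OF assms])
  also have "\<dots> = (\<Sum>m\<in>\<mu> ` ?I. of_nat (card {b\<in>?I. \<mu> b = m}))"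
  proof (rule sum.cong[OF refl])
    fix m assume "m \<in> \<mu> ` ?I"
    then have "m \<in> A" "m \<noteq> 0" using assms by auto
    moreover from this have "{b\<in>B. \<mu> b = m} = {b\<in>?I. \<mu> b = m}" by auto
    ultimately show "edim (eigenspace UNIV D m) = of_nat (card {b\<in>?I. \<mu> b = m})"
      using independent[of "{b\<in>B. \<mu> b = m}"] by (simp add: eigenspace_UNIV of_nat_eq_enat)
  qed
  also have "\<dots> = of_nat (\<Sum>m\<in>\<mu> ` ?I. card {b\<in>?I. \<mu> b = m})" by simp
  also have "(\<Sum>m\<in>\<mu> ` ?I. card {b\<in>?I. \<mu> b = m}) = card ?I"
    using sum.image_gen[OF fin, of "\<lambda>_. 1::nat" \<mu>] by (simp add: card_eq_sum del: sum_constant)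
  finally show ?thesis by (simp add: of_nat_eq_enat)
qed

lemma n_neg_eq: "n_neg UNIV D = enat (card {b\<in>B. \<mu> b < 0})"
  unfolding n_neg_def by (subst eigenvalue_count_UNIV) auto

lemma n_pos_eq: "n_pos UNIV D = enat (card {b\<in>B. \<mu> b > 0})"
  unfolding n_pos_def by (subst eigenvalue_count_UNIV) auto

text \<open>When 0 is not an eigenvalue the count is an empty sum, which agrees with the dimension
  of the zero space.\<close>

lemma n_zero_eq: "n_zero (cspan B) D = edim (eigenspace (cspan B) D 0)"
proof (cases "0 \<in> eigenvalues (cspan B) D")
  case True
  then have "eigenvalues (cspan B) D \<inter> {0} = {0}" by blast
  then show ?thesis by (simp add: n_zero_def eigenvalue_count_def)
next
  case False
  then have "eigenvalues (cspan B) D \<inter> {0} = {}" by blast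
  moreover have sub: "eigenspace (cspan B) D 0 \<subseteq> cspan {}"
    using False by (auto simp: eigenvalues_def complex_vector.span_empty)
  have "edim (eigenspace (cspan B) D 0) = 0"
  proof -
    have "cfinite_dim (eigenspace (cspan B) D 0)" unfolding cfinite_dim_def using sub by blast
    then show ?thesis
      using complex_vector.dim_le_card[OF sub] by (simp add: edim_cfinite zero_enat_def)
  qed
  ultimately show ?thesis by (simp add: n_zero_def eigenvalue_count_def)
qed

lemma edim_kernel: "edim (eigenspace (cspan B) D 0) = enat (card {b\<in>B. \<mu> b = 0})"
  unfolding eigenspace_span by (rule independent) auto

lemma edim_range: "edim (range D) = enat (card {b\<in>B. \<mu> b \<noteq> 0})"
proof -
  have "range D = cspan {b\<in>B. \<mu> b \<noteq> 0}"
  proof (rule subset_antisym)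
    show "range D \<subseteq> cspan {b\<in>B. \<mu> b \<noteq> 0}"
    proof
      fix y assume "y \<in> range D"
      then obtain x where "y = D x" by blast
      also have "\<dots> = (\<Sum>b\<in>{b\<in>B. \<mu> b \<noteq> 0}. (complex_of_real (\<mu> b) * cinner b x / cinner b b) *\<^sub>C b)"
        unfolding expansion
        by (intro sum.mono_neutral_right finite_B) (auto simp: complex_vector.scale_zero_left)
      also have "\<dots> \<in> cspan {b\<in>B. \<mu> b \<noteq> 0}"
        by (intro complex_vector.span_sum complex_vector.span_scale complex_vector.span_base)
      finally show "y \<in> cspan {b\<in>B. \<mu> b \<noteq> 0}" .
    qed
    have "b \<in> range D" if "b \<in> B" "\<mu> b \<noteq> 0" for b
    proof
      show "b = D ((1 / complex_of_real (\<mu> b)) *\<^sub>C b)"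
        using that clinear_onD(2)[OF linear] complex_vector.subspace_UNIV
        by (simp add: eig scaleC_scaleC scaleC_one)
    qed simp
    then show "cspan {b\<in>B. \<mu> b \<noteq> 0} \<subseteq> range D"
      by (intro complex_vector.span_minimal csubspace_image[OF linear] complex_vector.subspace_UNIV)
         auto
  qed
  then show ?thesis by (simp add: independent)
qed

lemma card_split:
  "card {b\<in>B. \<mu> b < 0} + card {b\<in>B. \<mu> b > 0} = card {b\<in>B. \<mu> b \<noteq> 0}"
  "card {b\<in>B. \<mu> b \<noteq> 0} + card {b\<in>B. \<mu> b = 0} = card B"
proof -
  have "card {b\<in>B. \<mu> b \<noteq> 0} = card ({b\<in>B. \<mu> b < 0} \<union> {b\<in>B. \<mu> b > 0})"
    by (rule arg_cong[of _ _ card]) auto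
  also have "\<dots> = card {b\<in>B. \<mu> b < 0} + card {b\<in>B. \<mu> b > 0}"
    using finite_B by (intro card_Un_disjoint) auto
  finally show "card {b\<in>B. \<mu> b < 0} + card {b\<in>B. \<mu> b > 0} = card {b\<in>B. \<mu> b \<noteq> 0}" ..
  have "card B = card ({b\<in>B. \<mu> b \<noteq> 0} \<union> {b\<in>B. \<mu> b = 0})"
    by (rule arg_cong[of _ _ card]) auto
  also have "\<dots> = card {b\<in>B. \<mu> b \<noteq> 0} + card {b\<in>B. \<mu> b = 0}"
    using finite_B by (intro card_Un_disjoint) auto
  finally show "card {b\<in>B. \<mu> b \<noteq> 0} + card {b\<in>B. \<mu> b = 0} = card B" ..
qed

lemma form_eq: "Re (cinner x (D x)) = (\<Sum>b\<in>B. \<mu> b * (cmod (cinner b x))\<^sup>2 / (norm b)\<^sup>2)"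
proof -
  have "cinner x (D x)
      = (\<Sum>b\<in>B. complex_of_real (\<mu> b) * (cinner b x * cnj (cinner b x)) / cinner b b)"
    unfolding expansion cinner_sum_right cinner_scaleC_right
    by (intro sum.cong refl) (simp add: cinner_commute[of x])
  also have "\<dots> = complex_of_real (\<Sum>b\<in>B. \<mu> b * (cmod (cinner b x))\<^sup>2 / (norm b)\<^sup>2)"
    by (simp add: complex_norm_square[symmetric] cinner_self)
  finally show ?thesis by simp
qed

text \<open>A uniform bound rather than mere negativity is wanted, because it survives a small
  perturbation of the operator.\<close>

lemma form_neg_span:
  fixes a :: "'h \<Rightarrow> complex"
  assumes "C \<subseteq> B" "\<And>b. b \<in> C \<Longrightarrow> \<mu> b \<le> - \<delta>"
  defines "x \<equiv> \<Sum>b\<in>C. a b *\<^sub>C b"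
  shows "Re (cinner x (D x)) \<le> - \<delta> * (norm x)\<^sup>2"
proof -
  have C: "corthogonal C" using corthogonal_subset[OF orth assms(1)] .
  have Dx: "D x = (\<Sum>b\<in>C. (a b * complex_of_real (\<mu> b)) *\<^sub>C b)"
    unfolding x_def D_sum using assms(1) by (intro sum.cong refl) (auto simp: eig scaleC_scaleC)
  have "cinner x (D x) = (\<Sum>b\<in>C. cnj (a b) * cinner b (D x))"
    by (simp add: x_def cinner_sum_left cinner_scaleC_left)
  also have "\<dots> = (\<Sum>b\<in>C. complex_of_real (\<mu> b * ((cmod (a b))\<^sup>2 * (norm b)\<^sup>2)))"
    unfolding Dx
    by (intro sum.cong refl)
       (simp add: corthogonal_coeff[OF C] cinner_self complex_norm_square mult_ac
         del: of_real_power)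
  also have "\<dots> = complex_of_real (\<Sum>b\<in>C. \<mu> b * ((cmod (a b))\<^sup>2 * (norm b)\<^sup>2))" by simp
  finally have "Re (cinner x (D x)) = (\<Sum>b\<in>C. \<mu> b * ((cmod (a b))\<^sup>2 * (norm b)\<^sup>2))" by simp
  also have "\<dots> \<le> (\<Sum>b\<in>C. - \<delta> * ((cmod (a b))\<^sup>2 * (norm b)\<^sup>2))"
    using assms(2) by (intro sum_mono mult_right_mono) auto
  also have "\<dots> = - \<delta> * (norm x)\<^sup>2"
    unfolding x_def corthogonal_norm[OF C] by (simp add: sum_distrib_left)
  finally show ?thesis .
qed

lemma spectral_gap:
  obtains \<delta> where "\<delta> > 0" "\<And>b. b \<in> B \<Longrightarrow> \<mu> b < 0 \<Longrightarrow> \<mu> b \<le> - \<delta>"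
proof -
  \<comment> \<open>The extra element 1 keeps the set nonempty when there is no negative
    eigenvalue.\<close>
  let ?M = "insert 1 ((\<lambda>b. - \<mu> b) ` {b\<in>B. \<mu> b < 0})"
  have fin: "finite ?M" using finite_B by simp
  then have "Min ?M \<in> ?M" by (intro Min_in) auto
  then have "Min ?M > 0" by auto
  moreover have "\<mu> b \<le> - Min ?M" if "b \<in> B" "\<mu> b < 0" for b
  proof -
    have "Min ?M \<le> - \<mu> b" using fin that by (intro Min_le) auto
    then show ?thesis by simp
  qed
  ultimately show thesis using that by blast
qed

lemma neg_sum_nonzero:
  assumes "C \<subseteq> B" "\<exists>b\<in>C. a b \<noteq> 0"
  shows "(\<Sum>b\<in>C. a b *\<^sub>C b) \<noteq> 0"
  using assms corthogonal_independent[OF corthogonal_subset[OF orth assms(1)]]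
    complex_vector.dependent_finite[OF finite_subset[OF assms(1) finite_B]] by blast

text \<open>The nonnegative part is the full orthogonal complement of the negative eigenvectors in
  the Hilbert space; on it only terms with \<open>\<mu> b \<ge> 0\<close> survive in
  \<open>form_eq\<close>.\<close>

lemma neg_index_form: "neg_index UNIV (\<lambda>x. Re (cinner x (D x))) (card {b\<in>B. \<mu> b < 0})"
proof (rule neg_index_finiteI[where c = "\<lambda>b. b" and P = "{x. \<forall>b\<in>{b\<in>B. \<mu> b < 0}. cinner b x = 0}"])
  let ?C = "{b\<in>B. \<mu> b < 0}" and ?P = "{x. \<forall>b\<in>{b\<in>B. \<mu> b < 0}. cinner b x = 0}"
  show "finite ?C" using finite_B by simp
  show "Re (cinner (\<Sum>b\<in>?C. a b *\<^sub>C b) (D (\<Sum>b\<in>?C. a b *\<^sub>C b))) < 0" if "\<exists>b\<in>?C. a b \<noteq> 0" for a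
  proof -
    obtain \<delta> where \<delta>: "\<delta> > 0" "\<And>b. b \<in> B \<Longrightarrow> \<mu> b < 0 \<Longrightarrow> \<mu> b \<le> - \<delta>"
      using spectral_gap by blast
    have "(\<Sum>b\<in>?C. a b *\<^sub>C b) \<noteq> 0" using that by (intro neg_sum_nonzero) auto
    then have "- \<delta> * (norm (\<Sum>b\<in>?C. a b *\<^sub>C b))\<^sup>2 < 0" using \<delta>(1) by simp
    with form_neg_span[of ?C \<delta> a] \<delta>(2) show ?thesis by force
  qed
  show "csubspace ?P" by (rule complex_vector.subspaceI) (auto simp: cinner_algebra)
  show "0 \<le> Re (cinner x (D x))" if "x \<in> ?P" for x
    unfolding form_eq
  proof (rule sum_nonneg)
    fix b assume "b \<in> B"
    then show "0 \<le> \<mu> b * (cmod (cinner b x))\<^sup>2 / (norm b)\<^sup>2"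
      using that by (cases "\<mu> b < 0") auto
  qed
  show "\<exists>a. v - (\<Sum>b\<in>?C. a b *\<^sub>C b) \<in> ?P" for v
  proof
    have "corthogonal ?C" by (rule corthogonal_subset[OF orth]) auto
    then show "v - (\<Sum>b\<in>?C. (cinner b v / cinner b b) *\<^sub>C b) \<in> ?P"
      by (auto simp: cinner_diff_right corthogonal_coeff cinner_nonzero)
  qed
qed auto

text \<open>On the span of the negative eigenvectors the form of \<open>D\<close> is at most
  -\<delta> times the squared norm. A perturbation of size \<delta>/2 leaves it at most -\<delta>/2
  times the squared norm, so the index cannot drop.\<close>

lemma neg_index_lower_semicontinuous:
  obtains \<epsilon> where "\<epsilon> > 0" "\<And>E k. (\<And>x. norm (E x - D x) \<le> \<epsilon> * norm x) \<Longrightarrow>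
    neg_index UNIV (\<lambda>x. Re (cinner x (E x))) k \<Longrightarrow> card {b\<in>B. \<mu> b < 0} \<le> k"
proof -
  obtain \<delta> where \<delta>: "\<delta> > 0" "\<And>b. b \<in> B \<Longrightarrow> \<mu> b < 0 \<Longrightarrow> \<mu> b \<le> - \<delta>" using spectral_gap by blast
  let ?C = "{b\<in>B. \<mu> b < 0}"
  have "card ?C \<le> k" if E: "\<And>x. norm (E x - D x) \<le> (\<delta> / 2) * norm x"
    and k: "neg_index UNIV (\<lambda>x. Re (cinner x (E x))) k" for E k
  proof (rule neg_index_bound[OF k, of ?C "\<lambda>b. b"])
    show "finite ?C" using finite_B by simp
    fix a :: "'h \<Rightarrow> complex" assume a: "\<exists>b\<in>?C. a b \<noteq> 0"
    let ?x = "\<Sum>b\<in>?C. a b *\<^sub>C b"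
    have "Re (cinner ?x (E ?x)) = Re (cinner ?x (D ?x)) + Re (cinner ?x (E ?x - D ?x))"
      by (simp add: cinner_diff_right)
    also have "\<dots> \<le> - \<delta> * (norm ?x)\<^sup>2 + norm ?x * ((\<delta> / 2) * norm ?x)"
    proof (rule add_mono)
      show "Re (cinner ?x (D ?x)) \<le> - \<delta> * (norm ?x)\<^sup>2" using \<delta>(2) by (intro form_neg_span) auto
      show "Re (cinner ?x (E ?x - D ?x)) \<le> norm ?x * ((\<delta> / 2) * norm ?x)"
        by (rule order_trans[OF Re_cinner_le]) (intro mult_left_mono E norm_ge_zero)
    qed
    also have "\<dots> = - (\<delta> / 2) * (norm ?x)\<^sup>2" by (simp add: power2_eq_square field_simps)
    also have "\<dots> < 0" using \<delta>(1) neg_sum_nonzero[OF _ a] by auto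
    finally show "Re (cinner ?x (E ?x)) < 0" .
  qed simp
  then show thesis using \<delta>(1) by (intro that[of "\<delta> / 2"]) (simp, blast)
qed

text \<open>The same eigenbasis serves with opposite eigenvalues, so facts about negative
  eigenvalues also cover the positive ones.\<close>

lemma finite_rank_uminus: "finite_rank_operator (\<lambda>x. - D x) B (\<lambda>b. - \<mu> b)"
  using linear hermitian orth range eig
  by unfold_locales
     (auto simp: clinear_on_def cinner_minus_left cinner_minus_right complex_vector.span_neg
       complex_vector.scale_minus_left complex_vector.scale_minus_right)

end

lemma finite_rank_operatorI:
  assumes lin: "clinear_on UNIV D" and herm: "\<And>x y. cinner x (D y) = cinner (D x) y"
    and N: "csubspace N" "cfinite_dim N" "\<And>x. D x \<in> N"
  obtains B \<mu> where "finite_rank_operator D B \<mu>" "cspan B = N"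
proof -
  obtain B \<mu> where B: "corthogonal B" "cspan B = N" "\<forall>b\<in>B. D b = complex_of_real (\<mu> b) *\<^sub>C b"
    using spectral_theorem[OF N(1,2) clinear_on_subset[OF lin subset_UNIV] N(3) herm] by metis
  then have "finite_rank_operator D B \<mu>"
    using lin herm N(3) by unfold_locales auto
  with B(2) that show thesis by blast
qed

section \<open>Lagrangian planes\<close>

text \<open>With this inner product, \<open>omega w (- snd x, fst x)\<close> equals
  \<open>cinner w x\<close>, so ordinary orthogonality in \<K> \<times> \<K> can be converted into
  \<omega>-orthogonality by a rotation.\<close>

instantiation prod :: (complex_inner, complex_inner) complex_inner
begin

definition cinner_prod :: "'a \<times> 'b \<Rightarrow> 'a \<times> 'b \<Rightarrow> complex"
  where "cinner_prod u v = cinner (fst u) (fst v) + cinner (snd u) (snd v)"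

instance
proof
  fix x y z :: "'a \<times> 'b" and a :: complex
  show "cinner x y = cnj (cinner y x)"
    by (simp add: cinner_prod_def flip: cinner_commute)
  show "cinner x (y + z) = cinner x y + cinner x z"
    by (simp add: cinner_prod_def cinner_add_right)
  show "cinner x (a *\<^sub>C y) = a * cinner x y"
    by (simp add: cinner_prod_def scaleC_prod_def cinner_scaleC_right distrib_left)
  show "cinner x x = complex_of_real ((norm x)\<^sup>2)"
    by (simp add: cinner_prod_def norm_prod_def cinner_self)
qed

end

lemma fst_scaleC [simp]: "fst (a *\<^sub>C u) = a *\<^sub>C fst u"
  and snd_scaleC [simp]: "snd (a *\<^sub>C u) = a *\<^sub>C snd u"
  by (simp_all add: scaleC_prod_def)

lemma scaleC_Pair: "a *\<^sub>C (x, y) = (a *\<^sub>C x, a *\<^sub>C y)"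
  by (simp add: scaleC_prod_def)

lemma omega_algebra:
  "omega (u + v) w = omega u w + omega v w" "omega u (v + w) = omega u v + omega u w"
  "omega (u - v) w = omega u w - omega v w" "omega u (v - w) = omega u v - omega u w"
  "omega (- u) w = - omega u w" "omega u (- w) = - omega u w"
  "omega (a *\<^sub>C u) w = cnj a * omega u w" "omega u (a *\<^sub>C w) = a * omega u w"
  by (simp_all add: omega_def cinner_algebra algebra_simps)

lemma omega_swap: "omega v u = - cnj (omega u v)"
  unfolding omega_def complex_cnj_diff
  by (simp flip: cinner_commute)

lemma lagrangian_subspace: "lagrangian L \<Longrightarrow> csubspace L"
  by (simp add: lagrangian_def)

lemma lagrangian_isotropic: "lagrangian L \<Longrightarrow> u \<in> L \<Longrightarrow> v \<in> L \<Longrightarrow> omega u v = 0"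
  unfolding lagrangian_def by blast

lemma lagrangian_maximal: "lagrangian L \<Longrightarrow> (\<And>v. v \<in> L \<Longrightarrow> omega u v = 0) \<Longrightarrow> u \<in> L"
  unfolding lagrangian_def by blast

lemma cfinite_dim_prod:
  assumes "cfinite_dim (UNIV :: 'a::complex_vector set)" "cfinite_dim (UNIV :: 'b::complex_vector set)"
  shows "cfinite_dim (UNIV :: ('a \<times> 'b) set)"
proof -
  obtain B C where B: "finite B" "cspan B = (UNIV :: 'a set)" and C: "finite C" "cspan C = (UNIV :: 'b set)"
    using assms unfolding cfinite_dim_def by blast
  let ?S = "(\<lambda>b. (b, 0)) ` B \<union> (\<lambda>c. (0, c)) ` C"
  have "(x, y) \<in> cspan ?S" for x y
  proof -
    obtain a where a: "x = (\<Sum>b\<in>B. a b *\<^sub>C b)" using B cspan_finite_sum[OF B(1)] by blast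
    obtain d where d: "y = (\<Sum>c\<in>C. d c *\<^sub>C c)" using C cspan_finite_sum[OF C(1)] by blast
    have "(x, y) = (\<Sum>b\<in>B. a b *\<^sub>C (b, 0)) + (\<Sum>c\<in>C. d c *\<^sub>C (0, c))"
      by (simp add: prod_eq_iff fst_sum snd_sum a d complex_vector.scale_zero_right)
    also have "\<dots> \<in> cspan ?S"
      by (intro complex_vector.span_add complex_vector.span_sum complex_vector.span_scale
          complex_vector.span_base) auto
    finally show ?thesis .
  qed
  then show ?thesis unfolding cfinite_dim_def using B(1) C(1) by (intro exI[of _ ?S]) auto
qed

text \<open>A vector orthogonal to the sum of the planes becomes, after rotation,
  \<omega>-orthogonal to both. By maximality it lies in their intersection and vanishes, so the sum
  is the whole space.\<close>

lemma lagrangian_sum: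
  fixes \<alpha> \<beta> :: "('k::complex_inner \<times> 'k) set"
  assumes K: "cfinite_dim (UNIV :: 'k set)" and L: "lagrangian \<alpha>" "lagrangian \<beta>"
    and trans: "\<alpha> \<inter> \<beta> = {0}"
  shows "\<exists>a\<in>\<alpha>. \<exists>b\<in>\<beta>. u = a + b"
proof -
  let ?W = "{a + b |a b. a \<in> \<alpha> \<and> b \<in> \<beta>}"
  have W: "csubspace ?W"
    using complex_vector.subspace_sums[OF L[THEN lagrangian_subspace]] .
  from orthogonal_projection[OF W cfinite_dim_subset[OF cfinite_dim_prod[OF K K] subset_UNIV]]
  obtain y where y: "y \<in> ?W" "\<forall>w\<in>?W. cinner w (u - y) = 0" ..
  define v where "v = (- snd (u - y), fst (u - y))"
  have v: "omega v w = 0" if "w \<in> ?W" for w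
  proof -
    have "omega w v = cinner w (u - y)" by (simp add: omega_def cinner_prod_def v_def cinner_minus_right cinner_diff_right)
    then show ?thesis using bspec[OF y(2) that] omega_swap[of v w] by simp
  qed
  have "a \<in> ?W" if "a \<in> \<alpha>" for a
    unfolding mem_Collect_eq
    using that complex_vector.subspace_0[OF lagrangian_subspace[OF L(2)]]
    by (intro exI[of _ a] exI[of _ 0]) simp
  moreover have "b \<in> ?W" if "b \<in> \<beta>" for b
    unfolding mem_Collect_eq
    using that complex_vector.subspace_0[OF lagrangian_subspace[OF L(1)]]
    by (intro exI[of _ 0] exI[of _ b]) simp
  ultimately have "v \<in> \<alpha>" "v \<in> \<beta>"
    using lagrangian_maximal[OF L(1), of v] lagrangian_maximal[OF L(2), of v] v by blast+
  then have "v = 0" using trans by blast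
  then have "u = y" by (simp add: v_def prod_eq_iff zero_prod_def)
  with y(1) show ?thesis by blast
qed

text \<open>The Cayley transform: \<open>(x, y) \<mapsto> x + \<i> y\<close> maps a Lagrangian plane bijectively onto \<open>\<K>\<close>.\<close>

lemma edim_lagrangian:
  fixes L :: "('k::complex_inner \<times> 'k) set"
  assumes K: "cfinite_dim (UNIV :: 'k set)" and L: "lagrangian L"
  shows "edim L = edim (UNIV :: 'k set)"
proof -
  let ?f = "\<lambda>u :: 'k \<times> 'k. fst u + \<i> *\<^sub>C snd u"
  have f: "clinear_on L ?f"
    by (simp add: clinear_on_def scaleC_add_right scaleC_scaleC mult.commute)
  have sub: "csubspace L" using lagrangian_subspace[OF L] .
  have inj: "u = 0" if "u \<in> L" "?f u = 0" for u
  proof -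
    have fst: "fst u = - (\<i> *\<^sub>C snd u)" using that(2) by (simp add: eq_neg_iff_add_eq_0)
    have "omega u u = 2 * \<i> * cinner (snd u) (snd u)"
      by (simp add: omega_def fst cinner_algebra)
    then have "snd u = 0" using lagrangian_isotropic[OF L that(1,1)] by simp
    with fst show ?thesis by (simp add: prod_eq_iff complex_vector.scale_zero_right)
  qed
  have fd: "cfinite_dim L" using cfinite_dim_subset[OF cfinite_dim_prod[OF K K] subset_UNIV] .
  have "z \<in> ?f ` L" for z
  proof -
    from orthogonal_projection[OF csubspace_image[OF f sub] cfinite_dim_subset[OF K subset_UNIV]]
    obtain y where y: "y \<in> ?f ` L" "\<forall>w\<in>?f ` L. cinner w (z - y) = 0" ..
    define k where "k = z - y"
    have orth: "cinner (?f u) k = 0" if "u \<in> L" for u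
      using bspec[OF y(2) imageI[OF that]] by (simp add: k_def)
    \<comment> \<open>Chosen so that \<open>omega v u\<close> is the conjugate of
      \<open>cinner (?f u) k\<close>; then \<open>v\<close> lies in \<open>L\<close>, while
      \<open>?f v\<close> is -2\<i> times \<open>k\<close>, which is orthogonal to \<open>k\<close>
      only for \<open>k = 0\<close>.\<close>
    define v where "v = (- (\<i> *\<^sub>C k), - k)"
    have "omega v u = 0" if "u \<in> L" for u
    proof -
      have "omega v u = cnj (cinner (?f u) k)"
        by (simp add: omega_def v_def cinner_algebra flip: cinner_commute)
      then show ?thesis using orth[OF that] by simp
    qed
    then have "v \<in> L" by (rule lagrangian_maximal[OF L])
    then have "cinner (?f v) k = 0" by (rule orth)
    then have "k = 0" by (simp add: v_def cinner_algebra complex_vector.scale_minus_right)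
    then show ?thesis using y(1) by (simp add: k_def)
  qed
  then have "?f ` L = UNIV" by blast
  then show ?thesis using edim_linear_image(1)[OF f sub inj fd] by simp
qed

section \<open>Existence of a Lagrangian plane transversal to three given ones\<close>

definition graph_plane :: "real \<Rightarrow> ('k::complex_inner \<times> 'k) set"
  where "graph_plane s = {(k, complex_of_real s *\<^sub>C k) |k. True}"

lemma lagrangian_graph_plane: "lagrangian (graph_plane s)"
  unfolding lagrangian_def
proof (intro conjI set_eqI)
  show "csubspace (graph_plane s)"
    by (rule complex_vector.subspaceI)
       (auto simp: graph_plane_def zero_prod_def complex_vector.scale_zero_right scaleC_add_right
         scaleC_Pair complex_vector.scale_left_commute)
  fix u :: "'a \<times> 'a"
  have "omega u (k, complex_of_real s *\<^sub>C k) = cinner (complex_of_real s *\<^sub>C fst u - snd u) k" for k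
    by (simp add: omega_def cinner_algebra)
  then have "u \<in> {u. \<forall>v\<in>graph_plane s. omega u v = 0}
      \<longleftrightarrow> (\<forall>k. cinner (complex_of_real s *\<^sub>C fst u - snd u) k = 0)"
    by (auto simp: graph_plane_def)
  also have "\<dots> \<longleftrightarrow> complex_of_real s *\<^sub>C fst u - snd u = 0"
    using cinner_eq_0_all by fastforce
  also have "\<dots> \<longleftrightarrow> u \<in> graph_plane s" by (cases u) (auto simp: graph_plane_def)
  finally show "u \<in> graph_plane s \<longleftrightarrow> u \<in> {u. \<forall>v\<in>graph_plane s. omega u v = 0}" ..
qed

text \<open>The exceptional numbers behave like eigenvalues of a self-adjoint relation: for
  \<open>(k, s k)\<close> and \<open>(k', t k')\<close> in \<open>L\<close>, vanishing of \<omega>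
  gives (t - s) \<open>cinner k k'\<close> = 0. Different numbers thus have orthogonal vectors, and
  \<K> has room for finitely many.\<close>

lemma finite_nontransversal:
  fixes L :: "('k::complex_inner \<times> 'k) set"
  assumes K: "cfinite_dim (UNIV :: 'k set)" and L: "lagrangian L"
  shows "finite {s. \<not> transversal (graph_plane s) L}"
proof (rule ccontr)
  let ?S = "{s. \<not> transversal (graph_plane s) L}"
  assume inf: "infinite ?S"
  have "\<exists>k. k \<noteq> 0 \<and> (k, complex_of_real s *\<^sub>C k) \<in> L" if "s \<in> ?S" for s
  proof -
    have "0 \<in> graph_plane s \<inter> L"
      using complex_vector.subspace_0 lagrangian_subspace lagrangian_graph_plane L by blast
    then obtain u where "u \<in> graph_plane s" "u \<in> L" "u \<noteq> 0"
      using \<open>s \<in> ?S\<close> by (auto simp: transversal_def)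
    then show ?thesis by (auto simp: graph_plane_def zero_prod_def complex_vector.scale_zero_right)
  qed
  then obtain f where f: "\<And>s. s \<in> ?S \<Longrightarrow> f s \<noteq> 0 \<and> (f s, complex_of_real s *\<^sub>C f s) \<in> L" by metis
  have orth: "cinner (f s) (f t) = 0" if "s \<in> ?S" "t \<in> ?S" "s \<noteq> t" for s t
  proof -
    have "omega (f s, complex_of_real s *\<^sub>C f s) (f t, complex_of_real t *\<^sub>C f t) = 0"
      using f that lagrangian_isotropic[OF L] by blast
    then have "complex_of_real (t - s) * cinner (f s) (f t) = 0"
      by (simp add: omega_def cinner_algebra algebra_simps)
    then show ?thesis using that(3) by simp
  qed
  have inj: "inj_on f ?S"
  proof (rule inj_onI, rule ccontr)
    fix s t assume st: "s \<in> ?S" "t \<in> ?S" "f s = f t" "s \<noteq> t"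
    then have "cinner (f s) (f s) = 0" using orth[of s t] by simp
    with f[OF st(1)] show False by simp
  qed
  obtain C where C: "finite C" "(UNIV :: 'k set) \<subseteq> cspan C" using K by (auto simp: cfinite_dim_def)
  obtain T where T: "finite T" "card T = Suc (card C)" "T \<subseteq> ?S"
    using infinite_arbitrarily_large[OF inf] by blast
  have "corthogonal (f ` T)"
    unfolding corthogonal_def
  proof (intro conjI ballI impI)
    show "0 \<notin> f ` T" using T(3) f by fastforce
    fix b c assume "b \<in> f ` T" "c \<in> f ` T" "b \<noteq> c"
    then obtain s t where "s \<in> T" "t \<in> T" "b = f s" "c = f t" "s \<noteq> t" by blast
    then show "cinner b c = 0" using orth T(3) by blast
  qed (use T in simp)
  then have "card (f ` T) \<le> card C"
    using complex_vector.independent_span_bound[OF C(1) corthogonal_independent] C(2) by blast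
  then show False using card_image[OF inj_on_subset[OF inj T(3)]] T(2) by simp
qed

text \<open>A real number outside three finite sets yields the plane. This guarantees that the plane
  chosen by \<open>SOME\<close> in \<open>duistermaat_index\<close> has the required
  properties.\<close>

lemma transversal_exists:
  fixes L1 L2 L3 :: "('k::complex_inner \<times> 'k) set"
  assumes "cfinite_dim (UNIV :: 'k set)" "lagrangian L1" "lagrangian L2" "lagrangian L3"
  shows "\<exists>L. lagrangian L \<and> transversal L L1 \<and> transversal L L2 \<and> transversal L L3"
proof -
  let ?S = "\<lambda>L :: ('k \<times> 'k) set. {s. \<not> transversal (graph_plane s) L}"
  have "finite (?S L1 \<union> ?S L2 \<union> ?S L3)" using finite_nontransversal[OF assms(1)] assms by blast
  then obtain s where "s \<notin> ?S L1 \<union> ?S L2 \<union> ?S L3"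
    using ex_new_if_finite[OF infinite_UNIV_char_0] by metis
  then show ?thesis using lagrangian_graph_plane by (intro exI[of _ "graph_plane s"]) simp
qed

section \<open>The Duistermaat index\<close>

lemma graph_map_unique:
  assumes "csubspace \<beta>" "csubspace \<gamma>" "\<beta> \<inter> \<gamma> = {0}" "w \<in> \<beta>" "u + w \<in> \<gamma>"
  shows "graph_map \<beta> \<gamma> u = w"
  unfolding graph_map_def
proof (rule the_equality)
  fix w' assume w': "w' \<in> \<beta> \<and> u + w' \<in> \<gamma>"
  have "w' - w \<in> \<beta>" using w' assms complex_vector.subspace_diff by blast
  moreover have "(u + w') - (u + w) \<in> \<gamma>" using w' assms complex_vector.subspace_diff by blast
  ultimately have "w' - w \<in> \<beta> \<inter> \<gamma>" by simp
  then show "w' = w" using assms(3) by simp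
qed (use assms in auto)

text \<open>\<open>T u\<close> is minus the \<beta>-component of \<open>u\<close> along \<gamma>. It
  is therefore linear on all of \<K> \<times> \<K>, and one map serves the forms on
  \<open>L1\<close> and on \<open>L2\<close>.\<close>

locale transversal_pair =
  fixes \<beta> \<gamma> :: "('k::complex_inner \<times> 'k) set"
  assumes finite_dim: "cfinite_dim (UNIV :: 'k set)"
    and lagr: "lagrangian \<beta>" "lagrangian \<gamma>" and trans: "\<beta> \<inter> \<gamma> = {0}"
begin

abbreviation "T \<equiv> graph_map \<beta> \<gamma>"

lemmas subspaces = lagr[THEN lagrangian_subspace]

lemmas T_unique = graph_map_unique[OF subspaces trans]

lemma T_mem: "T u \<in> \<beta>" "u + T u \<in> \<gamma>"
proof -
  obtain b c where "b \<in> \<beta>" "c \<in> \<gamma>" "u = b + c"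
    using lagrangian_sum[OF finite_dim lagr trans] by blast
  then have "- b \<in> \<beta>" "u + (- b) \<in> \<gamma>" using subspaces complex_vector.subspace_neg by auto
  moreover from this have "T u = - b" by (rule T_unique)
  ultimately show "T u \<in> \<beta>" "u + T u \<in> \<gamma>" by simp_all
qed

lemma T_linear: "T (u + v) = T u + T v" "T (a *\<^sub>C u) = a *\<^sub>C T u"
proof -
  have "(u + T u) + (v + T v) \<in> \<gamma>"
    using complex_vector.subspace_add[OF subspaces(2) T_mem(2)[of u] T_mem(2)[of v]] .
  then have "(u + v) + (T u + T v) \<in> \<gamma>" by (simp only: ac_simps)
  then show "T (u + v) = T u + T v"
    by (rule T_unique[OF complex_vector.subspace_add[OF subspaces(1) T_mem(1) T_mem(1)]])
  have "a *\<^sub>C (u + T u) \<in> \<gamma>"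
    using complex_vector.subspace_scale[OF subspaces(2) T_mem(2)] .
  then have "a *\<^sub>C u + a *\<^sub>C T u \<in> \<gamma>" by (simp add: scaleC_add_right)
  then show "T (a *\<^sub>C u) = a *\<^sub>C T u"
    by (rule T_unique[OF complex_vector.subspace_scale[OF subspaces(1) T_mem(1)]])
qed

lemma T_diff: "T (u - v) = T u - T v"
  using T_linear(1)[of "u - v" v] by simp

text \<open>In \<open>omega (u + T u) (v + T v) = 0\<close> the terms inside \<alpha> and inside
  \<beta> vanish; the two mixed terms that remain express the symmetry.\<close>

lemma hermitian_Q_form:
  assumes "lagrangian \<alpha>"
  shows "hermitian_on \<alpha> (Q_form \<beta> \<gamma>)"
  unfolding hermitian_on_def
proof (intro conjI ballI allI)
  fix u v assume uv: "u \<in> \<alpha>" "v \<in> \<alpha>"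
  have "omega (u + T u) (v + T v) = 0" using lagrangian_isotropic[OF lagr(2)] T_mem by blast
  then have "omega (T u) v + omega u (T v) = 0"
    using lagrangian_isotropic[OF assms uv] lagrangian_isotropic[OF lagr(1) T_mem(1) T_mem(1)]
    by (simp add: omega_algebra)
  then have "omega u (T v) = - omega (T u) v" by (simp add: add_eq_0_iff)
  then show "Q_form \<beta> \<gamma> v u = cnj (Q_form \<beta> \<gamma> u v)"
    using omega_swap[of v "T u"] by (simp add: Q_form_def)
qed (simp_all add: Q_form_def T_linear omega_algebra)

end

text \<open>On \<open>V \<times> V\<close> consider \<open>A(u,u) - B(v,v)\<close>. The complement of the diagonal, orthogonal with respect
  to this form, is \<open>{(u, v). A(\<cdot>, u) = B(\<cdot>, v)}\<close>; comparing the two decompositions of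
  \<open>V \<times> V\<close> takes the place of a Schur complement.\<close>

lemma neg_index_diagonal_complement:
  fixes V :: "'v::complex_vector set"
  assumes V: "csubspace V" and A: "hermitian_on V A" and B: "hermitian_on V B"
  defines "Y \<equiv> {(u, v). u \<in> V \<and> v \<in> V \<and> (\<forall>s\<in>V. A s u = B s v)}"
  assumes surj: "\<And>p q. p \<in> V \<Longrightarrow> q \<in> V \<Longrightarrow> \<exists>s\<in>V. (p - s, q - s) \<in> Y"
    and a: "neg_index V (\<lambda>u. Re (A u u)) a" and b: "neg_index V (\<lambda>u. - Re (B u u)) b"
    and c: "neg_index V (\<lambda>u. Re (A u u - B u u)) c"
    and d: "neg_index Y (\<lambda>(u, v). Re (A u u - B v v)) d"
  shows "a + b = c + d"
proof -
  let ?F = "\<lambda>(u, v). Re (A u u - B v v)"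
  note HA = hermitian_onD[OF A V] and HB = hermitian_onD[OF B V]
  have 0: "0 \<in> V" using complex_vector.subspace_0[OF V] .
  have A0: "A 0 0 = 0" using HA(3)[OF 0 0, of 0] by (simp add: complex_vector.scale_zero_left)
  have B0: "B 0 0 = 0" using HB(3)[OF 0 0, of 0] by (simp add: complex_vector.scale_zero_left)
  let ?i1 = "\<lambda>u::'v. (u, 0::'v)" and ?i2 = "\<lambda>v::'v. (0::'v, v)" and ?di = "\<lambda>u::'v. (u, u)"
  have lin: "clinear_on V ?i1" "clinear_on V ?i2" "clinear_on V ?di"
    by (simp_all add: clinear_on_def scaleC_Pair complex_vector.scale_zero_right)
  have i1: "neg_index (?i1 ` V) ?F a"
    by (rule neg_index_push[OF lin(1) V _ a]) (simp add: B0)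
  have i2: "neg_index (?i2 ` V) ?F b"
    by (rule neg_index_push[OF lin(2) V _ b]) (simp add: A0)
  have i3: "neg_index (?di ` V) ?F c"
    by (rule neg_index_push[OF lin(3) V _ c]) simp
  \<comment> \<open>First decomposition: the two coordinate axes, with indices \<open>a\<close> and
    \<open>b\<close>.\<close>
  have "neg_index {x + y |x y. x \<in> ?i1 ` V \<and> y \<in> ?i2 ` V} ?F (a + b)"
    by (rule neg_index_add[OF csubspace_image[OF lin(1) V] csubspace_image[OF lin(2) V] _ _ i1 i2])
       (auto simp: A0 B0 zero_prod_def)
  moreover have "{x + y |x y. x \<in> ?i1 ` V \<and> y \<in> ?i2 ` V} = V \<times> V"
  proof (intro subset_antisym subsetI)
    fix z assume "z \<in> V \<times> V"
    then have "z = ?i1 (fst z) + ?i2 (snd z)" "fst z \<in> V" "snd z \<in> V" by auto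
    then show "z \<in> {x + y |x y. x \<in> ?i1 ` V \<and> y \<in> ?i2 ` V}" by blast
  qed auto
  ultimately have 1: "neg_index (V \<times> V) ?F (a + b)" by simp
  have Y: "csubspace Y"
  proof (rule complex_vector.subspaceI)
    show "0 \<in> Y"
      using HA(3)[OF _ 0, of _ 0] HB(3)[OF _ 0, of _ 0] 0
      by (simp add: Y_def zero_prod_def complex_vector.scale_zero_left)
    show "x + y \<in> Y" if "x \<in> Y" "y \<in> Y" for x y
      using that HA(1) HB(1) complex_vector.subspace_add[OF V] by (auto simp: Y_def)
    show "k *\<^sub>C x \<in> Y" if "x \<in> Y" for k x
      using that HA(3) HB(3) complex_vector.subspace_scale[OF V] by (auto simp: Y_def scaleC_Pair)
  qed
  \<comment> \<open>Second decomposition: the diagonal carries the form A - B and so has index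
    \<open>c\<close>; its complement \<open>Y\<close> has index \<open>d\<close>.\<close>
  have "neg_index {x + y |x y. x \<in> ?di ` V \<and> y \<in> Y} ?F (c + d)"
  proof (rule neg_index_add[OF csubspace_image[OF lin(3) V] Y _ _ i3 d])
    fix x y assume "x \<in> ?di ` V" "y \<in> Y"
    then obtain s u v where s: "s \<in> V" "x = (s, s)" and uv: "y = (u, v)" "u \<in> V" "v \<in> V" "A s u = B s v"
      by (auto simp: Y_def)
    \<comment> \<open>Together with \<open>A s u = B s v\<close> this cancels all mixed terms of the
      form at (s, s) + (u, v).\<close>
    have "A u s = B v s"
      using hermitian_on_swap[OF A s(1) uv(2)] hermitian_on_swap[OF B s(1) uv(3)] uv(4) by simp
    moreover have "A (s + u) (s + u) = A s s + A s u + A u s + A u u"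
      using HA(1)[OF complex_vector.subspace_add[OF V s(1) uv(2)] s(1) uv(2)]
        HA(2)[OF s(1) s(1) uv(2)] HA(2)[OF uv(2) s(1) uv(2)] by simp
    moreover have "B (s + v) (s + v) = B s s + B s v + B v s + B v v"
      using HB(1)[OF complex_vector.subspace_add[OF V s(1) uv(3)] s(1) uv(3)]
        HB(2)[OF s(1) s(1) uv(3)] HB(2)[OF uv(3) s(1) uv(3)] by simp
    ultimately show "?F (x + y) = ?F x + ?F y" using uv(4) by (simp add: s(2) uv(1))
  qed (simp add: A0 B0 zero_prod_def)
  moreover have "{x + y |x y. x \<in> ?di ` V \<and> y \<in> Y} = V \<times> V"
  proof (intro subset_antisym subsetI)
    fix z assume "z \<in> {x + y |x y. x \<in> ?di ` V \<and> y \<in> Y}"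
    then show "z \<in> V \<times> V" using complex_vector.subspace_add[OF V] by (auto simp: Y_def)
  next
    fix z assume "z \<in> V \<times> V"
    then obtain p q where z: "z = (p, q)" "p \<in> V" "q \<in> V" by blast
    then obtain s where s: "s \<in> V" "(p - s, q - s) \<in> Y" using surj by blast
    have "z = ?di s + (p - s, q - s)" using z by simp
    then show "z \<in> {x + y |x y. x \<in> ?di ` V \<and> y \<in> Y}" using s by blast
  qed
  ultimately have "neg_index (V \<times> V) ?F (c + d)" by simp
  then show ?thesis using neg_index_unique 1 by blast
qed

text \<open>Transported to \<open>L1\<close>, the Duistermaat index is n_-(B - A) - n_-(B) + n_-(A).
  As B and A - B are nondegenerate, it equals n_-(A) + n_-(-B) - n_-(A - B), and
  \<open>neg_index_diagonal_complement\<close> identifies this with the index on pairs.\<close>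

lemma duistermaat_index_eq:
  fixes L1 L2 M :: "('k::complex_inner \<times> 'k) set"
  assumes K: "cfinite_dim (UNIV :: 'k set)"
    and lagr: "lagrangian L1" "lagrangian L2" "lagrangian M"
    and M: "M \<inter> L1 = {0}" "M \<inter> L2 = {0}"
    and k: "neg_index {(b, m). b \<in> L2 \<and> m \<in> M \<and> b - m \<in> L1} (\<lambda>(b, m). Re (omega (b - m) b)) k"
  shows "duistermaat_index L1 L2 M = int k"
proof -
  define L where
    "L = (SOME L. lagrangian L \<and> transversal L L1 \<and> transversal L L2 \<and> transversal L M)"
  have "lagrangian L \<and> transversal L L1 \<and> transversal L L2 \<and> transversal L M"
    unfolding L_def by (rule someI_ex[OF transversal_exists[OF K lagr]])
  then have L: "lagrangian L" "L \<inter> L1 = {0}" "L \<inter> L2 = {0}" "L \<inter> M = {0}"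
    by (auto simp: transversal_def)
  interpret A: transversal_pair L L2 using K L lagr by unfold_locales
  interpret B: transversal_pair L M using K L lagr by unfold_locales
  let ?A = "Q_form L L2" and ?B = "Q_form L M"
  let ?Q = "\<lambda>u v. ?A u v - ?B u v"
  note sub = lagr[THEN lagrangian_subspace] lagrangian_subspace[OF L(1)]
  have fd: "cfinite_dim V" for V :: "('k \<times> 'k) set"
    using cfinite_dim_subset[OF cfinite_dim_prod[OF K K] subset_UNIV] .
  have hA: "hermitian_on L1 ?A" by (rule A.hermitian_Q_form[OF lagr(1)])
  have hB: "hermitian_on L1 ?B" by (rule B.hermitian_Q_form[OF lagr(1)])
  have hQ: "hermitian_on L1 ?Q"
    unfolding hermitian_on_def
  proof (intro conjI ballI allI)
    fix u v assume "u \<in> L1" "v \<in> L1"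
    then show "?Q v u = cnj (?Q u v)"
      using hermitian_on_swap[OF hA, of u v] hermitian_on_swap[OF hB, of u v] by simp
  qed (simp_all add: Q_form_def A.T_linear B.T_linear omega_algebra algebra_simps)
  \<comment> \<open>\<omega> pairs the transversal planes \<open>L1\<close> and \<open>L\<close>
    without degeneracy, so equations between forms on \<open>L1\<close> become equations between
    graph maps into \<open>L\<close>.\<close>
  have L1L: "w = 0" if "w \<in> L" "\<And>s. s \<in> L1 \<Longrightarrow> omega s w = 0" for w
  proof -
    have "w \<in> L1"
    proof (rule lagrangian_maximal[OF lagr(1)])
      fix v assume "v \<in> L1"
      then show "omega w v = 0" using that(2) omega_swap[of w v] by simp
    qed
    then show ?thesis using that(1) L(2) by blast
  qed
  have TL: "A.T u - B.T v \<in> L" for u v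
    by (rule complex_vector.subspace_diff[OF sub(4) A.T_mem(1) B.T_mem(1)])
  have ortho_iff: "(\<forall>s\<in>L1. ?A s u = ?B s v) \<longleftrightarrow> A.T u = B.T v" for u v
  proof
    assume *: "\<forall>s\<in>L1. ?A s u = ?B s v"
    have "A.T u - B.T v = 0"
      by (rule L1L[OF TL]) (use * in \<open>simp add: Q_form_def omega_algebra\<close>)
    then show "A.T u = B.T v" by simp
  qed (simp add: Q_form_def)
  obtain kA where kA: "neg_index L1 (\<lambda>u. Re (?A u u)) kA"
    using sylvester_inertia[OF sub(1) fd hA] by blast
  have ndB: "\<forall>u\<in>L1. (\<forall>v\<in>L1. ?B v u = 0) \<longrightarrow> u = 0"
  proof (intro ballI impI)
    fix u assume u: "u \<in> L1" "\<forall>v\<in>L1. ?B v u = 0"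
    then have "B.T u = 0" using L1L[OF B.T_mem(1)] by (simp add: Q_form_def)
    then have "u \<in> M" using B.T_mem(2)[of u] by simp
    then show "u = 0" using u(1) M(1) by blast
  qed
  obtain kB lB where kB: "neg_index L1 (\<lambda>u. Re (?B u u)) kB" "neg_index L1 (\<lambda>u. - Re (?B u u)) lB"
    "kB + lB = cdim L1"
    using sylvester_inertia[OF sub(1) fd hB] ndB by blast
  \<comment> \<open>For \<open>u\<close> in the radical the graph points over \<open>u\<close> in
    \<open>L2\<close> and in \<open>M\<close> coincide, and these planes meet only in 0.\<close>
  have ndQ: "\<forall>u\<in>L1. (\<forall>v\<in>L1. ?Q v u = 0) \<longrightarrow> u = 0"
  proof (intro ballI impI)
    fix u assume u: "u \<in> L1" "\<forall>v\<in>L1. ?Q v u = 0"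
    then have "A.T u = B.T u" using ortho_iff[of u u] by simp
    then have "u + A.T u \<in> M \<inter> L2" using A.T_mem(2)[of u] B.T_mem(2)[of u] by simp
    then have "u + A.T u = 0" using M(2) by simp
    then have "u = - A.T u" by (simp add: eq_neg_iff_add_eq_0)
    then have "u \<in> L" using complex_vector.subspace_neg[OF sub(4) A.T_mem(1)] by metis
    then show "u = 0" using u(1) L(2) by blast
  qed
  obtain kQ lQ where kQ: "neg_index L1 (\<lambda>u. Re (?Q u u)) kQ" "neg_index L1 (\<lambda>u. - Re (?Q u u)) lQ"
    "kQ + lQ = cdim L1"
    using sylvester_inertia[OF sub(1) fd hQ] ndQ by blast
  let ?Y = "{(u, v). u \<in> L1 \<and> v \<in> L1 \<and> (\<forall>s\<in>L1. ?A s u = ?B s v)}"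
  let ?X = "{(b, m). b \<in> L2 \<and> m \<in> M \<and> b - m \<in> L1}"
  have YE: "?Y = {(u, v). u \<in> L1 \<and> v \<in> L1 \<and> A.T u = B.T v}" unfolding ortho_iff ..
  \<comment> \<open>For pairs in \<open>?Y\<close> the two graph points have the same component in
    \<open>L\<close>, which is exactly why their difference lies in \<open>L1\<close>.\<close>
  let ?f = "\<lambda>(u, v). (u + A.T u, v + B.T v)"
  have f: "clinear_on ?Y ?f"
    by (auto simp: clinear_on_def A.T_linear B.T_linear scaleC_Pair scaleC_add_right)
  have Y: "csubspace {z. fst z \<in> L1 \<and> snd z \<in> L1 \<and> A.T (fst z) = B.T (snd z)}"
    by (rule complex_vector.subspaceI)
       (use A.T_linear(2)[of 0 0] B.T_linear(2)[of 0 0] in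
         \<open>simp_all add: A.T_linear B.T_linear complex_vector.scale_zero_left
           complex_vector.subspace_0[OF sub(1)] complex_vector.subspace_add[OF sub(1)]
           complex_vector.subspace_scale[OF sub(1)]\<close>)
  have "?Y = {z. fst z \<in> L1 \<and> snd z \<in> L1 \<and> A.T (fst z) = B.T (snd z)}"
    unfolding YE by (simp add: case_prod_unfold)
  with Y have Y: "csubspace ?Y" by simp
  have img: "?f ` ?Y = ?X"
  proof (intro subset_antisym subsetI)
    fix z assume "z \<in> ?f ` ?Y"
    then obtain u v where uv: "u \<in> L1" "v \<in> L1" "A.T u = B.T v" "z = (u + A.T u, v + B.T v)"
      unfolding YE by auto
    have "(u + A.T u) - (v + B.T v) \<in> L1"
      using uv(3) complex_vector.subspace_diff[OF sub(1) uv(1,2)] by simp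
    then show "z \<in> ?X" using uv(4) A.T_mem(2) B.T_mem(2) by simp
  next
    fix z assume "z \<in> ?X"
    then obtain b m where bm: "b \<in> L2" "m \<in> M" "b - m \<in> L1" "z = (b, m)" by blast
    obtain l u where u: "l \<in> L" "u \<in> L1" "b = l + u"
      using lagrangian_sum[OF K L(1) lagr(1) L(2)] by blast
    obtain l' v where v: "l' \<in> L" "v \<in> L1" "m = l' + v"
      using lagrangian_sum[OF K L(1) lagr(1) L(2)] by blast
    have l: "A.T u = l" using u bm(1) by (intro A.T_unique) (auto simp: add.commute)
    have l': "B.T v = l'" using v bm(2) by (intro B.T_unique) (auto simp: add.commute)
    have "(b - m) - (u - v) \<in> L1"
      using complex_vector.subspace_diff[OF sub(1) bm(3) complex_vector.subspace_diff[OF sub(1) u(2) v(2)]] .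
    then have "l - l' \<in> L1" using u(3) v(3) by (simp add: algebra_simps)
    moreover have "l - l' \<in> L" using complex_vector.subspace_diff[OF sub(4) u(1) v(1)] .
    ultimately have "l = l'" using L(2) by (metis IntI eq_iff_diff_eq_0 singletonD)
    then have "(u, v) \<in> ?Y" unfolding YE using u v l l' by simp
    moreover have "z = ?f (u, v)" using u v l l' bm(4) by (simp add: add.commute)
    ultimately show "z \<in> ?f ` ?Y" by blast
  qed
  have kY: "neg_index ?Y (\<lambda>(u, v). Re (?A u u - ?B v v)) k"
  proof (rule neg_index_pull[OF f Y])
    show "neg_index (?f ` ?Y) (\<lambda>(b, m). Re (omega (b - m) b)) k" unfolding img by (rule k)
    fix y assume "y \<in> ?Y"
    then obtain u v where uv: "u \<in> L1" "v \<in> L1" "A.T u = B.T v" "y = (u, v)"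
      unfolding YE by auto
    \<comment> \<open>The part inside \<open>L1\<close> vanishes by isotropy, and against
      \<open>v\<close> the vector \<open>A.T u\<close> is read as \<open>B.T v\<close>.\<close>
    then have "omega (u - v) (u + A.T u) = ?A u u - ?B v v"
      using lagrangian_isotropic[OF lagr(1), of _ u] by (simp add: Q_form_def omega_algebra)
    then show "(case y of (u, v) \<Rightarrow> Re (?A u u - ?B v v)) = (case ?f y of (b, m) \<Rightarrow> Re (omega (b - m) b))"
      using uv(3,4) by simp
  qed
  have "kA + lB = kQ + k"
  proof (rule neg_index_diagonal_complement[OF sub(1) hA hB _ kA kB(2) kQ(1) kY])
    fix p q assume pq: "p \<in> L1" "q \<in> L1"
    \<comment> \<open>The vector sought must satisfy \<open>A.T s - B.T s = A.T p - B.T q\<close>.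
      After splitting the right side along \<open>M\<close> and \<open>L2\<close>, the
      \<open>L1\<close>-component of the \<open>L2\<close>-part solves this.\<close>
    obtain m b where m: "m \<in> M" "b \<in> L2" "A.T p - B.T q = m + b"
      using lagrangian_sum[OF K lagr(3,2) M(2)] by blast
    obtain l u where u: "l \<in> L" "u \<in> L1" "b = l + u"
      using lagrangian_sum[OF K L(1) lagr(1) L(2)] by blast
    have l: "A.T u = l" using u m(2) by (intro A.T_unique) (auto simp: add.commute)
    have "B.T u = l - (A.T p - B.T q)"
    proof (rule B.T_unique)
      show "l - (A.T p - B.T q) \<in> L" using complex_vector.subspace_diff[OF sub(4) u(1) TL] .
      have "u + (l - (A.T p - B.T q)) = - m" using m(3) u(3) by (simp add: algebra_simps)
      then show "u + (l - (A.T p - B.T q)) \<in> M" using complex_vector.subspace_neg[OF sub(3) m(1)] by simp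
    qed
    then have "A.T (p - u) = B.T (q - u)" using l by (simp add: A.T_diff B.T_diff algebra_simps)
    then show "\<exists>s\<in>L1. (p - s, q - s) \<in> ?Y"
      unfolding YE using u(2) pq complex_vector.subspace_diff[OF sub(1)] by (intro bexI[of _ u]) auto
  qed
  moreover have "n_neg_Q L1 L L2 = kA" unfolding n_neg_Q_def
    by (rule form_neg_index_eq[where Q = ?A, OF sub(1) kA]) (use A.T_linear(2)[of 0 0] in \<open>simp add: Q_form_def omega_def\<close>)
  moreover have "n_neg_Q L1 L M = kB" unfolding n_neg_Q_def
    by (rule form_neg_index_eq[where Q = ?B, OF sub(1) kB(1)]) (simp add: Q_form_def omega_def)
  \<comment> \<open>Parametrising \<open>L2\<close> by \<open>L1\<close> turns the graph map of
    \<open>M\<close> into \<open>B.T - A.T\<close>, so the form on \<open>L2\<close> becomes B - A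
    on \<open>L1\<close>.\<close>
  moreover have "n_neg_Q L2 L M = lQ"
  proof -
    let ?g = "\<lambda>u. u + A.T u"
    have g: "clinear_on L1 ?g" by (auto simp: clinear_on_def A.T_linear scaleC_add_right)
    have "?g ` L1 = L2"
    proof (intro subset_antisym subsetI)
      fix b assume b: "b \<in> L2"
      obtain l u where u: "l \<in> L" "u \<in> L1" "b = l + u"
        using lagrangian_sum[OF K L(1) lagr(1) L(2)] by blast
      have l: "A.T u = l" using u b by (intro A.T_unique) (auto simp: add.commute)
      then have "b = ?g u" using u(3) by (simp add: add.commute)
      then show "b \<in> ?g ` L1" using u(2) by blast
    qed (use A.T_mem(2) in auto)
    moreover have "neg_index (?g ` L1) (\<lambda>u. Re (?B u u)) lQ"
    proof (rule neg_index_push[OF g sub(1) _ kQ(2)])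
      fix u assume "u \<in> L1"
      have "B.T (u + A.T u) = B.T u - A.T u"
      proof (rule B.T_unique)
        show "B.T u - A.T u \<in> L" using complex_vector.subspace_diff[OF sub(4) B.T_mem(1) A.T_mem(1)] .
        show "u + A.T u + (B.T u - A.T u) \<in> M" using B.T_mem(2)[of u] by (simp add: algebra_simps)
      qed
      moreover have "omega (A.T u) (B.T u - A.T u) = 0"
        using lagrangian_isotropic[OF L(1) A.T_mem(1)]
          complex_vector.subspace_diff[OF sub(4) B.T_mem(1) A.T_mem(1)] by blast
      ultimately show "- Re (?Q u u) = Re (?B (u + A.T u) (u + A.T u))"
        by (simp add: Q_form_def omega_algebra)
    qed
    ultimately show ?thesis unfolding n_neg_Q_def
      by (intro form_neg_index_eq[where Q = ?B, OF sub(2)]) (simp_all add: Q_form_def omega_def)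
  qed
  ultimately show ?thesis
    using kB(3) kQ(3) unfolding duistermaat_index_def L_def[symmetric] by (simp add: Let_def)
qed

section \<open>Resolvents of self-adjoint extensions\<close>

lemma csubspace_adjoint_op: "csubspace (adjoint_op S)"
proof (rule complex_vector.subspaceI)
  show "0 \<in> adjoint_op S" by (auto simp: adjoint_op_def zero_prod_def)
  show "x + y \<in> adjoint_op S" if "x \<in> adjoint_op S" "y \<in> adjoint_op S" for x y
    using that by (fastforce simp: adjoint_op_def cinner_algebra)
  show "c *\<^sub>C x \<in> adjoint_op S" if "x \<in> adjoint_op S" for c x
    using that by (fastforce simp: adjoint_op_def cinner_algebra scaleC_Pair)
qed

lemma omega_nondegenerate:
  assumes "\<And>v. omega u v = 0"
  shows "u = 0"
proof -
  have "omega u (0, fst u) = 0" "omega u (snd u, 0) = 0" using assms by blast+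
  then show ?thesis by (simp add: omega_def prod_eq_iff)
qed

definition boundary_map :: "('h \<Rightarrow> 'k) \<Rightarrow> ('h \<Rightarrow> 'k) \<Rightarrow> 'h \<Rightarrow> 'k \<times> 'k"
  where "boundary_map \<Gamma>0 \<Gamma>1 f = (\<Gamma>0 f, \<Gamma>1 f)"

text \<open>\<open>N\<close> and \<open>M\<close> depend only on the operator, the boundary maps and
  \<open>l\<close>, so instances for two different extensions share them.\<close>

locale self_adjoint_extension_at =
  fixes S H :: "('h::chilbert_space \<times> 'h) set" and n :: nat
    and \<Gamma>0 \<Gamma>1 :: "'h \<Rightarrow> 'k::chilbert_space" and L :: "('k \<times> 'k) set" and l :: real
  assumes triplet: "boundary_triplet S n \<Gamma>0 \<Gamma>1" and self_adjoint: "self_adjoint H"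
    and plane: "corresponding_plane S \<Gamma>0 \<Gamma>1 H L"
    and resolvent_set: "complex_of_real l \<in> resolvent_set H"
begin

abbreviation "\<Gamma> \<equiv> boundary_map \<Gamma>0 \<Gamma>1"
abbreviation "R \<equiv> resolvent H (complex_of_real l)"
abbreviation "N \<equiv> N_space S l"
abbreviation "M \<equiv> M_plane S \<Gamma>0 \<Gamma>1 l"

lemma finite_dim: "cfinite_dim (UNIV :: 'k set)" and edim_K: "edim (UNIV :: 'k set) = enat n"
  using triplet edim_eq_enatD by (auto simp: boundary_triplet_def)

lemma lagrangian: "lagrangian L"
  using plane by (simp add: corresponding_plane_def)

lemma H_iff: "(f, f') \<in> H \<longleftrightarrow> (f, f') \<in> adjoint_op S \<and> \<Gamma> f \<in> L"
  using plane by (auto simp: corresponding_plane_def boundary_map_def)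

lemma csubspace_H: "csubspace H"
  using self_adjoint by (simp add: self_adjoint_def linear_operator_def)

lemma H_symmetric: "(f, f') \<in> H \<Longrightarrow> (g, g') \<in> H \<Longrightarrow> cinner f g' = cinner f' g"
  using self_adjoint unfolding self_adjoint_def adjoint_op_def by blast

lemma csubspace_domain: "csubspace (Domain (adjoint_op S))"
  unfolding Domain_fst
  by (rule csubspace_image[OF _ csubspace_adjoint_op]) (simp add: clinear_on_def)

lemma \<Gamma>_linear: "clinear_on (Domain (adjoint_op S)) \<Gamma>"
  using triplet by (simp add: boundary_triplet_def boundary_map_def clinear_on_def scaleC_Pair)

lemmas \<Gamma>_simps = clinear_onD[OF \<Gamma>_linear csubspace_domain]

lemma green:
  assumes "(f, f') \<in> adjoint_op S" "(g, g') \<in> adjoint_op S"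
  shows "cinner f g' - cinner f' g = omega (\<Gamma> f) (\<Gamma> g)"
  using triplet assms by (force simp: boundary_triplet_def boundary_map_def omega_def)

lemma \<Gamma>_surj: obtains f f' where "(f, f') \<in> adjoint_op S" "\<Gamma> f = u"
proof -
  have "u \<in> \<Gamma> ` Domain (adjoint_op S)" using triplet by (simp add: boundary_triplet_def boundary_map_def [abs_def])
  then show thesis using that by blast
qed

lemma R_mem: "(R y, y + complex_of_real l *\<^sub>C R y) \<in> H"
proof -
  have "\<exists>!x. (x, y + complex_of_real l *\<^sub>C x) \<in> H"
    using resolvent_set by (simp add: resolvent_set_def)
  from theI'[OF this] show ?thesis by (simp add: resolvent_def)
qed

lemma R_eqI: "(x, y + complex_of_real l *\<^sub>C x) \<in> H \<Longrightarrow> R y = x"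
  using resolvent_set R_mem[of y] unfolding resolvent_set_def by blast

lemma R_adjoint: "(R y, y + complex_of_real l *\<^sub>C R y) \<in> adjoint_op S"
  and \<Gamma>_R: "\<Gamma> (R y) \<in> L"
  using R_mem H_iff by blast+

lemma R_domain: "R y \<in> Domain (adjoint_op S)"
  using R_adjoint by blast

lemma R_linear: "clinear_on UNIV R"
  unfolding clinear_on_def
proof (intro conjI ballI allI)
  fix x y c
  show "R (x + y) = R x + R y"
    using complex_vector.subspace_add[OF csubspace_H R_mem[of x] R_mem[of y]]
    by (intro R_eqI) (simp add: scaleC_add_right ac_simps)
  show "R (c *\<^sub>C x) = c *\<^sub>C R x"
    using complex_vector.subspace_scale[OF csubspace_H R_mem[of x], of c]
    by (intro R_eqI) (simp add: scaleC_Pair scaleC_add_right scaleC_scaleC mult.commute)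
qed

lemmas R_simps = clinear_onD[OF R_linear complex_vector.subspace_UNIV UNIV_I]

lemma R_zero: "R 0 = 0"
  by (rule clinear_on_zero[OF R_linear complex_vector.subspace_UNIV])

lemma R_hermitian: "cinner x (R y) = cinner (R x) y"
  using H_symmetric[OF R_mem[of x] R_mem[of y]] by (simp add: cinner_algebra)

lemma \<Gamma>_R_surj:
  assumes "a \<in> L"
  obtains y where "\<Gamma> (R y) = a"
proof -
  obtain g g' where g: "(g, g') \<in> adjoint_op S" "\<Gamma> g = a" by (rule \<Gamma>_surj)
  then have "R (g' - complex_of_real l *\<^sub>C g) = g" using assms H_iff by (intro R_eqI) simp
  then show thesis using that g(2) by metis
qed

lemma N_iff: "m \<in> N \<longleftrightarrow> (m, complex_of_real l *\<^sub>C m) \<in> adjoint_op S"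
  by (simp add: N_space_def ker_minus_def)

lemma N_domain: "N \<subseteq> Domain (adjoint_op S)"
  using N_iff by blast

lemma csubspace_N: "csubspace N"
proof -
  have "clinear_on UNIV (\<lambda>m :: 'h. (m, complex_of_real l *\<^sub>C m))"
    by (simp add: clinear_on_def scaleC_add_right scaleC_Pair complex_vector.scale_left_commute)
  from csubspace_vimage[OF this complex_vector.subspace_UNIV csubspace_adjoint_op[of S]]
  moreover have "N = {m \<in> UNIV. (m, complex_of_real l *\<^sub>C m) \<in> adjoint_op S}" using N_iff by blast
  ultimately show ?thesis by simp
qed

text \<open>Green's identity for \<open>R y\<close> and \<open>m\<close>, in which the terms with
  the real number \<open>l\<close> cancel. It expresses inner products with elements of
  \<open>N\<close> by boundary values and governs both the form of the resolvent difference and its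
  kernel.\<close>

lemma cinner_N: "m \<in> N \<Longrightarrow> cinner y m = - omega (\<Gamma> (R y)) (\<Gamma> m)"
  using green[OF R_adjoint[of y], of m "complex_of_real l *\<^sub>C m", symmetric]
  by (simp add: N_iff cinner_algebra)

text \<open>Such an \<open>m\<close> lies in the domain of \<open>H\<close> and in the kernel of
  \<open>H - l\<close>, which is trivial on the resolvent set.\<close>

lemma N_\<Gamma>_L:
  assumes "m \<in> N" "\<Gamma> m \<in> L"
  shows "m = 0"
proof -
  have "(m, 0 + complex_of_real l *\<^sub>C m) \<in> H" using assms H_iff N_iff by simp
  then have "R 0 = m" by (rule R_eqI)
  then show ?thesis using R_zero by simp
qed

lemma M_eq: "M = \<Gamma> ` N"
  by (simp add: M_plane_def boundary_map_def [abs_def])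

lemma csubspace_M: "csubspace M"
  unfolding M_eq by (rule csubspace_image[OF clinear_on_subset[OF \<Gamma>_linear N_domain] csubspace_N])

lemma M_L: "M \<inter> L = {0}"
proof -
  have "0 \<in> M \<inter> L"
    using complex_vector.subspace_0 csubspace_M lagrangian_subspace[OF lagrangian] by blast
  moreover have "u = 0" if "u \<in> M" "u \<in> L" for u
  proof -
    obtain m where m: "m \<in> N" "u = \<Gamma> m" using \<open>u \<in> M\<close> M_eq by blast
    then have "m = 0" using N_\<Gamma>_L \<open>u \<in> L\<close> by simp
    then show ?thesis using m clinear_on_zero[OF \<Gamma>_linear csubspace_domain] by simp
  qed
  ultimately show ?thesis by blast
qed

text \<open>Every \<open>f\<close> in the domain of the adjoint differs from
  \<open>R (f' - l f)\<close> by an element of \<open>N\<close>. This splits the domain into that of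
  \<open>H\<close> and \<open>N\<close>, and surjectivity of \<open>\<Gamma>\<close> transfers the
  splitting to boundary values.\<close>

lemma L_M_sum: "\<exists>a\<in>L. \<exists>m\<in>M. u = a + m"
proof -
  obtain f f' where f: "(f, f') \<in> adjoint_op S" "\<Gamma> f = u" by (rule \<Gamma>_surj)
  define y where "y = f' - complex_of_real l *\<^sub>C f"
  have "(f, f') - (R y, y + complex_of_real l *\<^sub>C R y) \<in> adjoint_op S"
    using complex_vector.subspace_diff[OF csubspace_adjoint_op f(1) R_adjoint] .
  then have N: "f - R y \<in> N"
    by (simp add: N_iff y_def complex_vector.scale_right_diff_distrib algebra_simps)
  have "\<Gamma> (f - R y) = \<Gamma> f - \<Gamma> (R y)" using f(1) R_domain by (intro \<Gamma>_simps(3)) blast+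
  then have "u = \<Gamma> (R y) + \<Gamma> (f - R y)" using f(2) by (simp add: prod_eq_iff)
  moreover have "\<Gamma> (f - R y) \<in> M" unfolding M_eq using N by blast
  ultimately show ?thesis using \<Gamma>_R by blast
qed

text \<open>Isotropy is Green's identity. For maximality, the \<open>L\<close>-component of a vector
  \<omega>-orthogonal to \<open>M\<close> is \<omega>-orthogonal to \<open>L\<close> and to
  \<open>M\<close>, hence to everything.\<close>

lemma lagrangian_M: "lagrangian M"
  unfolding lagrangian_def
proof (intro conjI subset_antisym subsetI)
  show "csubspace M" by (rule csubspace_M)
  have iso: "omega u v = 0" if "u \<in> M" "v \<in> M" for u v
  proof -
    obtain p q where pq: "p \<in> N" "q \<in> N" "u = \<Gamma> p" "v = \<Gamma> q" using \<open>u \<in> M\<close> \<open>v \<in> M\<close> M_eq by blast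
    then show ?thesis
      using green[of p "complex_of_real l *\<^sub>C p" q "complex_of_real l *\<^sub>C q"]
      by (simp add: N_iff cinner_algebra)
  qed
  then show "u \<in> {u. \<forall>v\<in>M. omega u v = 0}" if "u \<in> M" for u using that by blast
  fix u assume u: "u \<in> {u. \<forall>v\<in>M. omega u v = 0}"
  obtain a m where am: "a \<in> L" "m \<in> M" "u = a + m" using L_M_sum by blast
  have "omega a v = 0" for v
  proof -
    obtain b m' where bm: "b \<in> L" "m' \<in> M" "v = b + m'" using L_M_sum by blast
    have "omega a m' = 0" using u am bm(2) iso by (simp add: omega_algebra)
    then show ?thesis using lagrangian_isotropic[OF lagrangian am(1) bm(1)] bm(3)
      by (simp add: omega_algebra)
  qed
  then have "a = 0" by (rule omega_nondegenerate)
  then show "u \<in> M" using am by simp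
qed

text \<open>\<open>\<Gamma>\<close> maps \<open>N\<close> bijectively onto \<open>M\<close>, whose
  dimension is known because it is a Lagrangian plane. The inverse \<open>g\<close> is used because
  finite dimension is at hand for \<open>M\<close> only and has to be carried over to
  \<open>N\<close>.\<close>

lemma edim_N: "edim N = enat n" and cfinite_dim_N: "cfinite_dim N"
proof -
  define g where "g = (\<lambda>u. SOME m. m \<in> N \<and> \<Gamma> m = u)"
  have N0: "m = 0" if "m \<in> N" "\<Gamma> m = 0" for m
    using that N_\<Gamma>_L complex_vector.subspace_0[OF lagrangian_subspace[OF lagrangian]] by metis
  have g: "g u \<in> N \<and> \<Gamma> (g u) = u" if "u \<in> M" for u
    unfolding g_def by (rule someI_ex) (use that M_eq in auto)
  have g_eq: "g u = m" if "m \<in> N" "\<Gamma> m = u" for u m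
  proof -
    have u: "u \<in> M" using that M_eq by blast
    have N: "g u - m \<in> N" using g[OF u] that complex_vector.subspace_diff[OF csubspace_N] by blast
    have "\<Gamma> (g u - m) = \<Gamma> (g u) - \<Gamma> m"
      using g[OF u] that(1) N_domain by (intro \<Gamma>_simps(3)) blast+
    then have "\<Gamma> (g u - m) = 0" using g[OF u] that(2) by simp
    from N0[OF N this] show ?thesis by simp
  qed
  have lin: "clinear_on M g"
    unfolding clinear_on_def
  proof (intro conjI ballI allI)
    fix u v c assume uv: "u \<in> M" "v \<in> M"
    show "g (u + v) = g u + g v"
    proof (rule g_eq)
      show "g u + g v \<in> N" using g uv complex_vector.subspace_add[OF csubspace_N] by blast
      have "\<Gamma> (g u + g v) = \<Gamma> (g u) + \<Gamma> (g v)" using g uv N_domain by (intro \<Gamma>_simps(1)) blast+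
      then show "\<Gamma> (g u + g v) = u + v" using g uv by simp
    qed
    show "g (c *\<^sub>C u) = c *\<^sub>C g u"
    proof (rule g_eq)
      show "c *\<^sub>C g u \<in> N" using g uv complex_vector.subspace_scale[OF csubspace_N] by blast
      have "\<Gamma> (c *\<^sub>C g u) = c *\<^sub>C \<Gamma> (g u)" using g uv N_domain by (intro \<Gamma>_simps(2)) blast
      then show "\<Gamma> (c *\<^sub>C g u) = c *\<^sub>C u" using g uv by simp
    qed
  qed
  have fd: "cfinite_dim M"
    using cfinite_dim_subset[OF cfinite_dim_prod[OF finite_dim finite_dim] subset_UNIV] .
  have ker: "u = 0" if "u \<in> M" "g u = 0" for u
    using g[OF that(1)] that(2) clinear_on_zero[OF \<Gamma>_linear csubspace_domain] by simp
  have "g ` M = N"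
  proof (intro subset_antisym subsetI)
    fix m assume "m \<in> N"
    then have "\<Gamma> m \<in> M" "g (\<Gamma> m) = m" using M_eq g_eq by auto
    then show "m \<in> g ` M" by (metis imageI)
  qed (use g in auto)
  then show "edim N = enat n" "cfinite_dim N"
    using edim_linear_image[OF lin csubspace_M ker fd] edim_lagrangian[OF finite_dim lagrangian_M] edim_K
    by auto
qed

end

section \<open>The difference of two resolvents and its boundary values\<close>

locale self_adjoint_extension_pair_at =
  E1: self_adjoint_extension_at S H1 n \<Gamma>0 \<Gamma>1 L1 l + E2: self_adjoint_extension_at S H2 n \<Gamma>0 \<Gamma>1 L2 l
  for S H1 H2 :: "('h::chilbert_space \<times> 'h) set" and n :: nat
    and \<Gamma>0 \<Gamma>1 :: "'h \<Rightarrow> 'k::chilbert_space" and L1 L2 :: "('k \<times> 'k) set" and l :: real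
begin

abbreviation "D \<equiv> resolvent_difference H1 H2 l"

lemma D_eq: "D y = E1.R y - E2.R y"
  by (simp add: resolvent_difference_def)

lemma D_N: "D y \<in> E1.N"
  using complex_vector.subspace_diff[OF csubspace_adjoint_op E1.R_adjoint[of y] E2.R_adjoint[of y]]
  by (simp add: E1.N_iff D_eq complex_vector.scale_right_diff_distrib)

lemma \<Gamma>_D: "E1.\<Gamma> (D y) = E1.\<Gamma> (E1.R y) - E1.\<Gamma> (E2.R y)"
  unfolding D_eq by (rule E1.\<Gamma>_simps(3)[OF E1.R_domain E2.R_domain])

lemma D_linear: "clinear_on UNIV D"
  using E1.R_linear E2.R_linear
  by (simp add: clinear_on_def D_eq complex_vector.scale_right_diff_distrib)

lemma D_hermitian: "cinner x (D y) = cinner (D x) y"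
  by (simp add: D_eq cinner_algebra E1.R_hermitian E2.R_hermitian)

text \<open>Apply \<open>cinner_N\<close> to \<open>D y\<close>; the contribution of its
  \<open>L1\<close>-part drops out by isotropy.\<close>

lemma form_D: "cinner y (D y) = omega (E1.\<Gamma> (E1.R y)) (E1.\<Gamma> (E2.R y))"
  using E1.cinner_N[OF D_N, of y y] lagrangian_isotropic[OF E1.lagrangian E1.\<Gamma>_R E1.\<Gamma>_R]
  unfolding \<Gamma>_D by (simp add: omega_algebra)

lemma D_spectral:
  obtains B \<mu> where "finite_rank_operator D B \<mu>" "cspan B = E1.N"
  using finite_rank_operatorI[OF D_linear D_hermitian E1.csubspace_N E1.cfinite_dim_N D_N] by blast

lemma duistermaat_index:
  assumes k: "neg_index UNIV (\<lambda>y. Re (cinner y (D y))) k"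
  shows "duistermaat_index L1 L2 E1.M = int k"
proof (rule duistermaat_index_eq[OF E1.finite_dim E1.lagrangian E2.lagrangian E1.lagrangian_M E1.M_L E2.M_L])
  let ?X = "{(b, m). b \<in> L2 \<and> m \<in> E1.M \<and> b - m \<in> L1}"
  let ?f = "\<lambda>y. (E1.\<Gamma> (E2.R y), - E1.\<Gamma> (D y))"
  have f: "clinear_on UNIV ?f"
    unfolding clinear_on_def
  proof (intro conjI ballI allI)
    fix x y :: 'h and c
    have D: "D y \<in> Domain (adjoint_op S)" for y using D_N E1.N_domain by blast
    show "?f (x + y) = ?f x + ?f y"
      unfolding E2.R_simps(1)[OF UNIV_I] clinear_onD(1)[OF D_linear complex_vector.subspace_UNIV UNIV_I UNIV_I]
        E1.\<Gamma>_simps(1)[OF E2.R_domain E2.R_domain] E1.\<Gamma>_simps(1)[OF D D]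
      by simp
    show "?f (c *\<^sub>C x) = c *\<^sub>C ?f x"
      unfolding E2.R_simps(2) clinear_onD(2)[OF D_linear complex_vector.subspace_UNIV UNIV_I]
        E1.\<Gamma>_simps(2)[OF E2.R_domain] E1.\<Gamma>_simps(2)[OF D]
      by (simp add: scaleC_Pair complex_vector.scale_minus_right)
  qed
  have diff: "E1.\<Gamma> (E2.R y) - - E1.\<Gamma> (D y) = E1.\<Gamma> (E1.R y)" for y
    unfolding \<Gamma>_D by simp
  have "range ?f = ?X"
  proof (intro subset_antisym subsetI)
    fix z assume "z \<in> range ?f"
    then obtain y where z: "z = ?f y" by blast
    have "E1.\<Gamma> (D y) \<in> E1.M" unfolding E1.M_eq using D_N by blast
    then have "- E1.\<Gamma> (D y) \<in> E1.M" by (rule complex_vector.subspace_neg[OF E1.csubspace_M])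
    moreover have "E1.\<Gamma> (E2.R y) - - E1.\<Gamma> (D y) \<in> L1" unfolding diff by (rule E1.\<Gamma>_R)
    ultimately show "z \<in> ?X" unfolding z using E2.\<Gamma>_R by simp
  next
    fix z assume "z \<in> ?X"
    then obtain b m where bm: "z = (b, m)" "b \<in> L2" "m \<in> E1.M" "b - m \<in> L1" by blast
    \<comment> \<open>Matching the difference \<open>b - m\<close> is enough: the remaining
      discrepancy lies in \<open>L2\<close> and in \<open>M\<close> at once and is therefore
      0.\<close>
    obtain y where y: "E1.\<Gamma> (E1.R y) = b - m" using E1.\<Gamma>_R_surj[OF bm(4)] by blast
    have "b - E1.\<Gamma> (E2.R y) = m + E1.\<Gamma> (D y)" unfolding \<Gamma>_D y by simp
    moreover have "b - E1.\<Gamma> (E2.R y) \<in> L2"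
      using complex_vector.subspace_diff[OF lagrangian_subspace[OF E2.lagrangian] bm(2) E2.\<Gamma>_R] .
    moreover have "E1.\<Gamma> (D y) \<in> E1.M" unfolding E1.M_eq using D_N by blast
    then have "m + E1.\<Gamma> (D y) \<in> E1.M" by (rule complex_vector.subspace_add[OF E1.csubspace_M bm(3)])
    ultimately have "b - E1.\<Gamma> (E2.R y) = 0" "m + E1.\<Gamma> (D y) = 0" using E2.M_L by auto
    then have "b = E1.\<Gamma> (E2.R y)" "m = - E1.\<Gamma> (D y)"
      by (simp_all only: eq_neg_iff_add_eq_0 right_minus_eq)
    then show "z \<in> range ?f" unfolding bm(1) by blast
  qed
  moreover have "neg_index (range ?f) (\<lambda>(b, m). Re (omega (b - m) b)) k"
  proof (rule neg_index_push[OF f complex_vector.subspace_UNIV _ k])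
    fix y
    show "Re (cinner y (D y)) = (case ?f y of (b, m) \<Rightarrow> Re (omega (b - m) b))"
      unfolding form_D case_prod_conv diff ..
  qed
  ultimately show "neg_index ?X (\<lambda>(b, m). Re (omega (b - m) b)) k" by simp
qed

text \<open>Injectivity on the kernel comes from \<open>cinner_N\<close> with \<open>m = y\<close>:
  a vanishing boundary value forces \<open>cinner y y = 0\<close>.\<close>

lemma edim_ker_D: "edim (eigenspace E1.N D 0) = edim (L1 \<inter> L2)"
proof -
  let ?K = "eigenspace E1.N D 0" and ?f = "\<lambda>y. E1.\<Gamma> (E1.R y)"
  have K_iff: "y \<in> ?K \<longleftrightarrow> y \<in> E1.N \<and> D y = 0" for y
    by (simp add: eigenspace_def complex_vector.scale_zero_left)
  have K: "csubspace ?K"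
  proof -
    have "csubspace {y \<in> E1.N. D y \<in> {0}}"
      by (rule csubspace_vimage[OF clinear_on_subset[OF D_linear subset_UNIV] E1.csubspace_N
            complex_vector.subspace_single_0])
    moreover have "?K = {y \<in> E1.N. D y \<in> {0}}" using K_iff by blast
    ultimately show ?thesis by simp
  qed
  have "clinear_on UNIV ?f"
    unfolding clinear_on_def
    by (simp only: E1.R_simps(1)[OF UNIV_I] E1.R_simps(2) E1.\<Gamma>_simps(1)[OF E1.R_domain E1.R_domain]
        E1.\<Gamma>_simps(2)[OF E1.R_domain] simp_thms ball_triv)
  then have f: "clinear_on ?K ?f" by (rule clinear_on_subset) simp
  have ker: "y = 0" if "y \<in> ?K" "?f y = 0" for y
  proof -
    have "y \<in> E1.N" using that K_iff by blast
    then have "cinner y y = 0" using E1.cinner_N[of y y] that(2) by (simp add: omega_def)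
    then show ?thesis by simp
  qed
  have "?f ` ?K = L1 \<inter> L2"
  proof (intro subset_antisym subsetI)
    fix a assume "a \<in> ?f ` ?K"
    then obtain y where y: "a = ?f y" "D y = 0" using K_iff by blast
    then have "E1.R y = E2.R y" by (simp add: D_eq)
    then show "a \<in> L1 \<inter> L2" using E1.\<Gamma>_R[of y] E2.\<Gamma>_R[of y] y(1) by simp
  next
    fix a assume a: "a \<in> L1 \<inter> L2"
    then obtain x where x: "E1.\<Gamma> (E1.R x) = a" using E1.\<Gamma>_R_surj by blast
    \<comment> \<open>An arbitrary preimage \<open>x\<close> may be replaced by its projection onto
      \<open>N\<close>: for the part orthogonal to \<open>N\<close> the boundary value of the
      resolvent is \<omega>-orthogonal to \<open>M\<close>, hence lies in \<open>M\<close> and in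
      \<open>L1\<close>, hence is 0.\<close>
    from orthogonal_projection[OF E1.csubspace_N E1.cfinite_dim_N]
    obtain y where y: "y \<in> E1.N" "\<forall>w\<in>E1.N. cinner w (x - y) = 0" ..
    let ?c = "?f (x - y)"
    have "omega ?c u = 0" if "u \<in> E1.M" for u
    proof -
      from that obtain w where w: "w \<in> E1.N" "u = E1.\<Gamma> w" unfolding E1.M_eq by blast
      have "cinner (x - y) w = 0" using y(2) w(1) cinner_commute[of "x - y" w] by simp
      then show ?thesis using E1.cinner_N[OF w(1), of "x - y"] w(2) by simp
    qed
    then have "?c \<in> E1.M" by (rule lagrangian_maximal[OF E1.lagrangian_M])
    then have c: "?c = 0" using E1.\<Gamma>_R E1.M_L by blast
    moreover have "?c = ?f x - ?f y"
      unfolding E1.R_simps(3)[OF UNIV_I] by (rule E1.\<Gamma>_simps(3)[OF E1.R_domain E1.R_domain])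
    ultimately have ya: "?f y = a" using x by simp
    \<comment> \<open>Because \<open>a\<close> lies in \<open>L2\<close> too, \<open>E1.R y\<close>
      belongs to the domain of \<open>H2\<close>, which makes the two resolvents agree at
      \<open>y\<close>.\<close>
    then have "(E1.R y, y + complex_of_real l *\<^sub>C E1.R y) \<in> H2"
      using a E1.R_adjoint E2.H_iff by simp
    then have "E2.R y = E1.R y" by (rule E2.R_eqI)
    then have "y \<in> ?K" using y(1) K_iff by (simp add: D_eq)
    then show "a \<in> ?f ` ?K" using ya by blast
  qed
  moreover have "cfinite_dim ?K"
    by (rule cfinite_dim_subset[OF E1.cfinite_dim_N]) (auto simp: eigenspace_def)
  ultimately show ?thesis using edim_linear_image(1)[OF f K ker] by simp
qed

end

section \<open>Dependence on the spectral parameter\<close>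

text \<open>For \<open>x\<close> the resolvent value at \<open>l\<close>, the identity
  \<open>x - ?R0 y = (l - l0) ?R0 x\<close> holds. As both points lie in the resolvent set, an a
  priori bound on \<open>x\<close> replaces a Neumann series.\<close>

lemma resolvent_continuous:
  fixes H :: "('h::chilbert_space \<times> 'h) set" and l0 :: real
  assumes l0: "complex_of_real l0 \<in> resolvent_set H" and "\<epsilon> > 0"
  shows "\<exists>\<eta>>0. \<forall>l::real. \<bar>l - l0\<bar> < \<eta> \<longrightarrow> complex_of_real l \<in> resolvent_set H \<longrightarrow>
    (\<forall>y. norm (resolvent H (complex_of_real l) y - resolvent H (complex_of_real l0) y) \<le> \<epsilon> * norm y)"
proof -
  let ?R0 = "resolvent H (complex_of_real l0)"
  have mem: "(resolvent H z y, y + z *\<^sub>C resolvent H z y) \<in> H" if "z \<in> resolvent_set H" for z y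
  proof -
    have "\<exists>!x. (x, y + z *\<^sub>C x) \<in> H" using that by (simp add: resolvent_set_def)
    from theI'[OF this] show ?thesis by (simp add: resolvent_def)
  qed
  have uniq: "?R0 y = x" if "(x, y + complex_of_real l0 *\<^sub>C x) \<in> H" for x y
    using l0 mem[OF l0, of y] that unfolding resolvent_set_def by blast
  have bl: "bounded_linear ?R0" using l0 by (simp add: resolvent_set_def)
  then obtain C where C: "C > 0" "\<And>y. norm (?R0 y) \<le> norm y * C"
    using bounded_linear.pos_bounded by blast
  \<comment> \<open>The first bound gives \<open>\<bar>l - l0\<bar> * C \<le> 1 / 2\<close>, so
    \<open>x\<close> can be absorbed and has norm at most 2C times that of \<open>y\<close>. The
    second makes the resulting factor \<open>\<bar>l - l0\<bar> * 2 * C * C\<close> at most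
    \<open>\<epsilon>\<close>.\<close>
  define \<eta> where "\<eta> = min (1 / (2 * C)) (\<epsilon> / (2 * C * C))"
  have "norm (resolvent H (complex_of_real l) y - ?R0 y) \<le> \<epsilon> * norm y"
    if l: "\<bar>l - l0\<bar> < \<eta>" "complex_of_real l \<in> resolvent_set H" for l y
  proof -
    define x where "x = resolvent H (complex_of_real l) y"
    have "(x, (y + (l - l0) *\<^sub>R x) + complex_of_real l0 *\<^sub>C x) \<in> H"
      using mem[OF l(2), of y] by (simp add: x_def scaleR_scaleC complex_vector.scale_left_diff_distrib)
    then have "x = ?R0 (y + (l - l0) *\<^sub>R x)" by (rule uniq[symmetric])
    also have "\<dots> = ?R0 y + (l - l0) *\<^sub>R ?R0 x"
      using bl by (simp add: bounded_linear.linear linear_add linear_scale)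
    finally have x: "x - ?R0 y = (l - l0) *\<^sub>R ?R0 x" by (simp add: algebra_simps)
    have diff: "norm (x - ?R0 y) \<le> \<bar>l - l0\<bar> * (norm x * C)"
      unfolding x norm_scaleR by (intro mult_left_mono C(2)) simp
    have "\<bar>l - l0\<bar> * C \<le> 1 / 2" using l(1) C(1) by (simp add: \<eta>_def field_simps)
    then have "\<bar>l - l0\<bar> * (norm x * C) \<le> 1 / 2 * norm x"
      using mult_right_mono[of "\<bar>l - l0\<bar> * C" "1 / 2" "norm x"] by (simp add: mult_ac)
    moreover have "norm x \<le> norm (x - ?R0 y) + norm (?R0 y)"
      using norm_triangle_ineq[of "x - ?R0 y" "?R0 y"] by simp
    ultimately have nx: "norm x \<le> 2 * (norm y * C)" using diff C(2)[of y] by linarith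
    have "\<bar>l - l0\<bar> * (norm x * C) \<le> \<bar>l - l0\<bar> * (2 * (norm y * C) * C)"
      using nx C(1) by (intro mult_left_mono mult_right_mono) auto
    also have "\<dots> = (\<bar>l - l0\<bar> * (2 * C * C)) * norm y" by (simp add: mult_ac)
    also have "\<dots> \<le> \<epsilon> * norm y"
      using l(1) C(1) by (intro mult_right_mono) (auto simp: \<eta>_def field_simps)
    finally show ?thesis using diff unfolding x_def by linarith
  qed
  moreover have "\<eta> > 0" using C(1) \<open>\<epsilon> > 0\<close> by (simp add: \<eta>_def)
  ultimately show ?thesis by blast
qed

lemma locally_constant_onI:
  fixes f :: "real \<Rightarrow> 'b"
  assumes "\<And>x. x \<in> S \<Longrightarrow> \<exists>\<eta>>0. \<forall>y\<in>S. \<bar>y - x\<bar> < \<eta> \<longrightarrow> f y = f x"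
  shows "locally (\<lambda>U. f constant_on U) S"
proof (rule locallyI)
  fix w x assume w: "openin (top_of_set S) w" "x \<in> w"
  then have "x \<in> S" using openin_imp_subset by blast
  then obtain \<eta> where \<eta>: "\<eta> > 0" "\<And>y. y \<in> S \<Longrightarrow> \<bar>y - x\<bar> < \<eta> \<Longrightarrow> f y = f x" using assms by blast
  define u where "u = w \<inter> ball x \<eta>"
  have "openin (top_of_set S) u"
    unfolding u_def using w(1) by (simp add: openin_Int_open)
  moreover have "f constant_on u"
    unfolding constant_on_def u_def
    using \<eta>(2) openin_imp_subset[OF w(1)] by (intro exI[of _ "f x"]) (auto simp: dist_real_def abs_minus_commute)
  moreover have "x \<in> u" "u \<subseteq> w" using w(2) \<eta>(1) by (auto simp: u_def)
  ultimately show "\<exists>u v. openin (top_of_set S) u \<and> f constant_on v \<and> x \<in> u \<and> u \<subseteq> v \<and> v \<subseteq> w"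
    by blast
qed

theorem theorem1p3:
  fixes S H1 H2 :: "('h::chilbert_space \<times> 'h) set"
    and \<Gamma>0 \<Gamma>1 :: "'h \<Rightarrow> 'k::chilbert_space"
    and L1 L2 :: "('k \<times> 'k) set"
    and n :: nat
  assumes "separable_space (euclidean :: 'h topology)"
    and "linear_operator S" and "closed S" and "bounded_from_below S"
    and "densely_defined S" and "symmetric_operator S"
    and "defect_numbers S = (enat n, enat n)"
    and "boundary_triplet S n \<Gamma>0 \<Gamma>1"
    and "self_adjoint_extension S H1" and "self_adjoint_extension S H2"
    and "corresponding_plane S \<Gamma>0 \<Gamma>1 H1 L1" and "corresponding_plane S \<Gamma>0 \<Gamma>1 H2 L2"
  shows "(\<forall>l \<in> common_real_resolvent_set H1 H2.
        ereal_of_enat (n_neg UNIV (resolvent_difference H1 H2 l))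
          = ereal (real_of_int (duistermaat_index L1 L2 (M_plane S \<Gamma>0 \<Gamma>1 l)))
      \<and> ereal_of_enat (n_pos UNIV (resolvent_difference H1 H2 l))
          = ereal (real_of_int (duistermaat_index L2 L1 (M_plane S \<Gamma>0 \<Gamma>1 l)))
      \<and> n_zero (N_space S l) (resolvent_difference H1 H2 l) = edim (L1 \<inter> L2)
      \<and> ereal_of_enat (edim (range (resolvent_difference H1 H2 l)))
          = ereal (real n) - ereal_of_enat (edim (L1 \<inter> L2)))
    \<and> locally (\<lambda>U. (\<lambda>l. n_pos UNIV (resolvent_difference H1 H2 l)) constant_on U)
        (common_real_resolvent_set H1 H2)
    \<and> locally (\<lambda>U. (\<lambda>l. n_neg UNIV (resolvent_difference H1 H2 l)) constant_on U)
        (common_real_resolvent_set H1 H2)"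
proof -
  let ?I = "common_real_resolvent_set H1 H2" and ?D = "resolvent_difference H1 H2"
  \<comment> \<open>Exchanging the extensions changes the sign of the operator, so the formula for
    positive eigenvalues is the one for negative eigenvalues of the swapped pair.\<close>
  have swap: "resolvent_difference H2 H1 l = (\<lambda>x. - ?D l x)" for l
    by (simp add: resolvent_difference_def fun_eq_iff)
  have pair: "self_adjoint_extension_pair_at S H1 H2 n \<Gamma>0 \<Gamma>1 L1 L2 l"
    "self_adjoint_extension_pair_at S H2 H1 n \<Gamma>0 \<Gamma>1 L2 L1 l" if "l \<in> ?I" for l
    using assms that
    by (auto simp: self_adjoint_extension_pair_at_def self_adjoint_extension_at_def
        self_adjoint_extension_def common_real_resolvent_set_def)
  have spectral: "\<exists>B \<mu>. finite_rank_operator (?D l) B \<mu> \<and> cspan B = N_space S l" if "l \<in> ?I" for l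
  proof -
    interpret P: self_adjoint_extension_pair_at S H1 H2 n \<Gamma>0 \<Gamma>1 L1 L2 l by (rule pair(1)[OF that])
    show ?thesis using P.D_spectral by metis
  qed
  \<comment> \<open>The \<open>n\<close> basis vectors of \<open>N_space S l\<close> are sorted by
    the sign of the eigenvalue; the number with eigenvalue 0 is fixed by the planes and does not
    depend on \<open>l\<close>.\<close>
  have card: "card {b\<in>B. \<mu> b < 0} + card {b\<in>B. \<mu> b > 0} + cdim (L1 \<inter> L2) = n
      \<and> edim (L1 \<inter> L2) = enat (card {b\<in>B. \<mu> b = 0})"
    if l: "l \<in> ?I" and D: "finite_rank_operator (?D l) B \<mu>" and B: "cspan B = N_space S l" for l B \<mu>
  proof -
    interpret P: self_adjoint_extension_pair_at S H1 H2 n \<Gamma>0 \<Gamma>1 L1 L2 l by (rule pair(1)[OF l])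
    interpret D: finite_rank_operator "?D l" B \<mu> by (rule D)
    have "edim (L1 \<inter> L2) = enat (card {b\<in>B. \<mu> b = 0})"
      using P.edim_ker_D D.edim_kernel B by simp
    moreover have "enat (card B) = enat n" using D.independent[of B] P.E1.edim_N B by simp
    ultimately show ?thesis using D.card_split edim_eq_enatD by (metis enat.inject)
  qed
  have formulas: "ereal_of_enat (n_neg UNIV (?D l))
          = ereal (real_of_int (duistermaat_index L1 L2 (M_plane S \<Gamma>0 \<Gamma>1 l)))
      \<and> ereal_of_enat (n_pos UNIV (?D l))
          = ereal (real_of_int (duistermaat_index L2 L1 (M_plane S \<Gamma>0 \<Gamma>1 l)))
      \<and> n_zero (N_space S l) (?D l) = edim (L1 \<inter> L2)
      \<and> ereal_of_enat (edim (range (?D l))) = ereal (real n) - ereal_of_enat (edim (L1 \<inter> L2))"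
    if l: "l \<in> ?I" for l
  proof -
    obtain B \<mu> where fr: "finite_rank_operator (?D l) B \<mu>" and B: "cspan B = N_space S l"
      using spectral[OF l] by blast
    interpret P: self_adjoint_extension_pair_at S H1 H2 n \<Gamma>0 \<Gamma>1 L1 L2 l by (rule pair(1)[OF l])
    interpret Q: self_adjoint_extension_pair_at S H2 H1 n \<Gamma>0 \<Gamma>1 L2 L1 l by (rule pair(2)[OF l])
    interpret D: finite_rank_operator "?D l" B \<mu> by (rule fr)
    interpret E: finite_rank_operator "\<lambda>x. - ?D l x" B "\<lambda>b. - \<mu> b" by (rule D.finite_rank_uminus)
    note c = card[OF l fr B]
    have "duistermaat_index L1 L2 (M_plane S \<Gamma>0 \<Gamma>1 l) = int (card {b\<in>B. \<mu> b < 0})"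
      by (rule P.duistermaat_index[OF D.neg_index_form])
    moreover have "duistermaat_index L2 L1 (M_plane S \<Gamma>0 \<Gamma>1 l) = int (card {b\<in>B. - \<mu> b < 0})"
      by (rule Q.duistermaat_index) (unfold swap, rule E.neg_index_form)
    moreover have "n_zero (N_space S l) (?D l) = edim (L1 \<inter> L2)"
      using D.n_zero_eq P.edim_ker_D B by simp
    moreover have "card {b\<in>B. \<mu> b \<noteq> 0} + card {b\<in>B. \<mu> b = 0} = n"
      using c D.card_split(1) edim_eq_enatD[of "L1 \<inter> L2"] by simp
    then have "ereal_of_enat (edim (range (?D l))) = ereal (real n) - ereal_of_enat (edim (L1 \<inter> L2))"
      using c D.edim_range by auto
    ultimately show ?thesis unfolding D.n_neg_eq D.n_pos_eq by simp
  qed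
  have const: "\<exists>\<eta>>0. \<forall>l\<in>?I. \<bar>l - l0\<bar> < \<eta> \<longrightarrow>
      n_neg UNIV (?D l) = n_neg UNIV (?D l0) \<and> n_pos UNIV (?D l) = n_pos UNIV (?D l0)"
    if l0: "l0 \<in> ?I" for l0
  proof -
    obtain B0 \<mu>0 where fr0: "finite_rank_operator (?D l0) B0 \<mu>0" and B0: "cspan B0 = N_space S l0"
      using spectral[OF l0] by blast
    interpret D0: finite_rank_operator "?D l0" B0 \<mu>0 by (rule fr0)
    interpret E0: finite_rank_operator "\<lambda>x. - ?D l0 x" B0 "\<lambda>b. - \<mu>0 b" by (rule D0.finite_rank_uminus)
    obtain \<epsilon>1 where \<epsilon>1: "\<epsilon>1 > 0" "\<And>E k. (\<And>x. norm (E x - ?D l0 x) \<le> \<epsilon>1 * norm x) \<Longrightarrow>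
        neg_index UNIV (\<lambda>x. Re (cinner x (E x))) k \<Longrightarrow> card {b\<in>B0. \<mu>0 b < 0} \<le> k"
      using D0.neg_index_lower_semicontinuous by blast
    obtain \<epsilon>2 where \<epsilon>2: "\<epsilon>2 > 0" "\<And>E k. (\<And>x. norm (E x - - ?D l0 x) \<le> \<epsilon>2 * norm x) \<Longrightarrow>
        neg_index UNIV (\<lambda>x. Re (cinner x (E x))) k \<Longrightarrow> card {b\<in>B0. - \<mu>0 b < 0} \<le> k"
      using E0.neg_index_lower_semicontinuous by blast
    \<comment> \<open>Each of the two resolvents may use up half of the admissible
      perturbation.\<close>
    define \<epsilon> where "\<epsilon> = min \<epsilon>1 \<epsilon>2"
    have "\<epsilon> / 2 > 0" using \<epsilon>1(1) \<epsilon>2(1) by (simp add: \<epsilon>_def)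
    have res: "complex_of_real l \<in> resolvent_set H1" "complex_of_real l \<in> resolvent_set H2"
      if "l \<in> ?I" for l using that by (auto simp: common_real_resolvent_set_def)
    obtain \<eta>1 where \<eta>1: "\<eta>1 > 0" "\<And>l y. \<bar>l - l0\<bar> < \<eta>1 \<Longrightarrow> l \<in> ?I \<Longrightarrow>
        norm (resolvent H1 (complex_of_real l) y - resolvent H1 (complex_of_real l0) y) \<le> \<epsilon> / 2 * norm y"
      using resolvent_continuous[OF res(1)[OF l0] \<open>\<epsilon> / 2 > 0\<close>] res(1) by blast
    obtain \<eta>2 where \<eta>2: "\<eta>2 > 0" "\<And>l y. \<bar>l - l0\<bar> < \<eta>2 \<Longrightarrow> l \<in> ?I \<Longrightarrow>
        norm (resolvent H2 (complex_of_real l) y - resolvent H2 (complex_of_real l0) y) \<le> \<epsilon> / 2 * norm y"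
      using resolvent_continuous[OF res(2)[OF l0] \<open>\<epsilon> / 2 > 0\<close>] res(2) by blast
    have "n_neg UNIV (?D l) = n_neg UNIV (?D l0) \<and> n_pos UNIV (?D l) = n_pos UNIV (?D l0)"
      if l: "l \<in> ?I" and near: "\<bar>l - l0\<bar> < min \<eta>1 \<eta>2" for l
    proof -
      obtain B \<mu> where fr: "finite_rank_operator (?D l) B \<mu>" and B: "cspan B = N_space S l"
        using spectral[OF l] by blast
      interpret D: finite_rank_operator "?D l" B \<mu> by (rule fr)
      interpret E: finite_rank_operator "\<lambda>x. - ?D l x" B "\<lambda>b. - \<mu> b" by (rule D.finite_rank_uminus)
      have diff: "norm (?D l x - ?D l0 x) \<le> \<epsilon> * norm x" for x
      proof -
        have "?D l x - ?D l0 x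
          = (resolvent H1 (complex_of_real l) x - resolvent H1 (complex_of_real l0) x)
            - (resolvent H2 (complex_of_real l) x - resolvent H2 (complex_of_real l0) x)"
          by (simp add: resolvent_difference_def)
        also have "norm \<dots> \<le> \<epsilon> / 2 * norm x + \<epsilon> / 2 * norm x"
          using near l by (intro order_trans[OF norm_triangle_ineq4] add_mono \<eta>1(2) \<eta>2(2)) auto
        finally show ?thesis by simp
      qed
      have "norm (?D l x - ?D l0 x) \<le> \<epsilon>1 * norm x" for x
        by (rule order_trans[OF diff]) (simp add: \<epsilon>_def mult_right_mono)
      then have neg: "card {b\<in>B0. \<mu>0 b < 0} \<le> card {b\<in>B. \<mu> b < 0}"
        by (rule \<epsilon>1(2)[OF _ D.neg_index_form])
      have "norm (- ?D l x - - ?D l0 x) \<le> \<epsilon>2 * norm x" for x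
      proof -
        have "norm (- ?D l x - - ?D l0 x) = norm (?D l x - ?D l0 x)"
          by (simp add: norm_minus_commute)
        also have "\<dots> \<le> \<epsilon>2 * norm x"
          by (rule order_trans[OF diff]) (simp add: \<epsilon>_def mult_right_mono)
        finally show ?thesis .
      qed
      then have "card {b\<in>B0. - \<mu>0 b < 0} \<le> card {b\<in>B. - \<mu> b < 0}"
        by (rule \<epsilon>2(2)[OF _ E.neg_index_form])
      \<comment> \<open>Neither count is smaller at \<open>l\<close> than at \<open>l0\<close>, and
        by \<open>card\<close> both points have the same sum of counts, so both counts
        agree.\<close>
      then show ?thesis
        using neg card[OF l fr B] card[OF l0 fr0 B0]
        unfolding D.n_neg_eq D.n_pos_eq D0.n_neg_eq D0.n_pos_eq by simp
    qed
    moreover have "min \<eta>1 \<eta>2 > 0" using \<eta>1(1) \<eta>2(1) by simp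
    ultimately show ?thesis by blast
  qed
  have "locally (\<lambda>U. (\<lambda>l. n_pos UNIV (?D l)) constant_on U) ?I"
    by (rule locally_constant_onI) (use const in blast)
  moreover have "locally (\<lambda>U. (\<lambda>l. n_neg UNIV (?D l)) constant_on U) ?I"
    by (rule locally_constant_onI) (use const in blast)
  ultimately show ?thesis using formulas by blast
qed

end
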